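(* Let $\eta_\infty,\kappa_0,\kappa_\infty\in\mathbb{C}$ with $\eta_\infty\kappa_0\neq0$, and consider the Hamiltonian system $y_3'=\partial H/\partial z_3$, $z_3'=-\partial H/\partial y_3$ with Hamiltonian $$H(y_3,z_3;x)=\frac1x\left(2y_3^2z_3^2+\eta_\infty\kappa_\infty x\,y_3+\frac{\kappa_0x}{y_3}-z_3\left(2\eta_\infty x\,y_3^2+y_3\right)\right).$$ Let $q=q(x)$ be a solution of $(\mathrm{P}_{\mathrm{III}},D_7)$ with $\delta=0$ and parameters $\alpha=-4\kappa_\infty\eta_\infty$, $\beta=4\kappa_0$, $\gamma=4\eta_\infty^2$. Applying to this system the transformation $(y_3,z_3)\mapsto(y,z)$ defined by $$y_3=z+q,\qquad z_3=yz+\frac{x\,\eta_\infty}{2}+\frac{x\,q'}{4q^2}+\frac{1}{4q}$$ gives rise to the system $$\begin{cases}\begin{aligned} y'&=-\frac{1}{4x(q+z)^2}\Bigg(\left(\frac{z^2}{q^2}+\frac{2z}{q}+1\right)\left(\frac{x^2(q')^2}{q^2}+\frac{2xq'}{q}\right)+\frac{q'}{q}\left(\frac{3z}{q}+10\right)\left(4xyz^2\right)\\ &\quad-4\left(x^2\eta_\infty^2(q+z)^2-2y\left(q^2\left(18yz^2+1\right)+4z^2\left(yz^2+1\right)\right)-7yzq\left(4yz^2+1\right)\right)\\ &\quad+4xy(4q+11z)q'+8y^2q^3(2q+10z)+\frac{z}{q}\left(\frac{z}{q}+12yz^2+2\right)+\frac{4x\kappa_0}{q}\left(\frac{z}{q}+2\right)+1\Bigg),\end{aligned}\\[8ex]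 z'=\dfrac{q'}{q}\left(\dfrac{z^2}{q}+2z\right)+\dfrac{4yz}{x}(q+z)^2+\dfrac{z}{x}\left(\dfrac{z}{q}+1\right),\end{cases}$$ and this system is Bureau-Guillot for $(\mathrm{P}_{\mathrm{III}},D_7)$.
   Context: The independent variable is $x\in\mathbb{C}$ and $'=d/dx$. The third Painlevé equation is $y''=\frac{(y')^2}{y}-\frac{y'}{x}+\frac{\alpha y^2+\beta}{x}+\gamma y^3+\frac{\delta}{y}$; $(\mathrm{P}_{\mathrm{III}},D_7)$ is this equation with $\gamma=0$, $\alpha\delta\neq0$ or with $\delta=0$, $\beta\gamma\neq0$ (the version used here). The Hamiltonian system with coefficients rational in $x$ associated with $(\mathrm{P}_{\mathrm{III}},D_7)$, $\delta=0$, is the one with the Hamiltonian $H$ in the claim (its component $y_3$ satisfies this equation with the stated parameters). Regularisation process. A system $y'=P(y,z;x)$, $z'=Q(y,z;x)$, with $P,Q$ rational in $(y,z)$ and coefficients depending on $x$, is extended to $\mathbb{P}^2$, covered by the affine charts $(y,z)$, $(u_0,v_0)$, $(U_0,V_0)$ with $[1:y:z]=[u_0:1:v_0]=[V_0:U_0:1]$. In each chart one looks for base points, i.e. points where the right-hand side of one of the (rational) equations becomes $0/0$. Each base point (in a chart $(y,z)$, at $(a,b)$) is blown up, by introducing the charts $u=y-a$, $v=\frac{z-b}{y-a}$ and $U=\frac{y-a}{z-b}$, $V=z-b$, with exceptional curve $\{u=0\}\cup\{V=0\}$; new base points on it are blown up again, which gives for each base point one or more finite sequences ("cascades") of blow-ups,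 until no indeterminacy is left in the final charts. The system is regularised if in every cascade it is regular on the last exceptional curve in one of the final charts. The regularising conditions are the (differential) constraints on the coefficient functions of the system which make it regular on the last exceptional curves in this sense. Definition. A system $y'=P(y,z;x)$, $z'=Q(y,z;x)$ is an analogue of the Bureau-Guillot system (Bureau-Guillot, for short) for $(\mathrm{P}_{\mathrm J})$ if: (i) it is birationally equivalent (by a transformation of $(y,z)$ with coefficients depending on $x$) to the Hamiltonian system with coefficients rational in $x$ associated with $(\mathrm{P}_{\mathrm J})$; (ii) it has coefficient functions both rational and meromorphic in $x$ which are functions of the Painlevé transcendent $\mathrm{P}_{\mathrm J}$ (here $q$) and its derivatives; (iii) the Painlevé equation $(\mathrm{P}_{\mathrm J})$ is obtained as a regularising condition in the regularisation process of the system, i.e., regarding $q$ as an a priori undetermined function, the regularising conditions are differential equations for $q$ that are satisfied when $q$ solves $(\mathrm{P}_{\mathrm J})$. *)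

theory Defs
  imports "HOL-Complex_Analysis.Complex_Analysis"
begin

text \<open>
  Throughout, "for almost all \<open>x\<close> in \<open>D\<close>" means off a set that is sparse in \<open>D\<close>
  (the filter \<^const>\<open>cosparse\<close>). Functions that are \<^const>\<open>meromorphic_on\<close> a domain carry
  arbitrary values at their poles, so identities between them are asserted almost everywhere.
\<close>

definition domain_in_C :: "complex set \<Rightarrow> bool" where
  "domain_in_C D \<longleftrightarrow> open D \<and> connected D \<and> D \<noteq> {}"

text \<open>The right-hand sides \<open>P\<close>, \<open>Q\<close> of a system take their arguments in the order
  \<open>x\<close>, \<open>y\<close>, \<open>z\<close>.\<close>

type_synonym system =
  "(complex \<Rightarrow> complex \<Rightarrow> complex \<Rightarrow> complex) \<times> (complex \<Rightarrow> complex \<Rightarrow> complex \<Rightarrow> complex)"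

definition solution_near ::
  "system \<Rightarrow> (complex \<Rightarrow> complex) \<Rightarrow> (complex \<Rightarrow> complex) \<Rightarrow> complex \<Rightarrow> bool" where
  "solution_near S y z x \<longleftrightarrow> (\<forall>\<^sub>F t in nhds x.
     (y has_field_derivative fst S t (y t) (z t)) (at t) \<and>
     (z has_field_derivative snd S t (y t) (z t)) (at t))"


section \<open>The third Painleve equation and its Hamiltonian system\<close>

definition solves_PIII ::
  "complex \<Rightarrow> complex \<Rightarrow> complex \<Rightarrow> complex \<Rightarrow> complex set \<Rightarrow> (complex \<Rightarrow> complex) \<Rightarrow> bool" where
  "solves_PIII \<alpha> \<beta> \<gamma> \<delta> D y \<longleftrightarrow> y meromorphic_on D \<and>
     (\<forall>\<^sub>\<approx>x\<in>D. y x \<noteq> 0 \<and>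
        deriv (deriv y) x = (deriv y x)\<^sup>2 / y x - deriv y x / x
          + (\<alpha> * (y x)\<^sup>2 + \<beta>) / x + \<gamma> * (y x) ^ 3 + \<delta> / y x)"

definition H_D7 ::
  "complex \<Rightarrow> complex \<Rightarrow> complex \<Rightarrow> complex \<Rightarrow> complex \<Rightarrow> complex \<Rightarrow> complex" where
  "H_D7 \<eta> \<kappa>\<^sub>0 \<kappa>\<^sub>i y3 z3 x = 1 / x *
     (2 * y3\<^sup>2 * z3\<^sup>2 + \<eta> * \<kappa>\<^sub>i * x * y3 + \<kappa>\<^sub>0 * x / y3 - z3 * (2 * \<eta> * x * y3\<^sup>2 + y3))"

definition hamiltonian_system :: "(complex \<Rightarrow> complex \<Rightarrow> complex \<Rightarrow> complex) \<Rightarrow> system" where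
  "hamiltonian_system H =
     (\<lambda>x y z. deriv (\<lambda>w. H y w x) z, \<lambda>x y z. - deriv (\<lambda>w. H w z x) y)"


section \<open>Birational equivalence\<close>

definition bipoly :: "nat \<Rightarrow> (nat \<Rightarrow> nat \<Rightarrow> 'k) \<Rightarrow> 'k \<Rightarrow> 'k \<Rightarrow> 'k::comm_semiring_1" where
  "bipoly n c y z = (\<Sum>i\<le>n. \<Sum>j\<le>n. c i j * y ^ i * z ^ j)"

definition rational_yz ::
  "complex set \<Rightarrow> (complex \<Rightarrow> complex \<Rightarrow> complex \<Rightarrow> complex) \<Rightarrow> bool" where
  "rational_yz D F \<longleftrightarrow> (\<exists>n c e.
     (\<forall>i j. c i j meromorphic_on D \<and> e i j meromorphic_on D) \<and>
     (\<forall>\<^sub>\<approx>x\<in>D. (\<exists>i\<le>n. \<exists>j\<le>n. e i j x \<noteq> 0) \<and>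
        (\<forall>y z. bipoly n (\<lambda>i j. e i j x) y z \<noteq> 0 \<longrightarrow>
           F x y z = bipoly n (\<lambda>i j. c i j x) y z / bipoly n (\<lambda>i j. e i j x) y z)))"

text \<open>\<open>\<Phi> x y z\<close> holds for almost all \<open>x\<close> and all \<open>(y,z)\<close> off the zero set of a nonzero
  polynomial in \<open>(y,z)\<close> with meromorphic coefficients.\<close>

definition generically ::
  "complex set \<Rightarrow> (complex \<Rightarrow> complex \<Rightarrow> complex \<Rightarrow> bool) \<Rightarrow> bool" where
  "generically D \<Phi> \<longleftrightarrow> (\<exists>n r. (\<forall>i j. r i j meromorphic_on D) \<and>
     (\<forall>\<^sub>\<approx>x\<in>D. (\<exists>i\<le>n. \<exists>j\<le>n. r i j x \<noteq> 0) \<and>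
        (\<forall>y z. bipoly n (\<lambda>i j. r i j x) y z \<noteq> 0 \<longrightarrow> \<Phi> x y z)))"

definition transforms_into ::
  "complex set \<Rightarrow> (complex \<Rightarrow> complex \<Rightarrow> complex \<Rightarrow> complex) \<Rightarrow>
   (complex \<Rightarrow> complex \<Rightarrow> complex \<Rightarrow> complex) \<Rightarrow> system \<Rightarrow> system \<Rightarrow> bool" where
  "transforms_into D F G S1 S2 \<longleftrightarrow> generically D (\<lambda>x y0 z0.
     \<forall>y z. y x = y0 \<and> z x = z0 \<and> solution_near S1 y z x \<longrightarrow>
       solution_near S2 (\<lambda>t. F t (y t) (z t)) (\<lambda>t. G t (y t) (z t)) x)"

definition birationally_equivalent :: "complex set \<Rightarrow> system \<Rightarrow> system \<Rightarrow> bool" where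
  "birationally_equivalent D S1 S2 \<longleftrightarrow> (\<exists>F G F' G'.
     rational_yz D F \<and> rational_yz D G \<and> rational_yz D F' \<and> rational_yz D G' \<and>
     generically D (\<lambda>x y z. F' x (F x y z) (G x y z) = y \<and> G' x (F x y z) (G x y z) = z) \<and>
     generically D (\<lambda>x y z. F x (F' x y z) (G' x y z) = y \<and> G x (F' x y z) (G' x y z) = z) \<and>
     transforms_into D F G S1 S2 \<and> transforms_into D F' G' S2 S1)"


section \<open>The regularisation process\<close>

text \<open>
  The process is algebraic over a differential field \<open>'k\<close> (with derivation \<open>d\<close>) of coefficient
  functions of \<open>x\<close>: a vector field consists of two rational functions on \<open>'k\<close> squared, and base
  points, which move with \<open>x\<close>, are points over \<open>'k\<close>. Rational functions are represented by
  their values off some curve; \<open>'k\<close> is meant to be infinite.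
\<close>

type_synonym 'k vfield = "('k \<Rightarrow> 'k \<Rightarrow> 'k) \<times> ('k \<Rightarrow> 'k \<Rightarrow> 'k)"

definition polyfun2 :: "('k::field \<Rightarrow> 'k \<Rightarrow> 'k) \<Rightarrow> bool" where
  "polyfun2 N \<longleftrightarrow> (\<exists>n c. \<forall>y z. N y z = bipoly n c y z)"

definition is_quotient ::
  "('k::field \<Rightarrow> 'k \<Rightarrow> 'k) \<Rightarrow> ('k \<Rightarrow> 'k \<Rightarrow> 'k) \<Rightarrow> ('k \<Rightarrow> 'k \<Rightarrow> 'k) \<Rightarrow> bool" where
  "is_quotient f N E \<longleftrightarrow> polyfun2 N \<and> polyfun2 E \<and> (\<exists>y z. E y z \<noteq> 0) \<and>
     (\<exists>R. polyfun2 R \<and> (\<exists>y z. R y z \<noteq> 0) \<and>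
          (\<forall>y z. R y z \<noteq> 0 \<longrightarrow> f y z = N y z / E y z))"

text \<open>\<open>f\<close> is \<open>0/0\<close> at \<open>(a,b)\<close> if this happens however \<open>f\<close> is written as a quotient of
  polynomials, so that the indeterminacy is not due to a common factor.\<close>

definition indeterminate_at :: "('k::field \<Rightarrow> 'k \<Rightarrow> 'k) \<Rightarrow> 'k \<Rightarrow> 'k \<Rightarrow> bool" where
  "indeterminate_at f a b \<longleftrightarrow> (\<forall>N E. is_quotient f N E \<longrightarrow> N a b = 0 \<and> E a b = 0)"

definition regular_at :: "('k::field \<Rightarrow> 'k \<Rightarrow> 'k) \<Rightarrow> 'k \<Rightarrow> 'k \<Rightarrow> bool" where
  "regular_at f a b \<longleftrightarrow> (\<exists>N E. is_quotient f N E \<and> E a b \<noteq> 0)"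

definition base_point :: "'k::field vfield \<Rightarrow> 'k \<Rightarrow> 'k \<Rightarrow> bool" where
  "base_point S a b \<longleftrightarrow> indeterminate_at (fst S) a b \<or> indeterminate_at (snd S) a b"

definition vf_regular_at :: "'k::field vfield \<Rightarrow> 'k \<Rightarrow> 'k \<Rightarrow> bool" where
  "vf_regular_at S a b \<longleftrightarrow> regular_at (fst S) a b \<and> regular_at (snd S) a b"

text \<open>The system in the coordinates \<open>u = y - a\<close>, \<open>v = (z - b) / (y - a)\<close>, respectively
  \<open>U = (y - a) / (z - b)\<close>, \<open>V = z - b\<close>; the exceptional curve is \<open>u = 0\<close>, respectively
  \<open>V = 0\<close>.\<close>

definition blowup_uv :: "('k \<Rightarrow> 'k) \<Rightarrow> 'k \<Rightarrow> 'k \<Rightarrow> 'k vfield \<Rightarrow> 'k::field vfield" where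
  "blowup_uv d a b S =
     (\<lambda>u v. fst S (a + u) (b + u * v) - d a,
      \<lambda>u v. ((snd S (a + u) (b + u * v) - d b) - v * (fst S (a + u) (b + u * v) - d a)) / u)"

definition blowup_UV :: "('k \<Rightarrow> 'k) \<Rightarrow> 'k \<Rightarrow> 'k \<Rightarrow> 'k vfield \<Rightarrow> 'k::field vfield" where
  "blowup_UV d a b S =
     (\<lambda>U V. ((fst S (a + U * V) (b + V) - d a) - U * (snd S (a + U * V) (b + V) - d b)) / V,
      \<lambda>U V. snd S (a + U * V) (b + V) - d b)"

text \<open>All cascades of blow-ups starting at the base point \<open>(a,b)\<close> of \<open>S\<close> are finite, and each
  ends with an exceptional curve on which the system is regular in one of the two final charts.
  The last premise is the condition on that curve; it is void if some base point is left on it.\<close>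

inductive cascades_regular :: "('k::field \<Rightarrow> 'k) \<Rightarrow> 'k vfield \<Rightarrow> 'k \<Rightarrow> 'k \<Rightarrow> bool"
  for d :: "'k::field \<Rightarrow> 'k" where
  blow_up: "cascades_regular d S a b"
    if "\<And>c. base_point (blowup_uv d a b S) 0 c \<Longrightarrow> cascades_regular d (blowup_uv d a b S) 0 c"
      and "\<And>c. base_point (blowup_UV d a b S) c 0 \<Longrightarrow> cascades_regular d (blowup_UV d a b S) c 0"
      and "(\<exists>c. base_point (blowup_uv d a b S) 0 c) \<or> (\<exists>c. base_point (blowup_UV d a b S) c 0) \<or>
           (\<forall>c. vf_regular_at (blowup_uv d a b S) 0 c) \<or> (\<forall>c. vf_regular_at (blowup_UV d a b S) c 0)"

text \<open>The charts \<open>u\<^sub>0 = 1/y\<close>, \<open>v\<^sub>0 = z/y\<close> and \<open>U\<^sub>0 = y/z\<close>, \<open>V\<^sub>0 = 1/z\<close> of the projective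
  plane.\<close>

definition chart_uv0 :: "'k::field vfield \<Rightarrow> 'k vfield" where
  "chart_uv0 S =
     (\<lambda>u v. - u\<^sup>2 * fst S (1 / u) (v / u),
      \<lambda>u v. u * (snd S (1 / u) (v / u) - v * fst S (1 / u) (v / u)))"

definition chart_UV0 :: "'k::field vfield \<Rightarrow> 'k vfield" where
  "chart_UV0 S =
     (\<lambda>U V. V * (fst S (U / V) (1 / V) - U * snd S (U / V) (1 / V)),
      \<lambda>U V. - V\<^sup>2 * snd S (U / V) (1 / V))"

definition regularised :: "('k::field \<Rightarrow> 'k) \<Rightarrow> 'k vfield \<Rightarrow> bool" where
  "regularised d S \<longleftrightarrow>
     (\<forall>T \<in> {S, chart_uv0 S, chart_UV0 S}. \<forall>a b. base_point T a b \<longrightarrow> cascades_regular d T a b)"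

text \<open>
  For a system with meromorphic coefficients the process is carried out locally, near every point
  \<open>x\<^sub>0\<close> of the domain, meromorphic functions near \<open>x\<^sub>0\<close> being identified with their Laurent
  series. As \<open>x\<^sub>0\<close> varies, this also captures base points whose coordinates are only
  multivalued (algebraic) functions of the coefficients, since these are single-valued near
  generic \<open>x\<^sub>0\<close>.
\<close>

definition expands_at ::
  "complex \<Rightarrow> (complex \<Rightarrow> complex \<Rightarrow> complex \<Rightarrow> complex) \<Rightarrow>
   (complex fls \<Rightarrow> complex fls \<Rightarrow> complex fls) \<Rightarrow> bool" where
  "expands_at x0 F f \<longleftrightarrow> (\<exists>n c e c' e'.
     (\<forall>i j. (\<lambda>w. c i j (x0 + w)) has_laurent_expansion c' i j \<and>
            (\<lambda>w. e i j (x0 + w)) has_laurent_expansion e' i j) \<and>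
     (\<exists>i\<le>n. \<exists>j\<le>n. e' i j \<noteq> 0) \<and>
     (\<forall>\<^sub>F x in at x0. \<forall>y z. bipoly n (\<lambda>i j. e i j x) y z \<noteq> 0 \<longrightarrow>
        F x y z = bipoly n (\<lambda>i j. c i j x) y z / bipoly n (\<lambda>i j. e i j x) y z) \<and>
     (\<forall>y z. f y z = bipoly n c' y z / bipoly n e' y z))"

definition regularised_on :: "complex set \<Rightarrow> system \<Rightarrow> bool" where
  "regularised_on D S \<longleftrightarrow> (\<forall>x0\<in>D. \<exists>f g.
     expands_at x0 (fst S) f \<and> expands_at x0 (snd S) g \<and> regularised fls_deriv (f, g))"


section \<open>Analogues of the Bureau-Guillot system\<close>

text \<open>Differential polynomials in an unknown function, with coefficients polynomial in \<open>x\<close>.\<close>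

datatype diff_poly = DConst complex | DVar | DJet nat
  | DAdd diff_poly diff_poly | DMult diff_poly diff_poly

primrec dp_eval :: "diff_poly \<Rightarrow> (complex \<Rightarrow> complex) \<Rightarrow> complex \<Rightarrow> complex" where
  "dp_eval (DConst c) q x = c"
| "dp_eval DVar q x = x"
| "dp_eval (DJet k) q x = (deriv ^^ k) q x"
| "dp_eval (DAdd A B) q x = dp_eval A q x + dp_eval B q x"
| "dp_eval (DMult A B) q x = dp_eval A q x * dp_eval B q x"

definition dp_holds :: "complex set \<Rightarrow> diff_poly \<Rightarrow> (complex \<Rightarrow> complex) \<Rightarrow> bool" where
  "dp_holds D \<Phi> q \<longleftrightarrow> (\<forall>\<^sub>\<approx>x\<in>D. dp_eval \<Phi> q x = 0)"

text \<open>A system whose coefficients depend on a function is a map from functions to systems. The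
  next predicate says that one component of it is rational in \<open>(y,z)\<close> with coefficients that are
  rational expressions in \<open>x\<close>, \<open>q\<close>, \<open>q'\<close>, \<open>q''\<close>, ... (denominators cleared), the same
  expressions for every function, and that they are meromorphic for the given \<open>q\<close>.\<close>

definition coefficients_from ::
  "complex set \<Rightarrow> (complex \<Rightarrow> complex) \<Rightarrow>
   ((complex \<Rightarrow> complex) \<Rightarrow> complex \<Rightarrow> complex \<Rightarrow> complex \<Rightarrow> complex) \<Rightarrow> bool" where
  "coefficients_from D q F \<longleftrightarrow> (\<exists>n A B.
     (\<forall>p x y z. bipoly n (\<lambda>i j. dp_eval (B i j) p x) y z \<noteq> 0 \<longrightarrow>
        F p x y z = bipoly n (\<lambda>i j. dp_eval (A i j) p x) y z /
                    bipoly n (\<lambda>i j. dp_eval (B i j) p x) y z) \<and>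
     (\<forall>i j. dp_eval (A i j) q meromorphic_on D \<and> dp_eval (B i j) q meromorphic_on D) \<and>
     (\<forall>\<^sub>\<approx>x\<in>D. \<exists>i\<le>n. \<exists>j\<le>n. dp_eval (B i j) q x \<noteq> 0))"

text \<open>The functions that may be put in place of \<open>q\<close>: as \<open>1/q\<close> may occur in the coefficients,
  the zero function is excluded.\<close>

definition admissible :: "complex set \<Rightarrow> (complex \<Rightarrow> complex) \<Rightarrow> bool" where
  "admissible D q \<longleftrightarrow> domain_in_C D \<and> q meromorphic_on D \<and> (\<forall>\<^sub>\<approx>x\<in>D. q x \<noteq> 0)"

text \<open>The differential equations \<open>\<Phi> = 0\<close>, for \<open>\<Phi>\<close> in \<open>C\<close>, express exactly that the system
  is regularised; none of them is an identity.\<close>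

definition regularising_conditions ::
  "((complex \<Rightarrow> complex) \<Rightarrow> system) \<Rightarrow> diff_poly set \<Rightarrow> bool" where
  "regularising_conditions S C \<longleftrightarrow> finite C \<and> C \<noteq> {} \<and>
     (\<forall>\<Phi>\<in>C. \<exists>D q. admissible D q \<and> \<not> dp_holds D \<Phi> q) \<and>
     (\<forall>D q. admissible D q \<longrightarrow> (regularised_on D (S q) \<longleftrightarrow> (\<forall>\<Phi>\<in>C. dp_holds D \<Phi> q)))"

text \<open>\<open>PJ D q\<close> states that \<open>q\<close> solves the Painleve equation on \<open>D\<close>, and \<open>S0\<close> is the associated
  Hamiltonian system.\<close>

definition bureau_guillot ::
  "complex set \<Rightarrow> (complex set \<Rightarrow> (complex \<Rightarrow> complex) \<Rightarrow> bool) \<Rightarrow> system \<Rightarrow>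
   ((complex \<Rightarrow> complex) \<Rightarrow> system) \<Rightarrow> (complex \<Rightarrow> complex) \<Rightarrow> bool" where
  "bureau_guillot D PJ S0 S q \<longleftrightarrow>
     PJ D q \<and>
     birationally_equivalent D S0 (S q) \<and>
     coefficients_from D q (\<lambda>p. fst (S p)) \<and> coefficients_from D q (\<lambda>p. snd (S p)) \<and>
     (\<exists>C. regularising_conditions S C \<and>
        (\<forall>D' q'. domain_in_C D' \<and> PJ D' q' \<longrightarrow> (\<forall>\<Phi>\<in>C. dp_holds D' \<Phi> q')))"


section \<open>The transformed system\<close>

definition rhs_y ::
  "complex \<Rightarrow> complex \<Rightarrow> complex \<Rightarrow> complex \<Rightarrow> complex \<Rightarrow> complex \<Rightarrow> complex \<Rightarrow> complex" where
  "rhs_y \<eta> \<kappa>\<^sub>0 q q' x y z = - (1 / (4 * x * (q + z)\<^sup>2)) *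
     ((z\<^sup>2 / q\<^sup>2 + 2 * z / q + 1) * (x\<^sup>2 * q'\<^sup>2 / q\<^sup>2 + 2 * x * q' / q)
      + q' / q * (3 * z / q + 10) * (4 * x * y * z\<^sup>2)
      - 4 * (x\<^sup>2 * \<eta>\<^sup>2 * (q + z)\<^sup>2
             - 2 * y * (q\<^sup>2 * (18 * y * z\<^sup>2 + 1) + 4 * z\<^sup>2 * (y * z\<^sup>2 + 1))
             - 7 * y * z * q * (4 * y * z\<^sup>2 + 1))
      + 4 * x * y * (4 * q + 11 * z) * q'
      + 8 * y\<^sup>2 * q ^ 3 * (2 * q + 10 * z)
      + z / q * (z / q + 12 * y * z\<^sup>2 + 2)
      + 4 * x * \<kappa>\<^sub>0 / q * (z / q + 2)
      + 1)"

definition rhs_z ::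
  "complex \<Rightarrow> complex \<Rightarrow> complex \<Rightarrow> complex \<Rightarrow> complex \<Rightarrow> complex" where
  "rhs_z q q' x y z =
     q' / q * (z\<^sup>2 / q + 2 * z) + 4 * y * z / x * (q + z)\<^sup>2 + z / x * (z / q + 1)"

definition bg_D7 :: "complex \<Rightarrow> complex \<Rightarrow> (complex \<Rightarrow> complex) \<Rightarrow> system" where
  "bg_D7 \<eta> \<kappa>\<^sub>0 q =
     (\<lambda>x y z. rhs_y \<eta> \<kappa>\<^sub>0 (q x) (deriv q x) x y z,
      \<lambda>x y z. rhs_z (q x) (deriv q x) x y z)"

end

theory Submission
  imports Defs
begin

text \<open>
  The transformation turns the Hamiltonian system into one whose only pole over the finite chart is
  \<open>z = - q\<close>. For arbitrary \<open>q\<close> the transformed system has two base points at infinity. The cascade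
  that starts at \<open>1/y = z/y = 0\<close> leads to \<open>z = 0\<close> and to the zeros of \<open>y\<^sub>3\<close>, and is regular whatever \<open>q\<close> is. The one
  that starts at \<open>y/z = 1/z = 0\<close> follows the poles of \<open>y\<^sub>3\<close>; it splits at two points \<open>y z = a\<close>, and
  after two more blow-ups a simple pole along the exceptional curve survives. Its coefficient
  vanishes at both points exactly if the combination of \<open>q\<close>, \<open>q'\<close>, \<open>q''\<close> that the Painleve equation
  equates to \<open>\<alpha>\<close> is constant. As the system does not contain \<open>\<kappa>\<^sub>\<infinity>\<close>, this third order equation
  is all that can be asked for. The computation is done over an arbitrary differential field and
  transferred to germs at a point by Laurent expansion.
\<close>

section \<open>Polynomial functions in two variables\<close>

text \<open>Base points and regularity are defined through all ways of writing a component as a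
  quotient of polynomials. A value or a pole is certified by one good quotient, but indeterminacy
  needs an argument about every denominator; it is enough to study divisibility by the equation of
  the exceptional curve.

  Apart from the point z = 0, which one blow-up resolves, every branch of a cascade runs into a
  point where u' = m and v' = 2 m (v - c) / u to leading order. Then dv/du has the integer exponent
  2: a resonance, where a power series v(u) exists only if one coefficient vanishes. This
  coefficient is the simple pole that may survive. Along the zeros of y3 it vanishes identically in
  q; along the poles of y3 it is the only place where an equation for q can arise.

  Multiplying the field by x makes both values of 4 a + r, namely 2 h and - 2 h with h = \<eta> x,
  eigenvectors of the derivation. This is why the two points a give one and the same
  condition.\<close>

lemma poly_altdef_le:
  fixes p :: "'a::comm_semiring_1 poly"
  assumes "degree p \<le> n"
  shows "poly p x = (\<Sum>i\<le>n. coeff p i * x ^ i)"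
  unfolding poly_altdef
  by (rule sum.mono_neutral_left) (use assms in \<open>auto simp: coeff_eq_0\<close>)

text \<open>Read as an element of \<open>'k poly poly\<close>, with y substituted as the constant
  polynomial \<open>[:y:]\<close>, a polynomial function inherits the absence of zero divisors and
  the finiteness of roots.\<close>

lemma polyfun2_iff_poly:
  fixes N :: "'k::field \<Rightarrow> 'k \<Rightarrow> 'k"
  shows "polyfun2 N \<longleftrightarrow> (\<exists>P. \<forall>y z. N y z = poly (poly P [:y:]) z)"
proof
  assume "polyfun2 N"
  then obtain n c where c: "\<And>y z. N y z = bipoly n c y z"
    unfolding polyfun2_def by blast
  have "N y z = poly (poly (\<Sum>i\<le>n. \<Sum>j\<le>n. monom (monom (c i j) j) i) [:y:]) z" for y z
    by (simp add: c bipoly_def poly_sum poly_monom poly_const_pow mult_ac)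
  then show "\<exists>P. \<forall>y z. N y z = poly (poly P [:y:]) z" by blast
next
  assume "\<exists>P. \<forall>y z. N y z = poly (poly P [:y:]) z"
  then obtain P where P: "\<And>y z. N y z = poly (poly P [:y:]) z" by blast
  \<comment> \<open>\<open>bipoly\<close> has one bound for both exponents, so all inner degrees are
    added to the outer one.\<close>
  define n where "n = degree P + (\<Sum>i\<le>degree P. degree (coeff P i))"
  have deg: "degree (coeff P i) \<le> n" for i
  proof (cases "i \<le> degree P")
    case True
    then have "degree (coeff P i) \<le> (\<Sum>i\<le>degree P. degree (coeff P i))"
      by (intro member_le_sum) auto
    then show ?thesis by (simp add: n_def)
  qed (simp add: coeff_eq_0)
  have "N y z = bipoly n (\<lambda>i j. coeff (coeff P i) j) y z" for y z
  proof -
    have "poly P [:y:] = (\<Sum>i\<le>n. coeff P i * [:y:] ^ i)"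
      by (rule poly_altdef_le) (simp add: n_def)
    then have "N y z = (\<Sum>i\<le>n. poly (coeff P i) z * y ^ i)"
      by (simp add: P poly_sum poly_const_pow mult.commute)
    also have "\<dots> = bipoly n (\<lambda>i j. coeff (coeff P i) j) y z"
      unfolding bipoly_def
      by (rule sum.cong[OF refl])
        (simp add: poly_altdef_le[OF deg] sum_distrib_right sum_distrib_left mult_ac)
    finally show ?thesis .
  qed
  then show "polyfun2 N" unfolding polyfun2_def by blast
qed

lemma polyfun2I: "(\<And>y z. N y z = poly (poly P [:y:]) z) \<Longrightarrow> polyfun2 N"
  by (auto simp: polyfun2_iff_poly)

named_theorems polyfun2_intros

lemma polyfun2_const [polyfun2_intros]: "polyfun2 (\<lambda>y z. c)"
  by (rule polyfun2I[where P = "[:[:c:]:]"]) simp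

lemma polyfun2_fst [polyfun2_intros]: "polyfun2 (\<lambda>y z. y)"
  by (rule polyfun2I[where P = "[:0, 1:]"]) simp

lemma polyfun2_snd [polyfun2_intros]: "polyfun2 (\<lambda>y z. z)"
  by (rule polyfun2I[where P = "[:[:0, 1:]:]"]) simp

lemma polyfun2_add [polyfun2_intros]:
  assumes "polyfun2 N" "polyfun2 M"
  shows "polyfun2 (\<lambda>y z. N y z + M y z)"
proof -
  from assms obtain P Q where "\<And>y z. N y z = poly (poly P [:y:]) z" "\<And>y z. M y z = poly (poly Q [:y:]) z"
    unfolding polyfun2_iff_poly by blast
  then show ?thesis by (intro polyfun2I[where P = "P + Q"]) simp
qed

lemma polyfun2_mult [polyfun2_intros]:
  assumes "polyfun2 N" "polyfun2 M"
  shows "polyfun2 (\<lambda>y z. N y z * M y z)"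
proof -
  from assms obtain P Q where "\<And>y z. N y z = poly (poly P [:y:]) z" "\<And>y z. M y z = poly (poly Q [:y:]) z"
    unfolding polyfun2_iff_poly by blast
  then show ?thesis by (intro polyfun2I[where P = "P * Q"]) simp
qed

lemma polyfun2_uminus [polyfun2_intros]: "polyfun2 N \<Longrightarrow> polyfun2 (\<lambda>y z. - N y z)"
  using polyfun2_mult[OF polyfun2_const[of "- 1"]] by simp

lemma polyfun2_diff [polyfun2_intros]:
  "polyfun2 N \<Longrightarrow> polyfun2 M \<Longrightarrow> polyfun2 (\<lambda>y z. N y z - M y z)"
  using polyfun2_add[of N "\<lambda>y z. - M y z"] by (simp add: polyfun2_uminus)

lemma polyfun2_power [polyfun2_intros]: "polyfun2 N \<Longrightarrow> polyfun2 (\<lambda>y z. N y z ^ n)"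
  by (induction n) (auto intro: polyfun2_intros)

lemma polyfun2_sum [polyfun2_intros]:
  "(\<And>i. i \<in> I \<Longrightarrow> polyfun2 (N i)) \<Longrightarrow> polyfun2 (\<lambda>y z. \<Sum>i\<in>I. N i y z)"
  by (induction I rule: infinite_finite_induct) (auto intro: polyfun2_intros)

lemma polyfun2_comp:
  assumes "polyfun2 N" "polyfun2 A" "polyfun2 B"
  shows "polyfun2 (\<lambda>y z. N (A y z) (B y z))"
proof -
  from assms(1) obtain n c where "\<And>y z. N y z = bipoly n c y z"
    unfolding polyfun2_def by blast
  then show ?thesis
    unfolding bipoly_def by (auto intro!: polyfun2_intros assms(2,3))
qed

lemma polyfun2_swap: "polyfun2 N \<Longrightarrow> polyfun2 (\<lambda>y z. N z y)"
  by (rule polyfun2_comp) (auto intro: polyfun2_intros)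

definition nzpoly :: "('k::field \<Rightarrow> 'k \<Rightarrow> 'k) \<Rightarrow> bool" where
  "nzpoly R \<longleftrightarrow> polyfun2 R \<and> (\<exists>y z. R y z \<noteq> 0)"

lemma nzpolyI: "polyfun2 R \<Longrightarrow> R y z \<noteq> 0 \<Longrightarrow> nzpoly R"
  by (auto simp: nzpoly_def)

lemma nzpoly_polyfun2: "nzpoly R \<Longrightarrow> polyfun2 R"
  by (simp add: nzpoly_def)

text \<open>A nonzero polynomial over the domain \<open>'k poly\<close> has finitely many roots,
  whereas the constants \<open>[:y:]\<close> are infinitely many in characteristic zero.\<close>

lemma poly2_nonzero_value:
  fixes P :: "'k::field_char_0 poly poly"
  assumes "P \<noteq> 0"
  shows "\<exists>y z. poly (poly P [:y:]) z \<noteq> 0"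
proof (rule ccontr)
  assume "\<not> ?thesis"
  then have "poly P [:y:] = 0" for y
    using poly_all_0_iff_0 by blast
  then have "range (\<lambda>y. [:y:]) \<subseteq> {x. poly P x = 0}" by auto
  moreover have "infinite (range (\<lambda>y::'k. [:y:]))"
    by (subst finite_image_iff) (auto simp: inj_on_def infinite_UNIV_char_0)
  ultimately show False
    using poly_roots_finite[OF assms] finite_subset by blast
qed

named_theorems nzpoly_intros

text \<open>Two curves never cover the plane: the representing polynomials live in a domain, and
  their product takes a nonzero value somewhere. Transitivity and congruence of generic equality
  rest on this.\<close>

lemma nzpoly_mult [nzpoly_intros]:
  fixes R Q :: "'k::field_char_0 \<Rightarrow> 'k \<Rightarrow> 'k"
  assumes "nzpoly R" "nzpoly Q"
  shows "nzpoly (\<lambda>y z. R y z * Q y z)"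
proof -
  from assms obtain A B where
    AB: "\<And>y z. R y z = poly (poly A [:y:]) z" "\<And>y z. Q y z = poly (poly B [:y:]) z"
    unfolding nzpoly_def polyfun2_iff_poly by blast
  with assms have "A \<noteq> 0" "B \<noteq> 0" by (auto simp: nzpoly_def)
  then obtain y z where "poly (poly (A * B) [:y:]) z \<noteq> 0"
    using poly2_nonzero_value[of "A * B"] by auto
  then have "R y z * Q y z \<noteq> 0" by (simp add: AB)
  then show ?thesis
    using assms by (auto intro!: nzpolyI[of _ y z] polyfun2_mult dest: nzpoly_polyfun2)
qed

lemma nzpoly_const [nzpoly_intros]: "c \<noteq> 0 \<Longrightarrow> nzpoly (\<lambda>y z. c)"
  by (auto simp: nzpoly_def intro: polyfun2_intros)

lemma nzpoly_power [nzpoly_intros]: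
  fixes R :: "'k::field_char_0 \<Rightarrow> 'k \<Rightarrow> 'k"
  shows "nzpoly R \<Longrightarrow> nzpoly (\<lambda>y z. R y z ^ n)"
  by (induction n) (auto intro: nzpoly_intros)

lemma nzpoly_fst [nzpoly_intros]: "nzpoly (\<lambda>y z. y)"
  by (rule nzpolyI[of _ 1 1]) (auto intro: polyfun2_intros)

lemma nzpoly_snd [nzpoly_intros]: "nzpoly (\<lambda>y z. z)"
  by (rule nzpolyI[of _ 1 1]) (auto intro: polyfun2_intros)

lemma nzpoly_swap: "nzpoly N \<Longrightarrow> nzpoly (\<lambda>y z. N z y)"
  by (auto simp: nzpoly_def intro: polyfun2_swap)

lemma nzpoly_nonzero_fst:
  fixes R :: "'k::field_char_0 \<Rightarrow> 'k \<Rightarrow> 'k"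
  assumes "nzpoly R"
  obtains y z where "R y z \<noteq> 0" "y \<noteq> 0"
  using nzpoly_mult[OF assms nzpoly_fst] by (auto simp: nzpoly_def)

text \<open>The blow-up map reaches every point with y \<noteq> a, and some such point lies off the
  curve R = 0; so a curve never pulls back to the whole plane.\<close>

lemma nzpoly_blowup_uv:
  fixes R :: "'k::field_char_0 \<Rightarrow> 'k \<Rightarrow> 'k"
  assumes "nzpoly R"
  shows "nzpoly (\<lambda>u v. R (a + u) (b + u * v))"
proof -
  have "nzpoly (\<lambda>y z. R y z * (y - a))"
    by (intro nzpoly_mult assms nzpolyI[of _ "a + 1" 0] polyfun2_intros) auto
  then obtain y z where "R y z \<noteq> 0" "y - a \<noteq> 0"
    by (auto simp: nzpoly_def)
  then have "R (a + (y - a)) (b + (y - a) * ((z - b) / (y - a))) \<noteq> 0" by simp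
  then show ?thesis
    by (intro nzpolyI[of _ "y - a" "(z - b) / (y - a)"] polyfun2_comp[OF nzpoly_polyfun2[OF assms]]
        polyfun2_intros) auto
qed

lemma polyfun2_vanish_fst:
  assumes "polyfun2 N" "\<And>v. N 0 v = 0"
  obtains M where "polyfun2 M" "\<And>u v. N u v = u * M u v"
proof -
  from assms(1) obtain P where P: "\<And>y z. N y z = poly (poly P [:y:]) z"
    unfolding polyfun2_iff_poly by blast
  obtain A Q where AQ: "P = pCons A Q" by (cases P)
  have "N y z = y * poly (poly Q [:y:]) z" for y z
    using assms(2)[of z] by (simp add: P AQ)
  moreover have "polyfun2 (\<lambda>y z. poly (poly Q [:y:]) z)"
    by (rule polyfun2I) simp
  ultimately show ?thesis using that by blast
qed

text \<open>The line u = 0 is irreducible: restricted to it, both factors become polynomials in v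
  alone, and one of them has to vanish identically.\<close>

lemma polyfun2_vanish_fst_mult:
  fixes N M :: "'k::field_char_0 \<Rightarrow> 'k \<Rightarrow> 'k"
  assumes "polyfun2 N" "polyfun2 M" "\<And>v. N 0 v * M 0 v = 0" "N 0 c \<noteq> 0"
  shows "M 0 v = 0"
proof (rule ccontr)
  assume "M 0 v \<noteq> 0"
  have "nzpoly (\<lambda>y z. N 0 z)"
    by (rule nzpolyI[of _ 0 c], rule polyfun2_comp[OF assms(1)])
      (auto intro: polyfun2_intros simp: assms(4))
  moreover have "nzpoly (\<lambda>y z. M 0 z)"
    by (rule nzpolyI[of _ 0 v], rule polyfun2_comp[OF assms(2)])
      (auto intro: polyfun2_intros simp: \<open>M 0 v \<noteq> 0\<close>)
  ultimately have "nzpoly (\<lambda>y z. N 0 z * M 0 z)" by (rule nzpoly_mult)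
  then show False
    using assms(3) by (auto simp: nzpoly_def)
qed

section \<open>Rational functions up to generic equality\<close>

text \<open>Equality of rational functions. Pointwise equality would be spoilt by the convention x /
  0 = 0 along curves where a denominator vanishes.\<close>

definition geq :: "('k::field \<Rightarrow> 'k \<Rightarrow> 'k) \<Rightarrow> ('k \<Rightarrow> 'k \<Rightarrow> 'k) \<Rightarrow> bool" (infix "\<doteq>" 50) where
  "f \<doteq> g \<longleftrightarrow> (\<exists>R. nzpoly R \<and> (\<forall>y z. R y z \<noteq> 0 \<longrightarrow> f y z = g y z))"

lemma geqI: "nzpoly R \<Longrightarrow> (\<And>y z. R y z \<noteq> 0 \<Longrightarrow> f y z = g y z) \<Longrightarrow> f \<doteq> g"
  by (auto simp: geq_def)

lemma geq_refl [simp, intro]: "f \<doteq> f"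
  by (rule geqI[of "\<lambda>y z. 1"]) (auto intro: nzpoly_intros)

lemma geq_sym: "f \<doteq> g \<Longrightarrow> g \<doteq> f"
  by (auto simp: geq_def)

lemma geq_cong2:
  fixes f g f' g' :: "'k::field_char_0 \<Rightarrow> 'k \<Rightarrow> 'k"
  assumes "f \<doteq> f'" "g \<doteq> g'"
  shows "(\<lambda>y z. H y z (f y z) (g y z)) \<doteq> (\<lambda>y z. H y z (f' y z) (g' y z))"
proof -
  from assms obtain R Q where "nzpoly R" "nzpoly Q"
    "\<And>y z. R y z \<noteq> 0 \<Longrightarrow> f y z = f' y z" "\<And>y z. Q y z \<noteq> 0 \<Longrightarrow> g y z = g' y z"
    unfolding geq_def by blast
  then show ?thesis
    by (intro geqI[of "\<lambda>y z. R y z * Q y z"] nzpoly_mult) auto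
qed

lemma geq_trans [trans]:
  fixes f g h :: "'k::field_char_0 \<Rightarrow> 'k \<Rightarrow> 'k"
  assumes "f \<doteq> g" "g \<doteq> h"
  shows "f \<doteq> h"
proof -
  from assms obtain R Q where "nzpoly R" "nzpoly Q"
    "\<And>y z. R y z \<noteq> 0 \<Longrightarrow> f y z = g y z" "\<And>y z. Q y z \<noteq> 0 \<Longrightarrow> g y z = h y z"
    unfolding geq_def by blast
  then show ?thesis
    by (intro geqI[of "\<lambda>y z. R y z * Q y z"] nzpoly_mult) auto
qed

lemma geq_swap: "f \<doteq> g \<Longrightarrow> (\<lambda>y z. f z y) \<doteq> (\<lambda>y z. g z y)"
  unfolding geq_def by (blast intro: nzpoly_swap)

lemma geq_blowup_uv:
  fixes f g :: "'k::field_char_0 \<Rightarrow> 'k \<Rightarrow> 'k"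
  assumes "f \<doteq> g"
  shows "(\<lambda>u v. f (a + u) (b + u * v)) \<doteq> (\<lambda>u v. g (a + u) (b + u * v))"
  using assms unfolding geq_def
  by (elim exE conjE, intro exI[of _ "\<lambda>u v. _ (a + u) (b + u * v)"] conjI nzpoly_blowup_uv) auto

lemma geq_poly_eq:
  fixes f g :: "'k::field_char_0 \<Rightarrow> 'k \<Rightarrow> 'k"
  assumes "f \<doteq> g" "polyfun2 f" "polyfun2 g"
  shows "f y z = g y z"
proof (rule ccontr)
  assume "f y z \<noteq> g y z"
  with assms have nz: "nzpoly (\<lambda>y z. f y z - g y z)"
    by (intro nzpolyI[of _ y z] polyfun2_intros) auto
  from assms(1) obtain R where "nzpoly R" "\<And>y z. R y z \<noteq> 0 \<Longrightarrow> f y z = g y z"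
    unfolding geq_def by blast
  with nzpoly_mult[OF this(1) nz] show False by (auto simp: nzpoly_def)
qed

lemma is_quotient_iff:
  "is_quotient f N E \<longleftrightarrow> polyfun2 N \<and> nzpoly E \<and> f \<doteq> (\<lambda>y z. N y z / E y z)"
  by (auto simp: is_quotient_def geq_def nzpoly_def)

lemma is_quotient_geq:
  fixes f g :: "'k::field_char_0 \<Rightarrow> 'k \<Rightarrow> 'k"
  shows "f \<doteq> g \<Longrightarrow> is_quotient f N E \<longleftrightarrow> is_quotient g N E"
  unfolding is_quotient_iff using geq_trans geq_sym by blast

text \<open>The quotients agree off a curve; after cross-multiplication both sides are polynomials
  and agree everywhere, also where a denominator vanishes. This is how two representations are
  compared at a point.\<close>

lemma is_quotient_cross:
  fixes f :: "'k::field_char_0 \<Rightarrow> 'k \<Rightarrow> 'k"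
  assumes "is_quotient f N E" "is_quotient f N' E'"
  shows "N y z * E' y z = N' y z * E y z"
proof -
  have "(\<lambda>y z. N y z / E y z) \<doteq> (\<lambda>y z. N' y z / E' y z)"
    using assms unfolding is_quotient_iff by (meson geq_trans geq_sym)
  then obtain R where R: "nzpoly R" "\<And>y z. R y z \<noteq> 0 \<Longrightarrow> N y z / E y z = N' y z / E' y z"
    unfolding geq_def by blast
  have "(\<lambda>y z. N y z * E' y z) \<doteq> (\<lambda>y z. N' y z * E y z)"
  proof (rule geqI[of "\<lambda>y z. R y z * (E y z * E' y z)"])
    show "nzpoly (\<lambda>y z. R y z * (E y z * E' y z))"
      using assms R by (auto intro!: nzpoly_intros simp: is_quotient_iff)
    show "N y z * E' y z = N' y z * E y z" if "R y z * (E y z * E' y z) \<noteq> 0" for y z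
      using R(2)[of y z] that by (simp add: frac_eq_eq)
  qed
  then show ?thesis
    by (rule geq_poly_eq)
      (use assms in \<open>auto intro!: polyfun2_intros simp: is_quotient_iff nzpoly_def\<close>)
qed

section \<open>Values, poles and indeterminacy at a point\<close>

definition has_value :: "('k::field \<Rightarrow> 'k \<Rightarrow> 'k) \<Rightarrow> 'k \<Rightarrow> 'k \<Rightarrow> 'k \<Rightarrow> bool" where
  "has_value f a b v \<longleftrightarrow> (\<exists>N E. is_quotient f N E \<and> E a b \<noteq> 0 \<and> v = N a b / E a b)"

definition pole_at :: "('k::field \<Rightarrow> 'k \<Rightarrow> 'k) \<Rightarrow> 'k \<Rightarrow> 'k \<Rightarrow> bool" where
  "pole_at f a b \<longleftrightarrow> (\<exists>N E. is_quotient f N E \<and> N a b \<noteq> 0 \<and> E a b = 0)"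

lemma regular_at_iff: "regular_at f a b \<longleftrightarrow> (\<exists>v. has_value f a b v)"
  by (auto simp: regular_at_def has_value_def)

lemma has_value_regular: "has_value f a b v \<Longrightarrow> regular_at f a b"
  by (auto simp: regular_at_iff)

lemma regular_not_indeterminate: "regular_at f a b \<Longrightarrow> \<not> indeterminate_at f a b"
  by (auto simp: regular_at_def indeterminate_at_def)

lemma pole_not_indeterminate: "pole_at f a b \<Longrightarrow> \<not> indeterminate_at f a b"
  by (auto simp: pole_at_def indeterminate_at_def)

lemma pole_not_regular:
  fixes f :: "'k::field_char_0 \<Rightarrow> 'k \<Rightarrow> 'k"
  shows "pole_at f a b \<Longrightarrow> \<not> regular_at f a b"
  unfolding pole_at_def regular_at_def
proof (elim exE conjE, intro notI, elim exE conjE)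
  fix N E N' E' assume "is_quotient f N E" "is_quotient f N' E'"
    and "N a b \<noteq> 0" "E a b = 0" "E' a b \<noteq> 0"
  then show False using is_quotient_cross[of f N E N' E' a b] by simp
qed

lemma regular_at_geq:
  fixes f :: "'k::field_char_0 \<Rightarrow> 'k \<Rightarrow> 'k"
  shows "f \<doteq> g \<Longrightarrow> regular_at f a b \<longleftrightarrow> regular_at g a b"
  by (simp add: regular_at_def is_quotient_geq)

lemma indeterminate_at_geq:
  fixes f :: "'k::field_char_0 \<Rightarrow> 'k \<Rightarrow> 'k"
  shows "f \<doteq> g \<Longrightarrow> indeterminate_at f a b \<longleftrightarrow> indeterminate_at g a b"
  by (simp add: indeterminate_at_def is_quotient_geq)

named_theorems has_value_intros

lemma has_value_poly: "polyfun2 N \<Longrightarrow> has_value N a b (N a b)"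
  unfolding has_value_def
  by (intro exI[of _ N] exI[of _ "\<lambda>y z. 1"]) (auto simp: is_quotient_iff intro: nzpoly_intros)

lemma has_value_const [has_value_intros]: "has_value (\<lambda>y z. c) a b c"
  using has_value_poly[OF polyfun2_const] .

lemma has_value_fst [has_value_intros]: "has_value (\<lambda>y z. y) a b a"
  using has_value_poly[OF polyfun2_fst] .

lemma has_value_snd [has_value_intros]: "has_value (\<lambda>y z. z) a b b"
  using has_value_poly[OF polyfun2_snd] .

lemma has_value_add [has_value_intros]:
  fixes f g :: "'k::field_char_0 \<Rightarrow> 'k \<Rightarrow> 'k"
  assumes "has_value f a b v" "has_value g a b w"
  shows "has_value (\<lambda>y z. f y z + g y z) a b (v + w)"
proof -
  from assms obtain N E M H where q: "is_quotient f N E" "E a b \<noteq> 0" "v = N a b / E a b"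
    "is_quotient g M H" "H a b \<noteq> 0" "w = M a b / H a b"
    unfolding has_value_def by blast
  have "(\<lambda>y z. f y z + g y z) \<doteq> (\<lambda>y z. N y z / E y z + M y z / H y z)"
    by (rule geq_cong2[where H = "\<lambda>y z a b. a + b"]) (use q in \<open>simp_all add: is_quotient_iff\<close>)
  also have "\<dots> \<doteq> (\<lambda>y z. (N y z * H y z + M y z * E y z) / (E y z * H y z))"
    using q by (intro geqI[of "\<lambda>y z. E y z * H y z"] nzpoly_intros)
      (auto simp: is_quotient_iff add_frac_eq)
  finally have "is_quotient (\<lambda>y z. f y z + g y z)
      (\<lambda>y z. N y z * H y z + M y z * E y z) (\<lambda>y z. E y z * H y z)"
    using q by (auto simp: is_quotient_iff intro!: polyfun2_intros nzpoly_intros dest: nzpoly_polyfun2)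
  then show ?thesis
    unfolding has_value_def using q
    by (rule_tac exI[of _ "\<lambda>y z. N y z * H y z + M y z * E y z"],
        rule_tac exI[of _ "\<lambda>y z. E y z * H y z"]) (simp add: add_frac_eq)
qed

lemma has_value_mult [has_value_intros]:
  fixes f g :: "'k::field_char_0 \<Rightarrow> 'k \<Rightarrow> 'k"
  assumes "has_value f a b v" "has_value g a b w"
  shows "has_value (\<lambda>y z. f y z * g y z) a b (v * w)"
proof -
  from assms obtain N E M H where q: "is_quotient f N E" "E a b \<noteq> 0" "v = N a b / E a b"
    "is_quotient g M H" "H a b \<noteq> 0" "w = M a b / H a b"
    unfolding has_value_def by blast
  have "(\<lambda>y z. f y z * g y z) \<doteq> (\<lambda>y z. (N y z / E y z) * (M y z / H y z))"
    by (rule geq_cong2[where H = "\<lambda>y z a b. a * b"]) (use q in \<open>simp_all add: is_quotient_iff\<close>)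
  then have "is_quotient (\<lambda>y z. f y z * g y z)
      (\<lambda>y z. N y z * M y z) (\<lambda>y z. E y z * H y z)"
    using q by (auto simp: is_quotient_iff intro!: polyfun2_intros nzpoly_intros)
  then show ?thesis
    unfolding has_value_def using q
    by (rule_tac exI[of _ "\<lambda>y z. N y z * M y z"], rule_tac exI[of _ "\<lambda>y z. E y z * H y z"]) simp
qed

lemma has_value_inverse [has_value_intros]:
  fixes f :: "'k::field_char_0 \<Rightarrow> 'k \<Rightarrow> 'k"
  assumes "has_value f a b v" "v \<noteq> 0"
  shows "has_value (\<lambda>y z. inverse (f y z)) a b (inverse v)"
proof -
  from assms obtain N E where q: "is_quotient f N E" "E a b \<noteq> 0" "v = N a b / E a b"
    unfolding has_value_def by blast
  have "(\<lambda>y z. inverse (f y z)) \<doteq> (\<lambda>y z. inverse (N y z / E y z))"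
    using q geq_cong2[of f "\<lambda>y z. N y z / E y z" f f "\<lambda>_ _ a b. inverse a"]
    by (auto simp: is_quotient_iff)
  then have "is_quotient (\<lambda>y z. inverse (f y z)) E N"
    using q assms by (auto simp: is_quotient_iff intro: nzpolyI[of _ a b] nzpoly_polyfun2)
  then show ?thesis
    unfolding has_value_def using q assms by (intro exI[of _ E] exI[of _ N]) auto
qed

lemma has_value_uminus [has_value_intros]:
  fixes f :: "'k::field_char_0 \<Rightarrow> 'k \<Rightarrow> 'k"
  shows "has_value f a b v \<Longrightarrow> has_value (\<lambda>y z. - f y z) a b (- v)"
  using has_value_mult[OF has_value_const[of "- 1"]] by simp

lemma has_value_diff [has_value_intros]:
  fixes f g :: "'k::field_char_0 \<Rightarrow> 'k \<Rightarrow> 'k"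
  shows "has_value f a b v \<Longrightarrow> has_value g a b w \<Longrightarrow> has_value (\<lambda>y z. f y z - g y z) a b (v - w)"
  using has_value_add[OF _ has_value_uminus] by simp

lemma has_value_divide [has_value_intros]:
  fixes f g :: "'k::field_char_0 \<Rightarrow> 'k \<Rightarrow> 'k"
  shows "has_value f a b v \<Longrightarrow> has_value g a b w \<Longrightarrow> w \<noteq> 0 \<Longrightarrow>
    has_value (\<lambda>y z. f y z / g y z) a b (v / w)"
  using has_value_mult[OF _ has_value_inverse] by (simp add: divide_inverse)

lemma has_value_power [has_value_intros]:
  fixes f :: "'k::field_char_0 \<Rightarrow> 'k \<Rightarrow> 'k"
  shows "has_value f a b v \<Longrightarrow> has_value (\<lambda>y z. f y z ^ n) a b (v ^ n)"
  by (induction n) (auto intro: has_value_intros)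

lemma has_value_eq: "has_value f a b v \<Longrightarrow> v = w \<Longrightarrow> has_value f a b w"
  by simp

text \<open>The exceptional curve is contracted to the blown-up point, so a function regular there
  is constant on the curve. In this way Taylor remainders stay regular through further
  blow-ups.\<close>

lemma has_value_blowup_uv:
  fixes f :: "'k::field_char_0 \<Rightarrow> 'k \<Rightarrow> 'k"
  assumes "has_value f a b v"
  shows "has_value (\<lambda>u w. f (a + u) (b + u * w)) 0 c v"
proof -
  from assms obtain N E where q: "is_quotient f N E" "E a b \<noteq> 0" "v = N a b / E a b"
    unfolding has_value_def by blast
  then have "is_quotient (\<lambda>u w. f (a + u) (b + u * w))
     (\<lambda>u w. N (a + u) (b + u * w)) (\<lambda>u w. E (a + u) (b + u * w))"
    by (auto simp: is_quotient_iff intro!: nzpoly_blowup_uv geq_blowup_uv[of f] polyfun2_comp[of N "\<lambda>u w. a + u"] polyfun2_intros)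
  then show ?thesis
    unfolding has_value_def using q
    by (rule_tac exI[of _ "\<lambda>u w. N (a + u) (b + u * w)"],
        rule_tac exI[of _ "\<lambda>u w. E (a + u) (b + u * w)"]) simp
qed

lemma is_quotient_swap:
  "is_quotient f N E \<Longrightarrow> is_quotient (\<lambda>y z. f z y) (\<lambda>y z. N z y) (\<lambda>y z. E z y)"
  unfolding is_quotient_iff using polyfun2_swap nzpoly_swap geq_swap by blast

lemma has_value_swap: "has_value f a b v \<Longrightarrow> has_value (\<lambda>y z. f z y) b a v"
  unfolding has_value_def using is_quotient_swap by fastforce

lemma has_value_blowup_UV:
  fixes f :: "'k::field_char_0 \<Rightarrow> 'k \<Rightarrow> 'k"
  assumes "has_value f a b v"
  shows "has_value (\<lambda>U V. f (a + U * V) (b + V)) c 0 v"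
  using has_value_swap[OF has_value_blowup_uv[OF has_value_swap[OF assms], of c]]
  by (simp add: mult.commute)

lemma poleI:
  fixes f :: "'k::field_char_0 \<Rightarrow> 'k \<Rightarrow> 'k"
  assumes "f \<doteq> (\<lambda>y z. F y z / G y z)" "has_value F a b v" "v \<noteq> 0" "nzpoly G" "G a b = 0"
  shows "pole_at f a b"
proof -
  from assms obtain N E where q: "is_quotient F N E" "E a b \<noteq> 0" "v = N a b / E a b"
    unfolding has_value_def by blast
  note assms(1)
  also have "(\<lambda>y z. F y z / G y z) \<doteq> (\<lambda>y z. (N y z / E y z) / G y z)"
    using q geq_cong2[of F "\<lambda>y z. N y z / E y z" F F "\<lambda>y z a b. a / G y z"]
    by (auto simp: is_quotient_iff)
  finally have "is_quotient f N (\<lambda>y z. E y z * G y z)"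
    using q assms by (auto simp: is_quotient_iff intro!: nzpoly_intros)
  then show ?thesis
    unfolding pole_at_def using q assms
    by (rule_tac exI[of _ N], rule_tac exI[of _ "\<lambda>y z. E y z * G y z"]) simp
qed

lemma pole_divide:
  fixes F :: "'k::field_char_0 \<Rightarrow> 'k \<Rightarrow> 'k"
  shows "has_value F a b v \<Longrightarrow> v \<noteq> 0 \<Longrightarrow> nzpoly G \<Longrightarrow> G a b = 0 \<Longrightarrow> pole_at (\<lambda>y z. F y z / G y z) a b"
  by (rule poleI[OF geq_refl])

text \<open>A positive, checkable form of not being 0/0: one quotient whose numerator and
  denominator do not both vanish.\<close>

definition definite_at :: "('k::field \<Rightarrow> 'k \<Rightarrow> 'k) \<Rightarrow> 'k \<Rightarrow> 'k \<Rightarrow> bool" where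
  "definite_at f a b \<longleftrightarrow> regular_at f a b \<or> pole_at f a b"

lemma definite_not_indeterminate: "definite_at f a b \<Longrightarrow> \<not> indeterminate_at f a b"
  by (auto simp: definite_at_def regular_not_indeterminate pole_not_indeterminate)

lemma definite_divide:
  fixes F :: "'k::field_char_0 \<Rightarrow> 'k \<Rightarrow> 'k"
  assumes "has_value F a b v" "nzpoly G" "v \<noteq> 0 \<or> G a b \<noteq> 0"
  shows "definite_at (\<lambda>y z. F y z / G y z) a b"
proof (cases "G a b = 0")
  case True
  then show ?thesis using assms pole_divide[of F a b v G] by (simp add: definite_at_def)
next
  case False
  then show ?thesis
    using has_value_divide[OF assms(1) has_value_poly[OF nzpoly_polyfun2[OF assms(2)]]]
    by (auto simp: definite_at_def regular_at_iff)
qed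

text \<open>If \<open>V ^ j * G + u * H\<close> is divided by a power of \<open>u\<close>, the curve \<open>u = 0\<close> cannot be cancelled,
  since \<open>V ^ j * G\<close> does not vanish on it.\<close>

lemma indeterminateI:
  fixes f :: "'k::field_char_0 \<Rightarrow> 'k \<Rightarrow> 'k"
  assumes f: "f \<doteq> (\<lambda>u v. ((v - c) ^ j * G u v + u * H u v) / u ^ k)"
    and G: "has_value G 0 c \<gamma>" "\<gamma> \<noteq> 0" and H: "has_value H 0 c \<theta>" and jk: "j > 0" "k > 0"
  shows "indeterminate_at f 0 c"
  unfolding indeterminate_at_def
proof (intro allI impI)
  fix N E assume NE: "is_quotient f N E"
  from G obtain GN GE where g: "is_quotient G GN GE" "GE 0 c \<noteq> 0" "\<gamma> = GN 0 c / GE 0 c"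
    unfolding has_value_def by blast
  from H obtain HN HE where h: "is_quotient H HN HE" "HE 0 c \<noteq> 0"
    unfolding has_value_def by blast
  have polys: "polyfun2 N" "polyfun2 GN" "polyfun2 HN" "polyfun2 E" "polyfun2 GE" "polyfun2 HE"
    using NE g h by (auto simp: is_quotient_iff nzpoly_polyfun2)
  define K where "K u v = (v - c) ^ j * GN u v * HE u v + u * HN u v * GE u v" for u v
  have "f \<doteq> (\<lambda>u v. ((v - c) ^ j * (GN u v / GE u v) + u * (HN u v / HE u v)) / u ^ k)"
    by (rule geq_trans[OF f], rule geq_cong2[where H = "\<lambda>u v a b. ((v - c) ^ j * a + u * b) / u ^ k"])
      (use g h in \<open>simp_all add: is_quotient_iff\<close>)
  also have "\<dots> \<doteq> (\<lambda>u v. K u v / (GE u v * HE u v * u ^ k))"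
    by (rule geqI[of "\<lambda>u v. GE u v * HE u v * u"])
      (use g h in \<open>auto simp: is_quotient_iff K_def field_simps intro!: nzpoly_intros\<close>)
  finally have "is_quotient f K (\<lambda>u v. GE u v * HE u v * u ^ k)"
    unfolding is_quotient_iff K_def using g h polys
    by (auto intro!: polyfun2_intros nzpoly_intros simp: is_quotient_iff)
  note cross = is_quotient_cross[OF NE this]
  have pK: "polyfun2 K" unfolding K_def by (intro polyfun2_intros polys)
  \<comment> \<open>The k factors u are shown to divide E one at a time: cancel u^i in the
    cross-multiplied identity, then set u = 0.\<close>
  have "\<exists>M. polyfun2 M \<and> (\<forall>u v. E u v = u ^ i * M u v)" if "i \<le> k" for i
    using that
  proof (induction i)
    case 0
    then show ?case using polys by auto
  next
    case (Suc i)
    then obtain M where M: "polyfun2 M" "\<And>u v. E u v = u ^ i * M u v" by auto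
    define L where "L u v = N u v * (GE u v * HE u v * u ^ (k - i)) - K u v * M u v" for u v
    have pL: "polyfun2 L" unfolding L_def by (intro polyfun2_intros polys M pK)
    have uk: "u ^ k = u ^ i * u ^ (k - i)" for u :: 'k
      using Suc.prems by (simp flip: power_add)
    have "u ^ i * L u v = 0" for u v
      using cross[of u v] M(2)[of u v] uk[of u] by (simp add: L_def algebra_simps)
    then have "(\<lambda>u v. L u v) \<doteq> (\<lambda>u v. 0)"
      by (intro geqI[of "\<lambda>u v. u"]) (auto intro: nzpoly_intros)
    then have "L u v = 0" for u v by (rule geq_poly_eq) (auto intro: pL polyfun2_intros)
    from this[of 0] Suc.prems have "K 0 v * M 0 v = 0" for v by (simp add: L_def power_0_left)
    then have z: "(v - c) ^ j * (GN 0 v * HE 0 v * M 0 v) = 0" for v by (simp add: K_def mult_ac)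
    have "(\<lambda>u v. GN 0 v * HE 0 v * M 0 v) \<doteq> (\<lambda>u v. 0)"
      using z by (intro geqI[of "\<lambda>u v. v - c"] nzpolyI[of _ 0 "c + 1"] polyfun2_intros) auto
    then have "GN 0 v * HE 0 v * M 0 v = 0" for v
      by (rule geq_poly_eq) (auto intro!: polyfun2_intros polyfun2_comp[OF polys(2)]
          polyfun2_comp[OF polys(6)] polyfun2_comp[OF M(1)])
    \<comment> \<open>GN and HE are nonzero at (0, c), so their product is not identically zero on
      the line u = 0, and M has to vanish there.\<close>
    then have "M 0 v = 0" for v
      using g h G polys M by (intro polyfun2_vanish_fst_mult[of "\<lambda>u v. GN u v * HE u v" M c])
        (auto intro: polyfun2_intros)
    then obtain M' where "polyfun2 M'" "\<And>u v. M u v = u * M' u v"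
      using polyfun2_vanish_fst M(1) by blast
    then show ?case using M by (auto simp: mult_ac intro!: exI[of _ M'])
  qed
  from this[of k] obtain M where M: "polyfun2 M" "\<And>u v. E u v = u ^ k * M u v" by auto
  \<comment> \<open>With u^k cancelled, evaluation at (0, c) gives N = 0, since K vanishes there
    while GE and HE do not.\<close>
  have "(\<lambda>u v. N u v * (GE u v * HE u v)) \<doteq> (\<lambda>u v. K u v * M u v)"
    using cross M by (intro geqI[of "\<lambda>u v. u"] nzpoly_intros) (auto simp: mult_ac)
  then have "N 0 c * (GE 0 c * HE 0 c) = K 0 c * M 0 c"
    by (rule geq_poly_eq) (intro polyfun2_intros polys M pK)+
  moreover have "K 0 c = 0" using jk by (simp add: K_def)
  ultimately show "N 0 c = 0 \<and> E 0 c = 0"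
    using g h M jk by simp
qed

section \<open>Blow-ups of vector fields\<close>

definition veq :: "'k::field vfield \<Rightarrow> 'k vfield \<Rightarrow> bool" where
  "veq S T \<longleftrightarrow> fst S \<doteq> fst T \<and> snd S \<doteq> snd T"

lemma veqI: "f \<doteq> f' \<Longrightarrow> g \<doteq> g' \<Longrightarrow> veq (f, g) (f', g')"
  by (simp add: veq_def)

lemma veq_sym: "veq S T \<Longrightarrow> veq T S"
  by (auto simp: veq_def intro: geq_sym)

lemma veq_trans:
  fixes S T U :: "'k::field_char_0 vfield"
  shows "veq S T \<Longrightarrow> veq T U \<Longrightarrow> veq S U"
  by (auto simp: veq_def intro: geq_trans)

definition vswap :: "'k vfield \<Rightarrow> 'k vfield" where
  "vswap S = (\<lambda>y z. snd S z y, \<lambda>y z. fst S z y)"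

lemma vswap_vswap [simp]: "vswap (vswap S) = S"
  by (simp add: vswap_def)

lemma veq_vswap: "veq S T \<Longrightarrow> veq (vswap S) (vswap T)"
  by (auto simp: veq_def vswap_def dest: geq_swap)

lemma is_quotient_swap_iff:
  "is_quotient (\<lambda>y z. f z y) N E \<longleftrightarrow> is_quotient f (\<lambda>y z. N z y) (\<lambda>y z. E z y)"
  using is_quotient_swap[of "\<lambda>y z. f z y" N E]
    is_quotient_swap[of f "\<lambda>y z. N z y" "\<lambda>y z. E z y"] by auto

lemma indeterminate_at_swap: "indeterminate_at (\<lambda>y z. f z y) a b \<longleftrightarrow> indeterminate_at f b a"
proof -
  have "indeterminate_at (\<lambda>y z. f z y) a b" if "indeterminate_at f b a" for f :: "'a \<Rightarrow> 'a \<Rightarrow> 'a" and a b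
    using that unfolding indeterminate_at_def is_quotient_swap_iff[of f] by blast
  from this[of f b a] this[of "\<lambda>y z. f z y" a b] show ?thesis by (rule iffI[rotated])
qed

lemma regular_at_swap: "regular_at (\<lambda>y z. f z y) a b \<longleftrightarrow> regular_at f b a"
  unfolding regular_at_iff
  by (rule iffI; erule exE) (rule exI, erule has_value_swap)+

lemma base_point_vswap: "base_point (vswap S) a b \<longleftrightarrow> base_point S b a"
  by (simp add: base_point_def vswap_def indeterminate_at_swap[of "fst S"]
      indeterminate_at_swap[of "snd S"] disj_commute)

lemma vf_regular_at_vswap: "vf_regular_at (vswap S) a b \<longleftrightarrow> vf_regular_at S b a"
  by (simp add: vf_regular_at_def vswap_def regular_at_swap[of "fst S"]
      regular_at_swap[of "snd S"] conj_commute)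

lemma base_point_veq:
  fixes S T :: "'k::field_char_0 vfield"
  shows "veq S T \<Longrightarrow> base_point S a b \<longleftrightarrow> base_point T a b"
  by (simp add: veq_def base_point_def indeterminate_at_geq[of "fst S" "fst T"]
      indeterminate_at_geq[of "snd S" "snd T"])

lemma vf_regular_at_veq:
  fixes S T :: "'k::field_char_0 vfield"
  shows "veq S T \<Longrightarrow> vf_regular_at S a b \<longleftrightarrow> vf_regular_at T a b"
  by (simp add: veq_def vf_regular_at_def regular_at_geq[of "fst S" "fst T"]
      regular_at_geq[of "snd S" "snd T"])

lemma vf_regular_not_base: "vf_regular_at S a b \<Longrightarrow> \<not> base_point S a b"
  by (auto simp: base_point_def vf_regular_at_def regular_not_indeterminate)

text \<open>Exchanging the coordinates turns one blow-up chart into the other, so facts about the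
  curve u = 0 also serve the curve V = 0.\<close>

lemma blowup_UV_eq_vswap: "blowup_UV d a b S = vswap (blowup_uv d b a (vswap S))"
  by (simp add: blowup_UV_def blowup_uv_def vswap_def mult.commute)

lemma veq_blowup_uv:
  fixes S T :: "'k::field_char_0 vfield"
  assumes "veq S T"
  shows "veq (blowup_uv d a b S) (blowup_uv d a b T)"
proof -
  note st = assms[unfolded veq_def]
  note fs = st[THEN conjunct1, THEN geq_blowup_uv[of _ _ a b]]
    and sn = st[THEN conjunct2, THEN geq_blowup_uv[of _ _ a b]]
  show ?thesis
    unfolding veq_def blowup_uv_def fst_conv snd_conv
    using geq_cong2[OF fs sn, where H = "\<lambda>u v A B. A - d a"]
      geq_cong2[OF fs sn, where H = "\<lambda>u v A B. (B - d b - v * (A - d a)) / u"] by simp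
qed

lemma veq_blowup_UV:
  fixes S T :: "'k::field_char_0 vfield"
  shows "veq S T \<Longrightarrow> veq (blowup_UV d a b S) (blowup_UV d a b T)"
  by (simp add: blowup_UV_eq_vswap veq_vswap veq_blowup_uv)

lemma cascades_regular_iff:
  "cascades_regular d S a b \<longleftrightarrow>
     (\<forall>c. base_point (blowup_uv d a b S) 0 c \<longrightarrow> cascades_regular d (blowup_uv d a b S) 0 c) \<and>
     (\<forall>c. base_point (blowup_UV d a b S) c 0 \<longrightarrow> cascades_regular d (blowup_UV d a b S) c 0) \<and>
     ((\<exists>c. base_point (blowup_uv d a b S) 0 c) \<or> (\<exists>c. base_point (blowup_UV d a b S) c 0) \<or>
      (\<forall>c. vf_regular_at (blowup_uv d a b S) 0 c) \<or> (\<forall>c. vf_regular_at (blowup_UV d a b S) c 0))"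
  by (subst cascades_regular.simps) blast

text \<open>Blow-ups preserve generic equality, and base points and regularity see nothing finer;
  induction carries this through the cascade. Hence each blown-up field may be replaced by a
  simplified formula.\<close>

lemma cascades_regular_veq_imp:
  fixes S T :: "'k::field_char_0 vfield"
  assumes "cascades_regular d S a b" "veq S T"
  shows "cascades_regular d T a b"
  using assms
proof (induction arbitrary: T rule: cascades_regular.induct)
  case (blow_up a b S)
  note uv = veq_blowup_uv[OF blow_up.prems, of d a b]
    and UV = veq_blowup_UV[OF blow_up.prems, of d a b]
  show ?case
    using blow_up.IH(1)[OF _ uv] blow_up.IH(2)[OF _ UV] blow_up.hyps
    unfolding base_point_veq[OF uv] base_point_veq[OF UV]
      vf_regular_at_veq[OF uv] vf_regular_at_veq[OF UV]
    by (rule_tac cascades_regular.blow_up) simp_all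
qed

lemma cascades_regular_veq:
  fixes S T :: "'k::field_char_0 vfield"
  shows "veq S T \<Longrightarrow> cascades_regular d S a b \<longleftrightarrow> cascades_regular d T a b"
  using cascades_regular_veq_imp veq_sym by blast

lemma cascades_regular_vswap_imp:
  "cascades_regular d S a b \<Longrightarrow> cascades_regular d (vswap S) b a"
proof (induction rule: cascades_regular.induct)
  case (blow_up a b S)
  have uv: "blowup_uv d b a (vswap S) = vswap (blowup_UV d a b S)"
    and UV: "blowup_UV d b a (vswap S) = vswap (blowup_uv d a b S)"
    by (simp_all add: blowup_UV_eq_vswap)
  show ?case
    by (rule cascades_regular.blow_up)
      (use blow_up in \<open>auto simp: uv UV base_point_vswap vf_regular_at_vswap\<close>)
qed

lemma cascades_regular_vswap: "cascades_regular d (vswap S) a b \<longleftrightarrow> cascades_regular d S b a"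
  using cascades_regular_vswap_imp[of d S b a] cascades_regular_vswap_imp[of d "vswap S" a b] by auto

section \<open>Rescaling of time\<close>

definition vscale :: "'k \<Rightarrow> 'k::field vfield \<Rightarrow> 'k vfield" where
  "vscale x S = (\<lambda>y z. x * fst S y z, \<lambda>y z. x * snd S y z)"

lemma is_quotient_scale:
  fixes f :: "'k::field_char_0 \<Rightarrow> 'k \<Rightarrow> 'k"
  assumes "is_quotient f N E"
  shows "is_quotient (\<lambda>y z. x * f y z) (\<lambda>y z. x * N y z) E"
  using assms geq_cong2[of f "\<lambda>y z. N y z / E y z" f f "\<lambda>y z a b. x * a"]
  by (auto simp: is_quotient_iff intro: polyfun2_intros)

lemma is_quotient_scale_iff:
  fixes f :: "'k::field_char_0 \<Rightarrow> 'k \<Rightarrow> 'k"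
  assumes "x \<noteq> 0"
  shows "is_quotient (\<lambda>y z. x * f y z) N E \<longleftrightarrow> is_quotient f (\<lambda>y z. inverse x * N y z) E"
  using is_quotient_scale[of "\<lambda>y z. x * f y z" N E "inverse x"]
    is_quotient_scale[of f "\<lambda>y z. inverse x * N y z" E x] assms
  by (auto simp flip: mult.assoc)

lemma indeterminate_at_scale:
  fixes f :: "'k::field_char_0 \<Rightarrow> 'k \<Rightarrow> 'k"
  assumes "x \<noteq> 0"
  shows "indeterminate_at (\<lambda>y z. x * f y z) a b \<longleftrightarrow> indeterminate_at f a b"
  unfolding indeterminate_at_def
proof (intro iffI allI impI)
  fix N E assume "is_quotient f N E"
    and *: "\<forall>N E. is_quotient (\<lambda>y z. x * f y z) N E \<longrightarrow> N a b = 0 \<and> E a b = 0"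
  from *[rule_format, OF is_quotient_scale[OF this(1)]] assms show "N a b = 0 \<and> E a b = 0" by simp
next
  fix N E assume "is_quotient (\<lambda>y z. x * f y z) N E"
    and *: "\<forall>N E. is_quotient f N E \<longrightarrow> N a b = 0 \<and> E a b = 0"
  from *[rule_format, OF this(1)[unfolded is_quotient_scale_iff[OF assms]]] assms
  show "N a b = 0 \<and> E a b = 0" by simp
qed

lemma regular_at_scale:
  fixes f :: "'k::field_char_0 \<Rightarrow> 'k \<Rightarrow> 'k"
  assumes "x \<noteq> 0"
  shows "regular_at (\<lambda>y z. x * f y z) a b \<longleftrightarrow> regular_at f a b"
  unfolding regular_at_def using is_quotient_scale is_quotient_scale_iff[OF assms] by blast

lemma base_point_vscale:
  fixes S :: "'k::field_char_0 vfield"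
  shows "x \<noteq> 0 \<Longrightarrow> base_point (vscale x S) a b \<longleftrightarrow> base_point S a b"
  by (simp add: base_point_def vscale_def indeterminate_at_scale)

lemma vf_regular_at_vscale:
  fixes S :: "'k::field_char_0 vfield"
  shows "x \<noteq> 0 \<Longrightarrow> vf_regular_at (vscale x S) a b \<longleftrightarrow> vf_regular_at S a b"
  by (simp add: vf_regular_at_def vscale_def regular_at_scale)

text \<open>The centre of a blow-up moves with velocity \<open>d a\<close>, so the derivation has to
  be rescaled together with the field.\<close>

lemma blowup_uv_vscale:
  "blowup_uv (\<lambda>t. x * d t) a b (vscale x S) = vscale x (blowup_uv d a b S)"
  unfolding blowup_uv_def vscale_def
  by (auto simp: fun_eq_iff right_diff_distrib mult_ac)

lemma blowup_UV_vscale: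
  "blowup_UV (\<lambda>t. x * d t) a b (vscale x S) = vscale x (blowup_UV d a b S)"
  unfolding blowup_UV_def vscale_def
  by (auto simp: fun_eq_iff right_diff_distrib mult_ac)

lemma vscale_vscale: "vscale x (vscale y S) = vscale (x * y) S"
  by (simp add: vscale_def mult.assoc)

lemma vscale_1 [simp]: "vscale 1 S = S"
  by (simp add: vscale_def)

lemma cascades_regular_vscale_imp:
  fixes S :: "'k::field_char_0 vfield"
  assumes "x \<noteq> 0"
  shows "cascades_regular d S a b \<Longrightarrow> cascades_regular (\<lambda>t. x * d t) (vscale x S) a b"
proof (induction rule: cascades_regular.induct)
  case (blow_up a b S)
  show ?case
    by (rule cascades_regular.blow_up, unfold blowup_uv_vscale blowup_UV_vscale)
      (use blow_up assms in \<open>auto simp: base_point_vscale vf_regular_at_vscale\<close>)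
qed

lemma cascades_regular_vscale:
  fixes S :: "'k::field_char_0 vfield"
  assumes "x \<noteq> 0"
  shows "cascades_regular (\<lambda>t. x * d t) (vscale x S) a b \<longleftrightarrow> cascades_regular d S a b"
  using cascades_regular_vscale_imp[OF assms, of d S a b]
    cascades_regular_vscale_imp[of "inverse x" "\<lambda>t. x * d t" "vscale x S" a b] assms
  by (auto simp: vscale_vscale simp flip: mult.assoc)

lemma regularised_vscale:
  fixes S :: "'k::field_char_0 vfield"
  assumes "x \<noteq> 0"
  shows "regularised (\<lambda>t. x * d t) (vscale x S) \<longleftrightarrow> regularised d S"
proof -
  have "chart_uv0 (vscale x S) = vscale x (chart_uv0 S)"
    "chart_UV0 (vscale x S) = vscale x (chart_UV0 S)"
    by (auto simp: chart_uv0_def chart_UV0_def vscale_def fun_eq_iff algebra_simps)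
  then show ?thesis
    by (simp add: regularised_def base_point_vscale[OF assms] cascades_regular_vscale[OF assms])
qed

section \<open>Generic equality in the charts at infinity\<close>

lemma chart_UV0_eq_vswap: "chart_UV0 S = vswap (chart_uv0 (vswap S))"
  by (simp add: chart_UV0_def chart_uv0_def vswap_def)

lemma nzpoly_chart_uv0:
  fixes R :: "'k::field_char_0 \<Rightarrow> 'k \<Rightarrow> 'k"
  assumes "nzpoly R"
  obtains T where "nzpoly T" "\<And>u v. T u v \<noteq> 0 \<Longrightarrow> u \<noteq> 0 \<and> R (1 / u) (v / u) \<noteq> 0"
proof -
  obtain n c where R: "\<And>y z. R y z = bipoly n c y z"
    using assms by (auto simp: nzpoly_def polyfun2_def)
  \<comment> \<open>R (1/u) (v/u) is multiplied by u^(2 n + 1): the power 2 n clears the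
    denominators, as i + j \<le> 2 n, and the additional factor makes T vanish on u = 0, so that T u
    v \<noteq> 0 excludes that line.\<close>
  define T where "T u v = (\<Sum>i\<le>n. \<Sum>j\<le>n. c i j * u ^ (2 * n + 1 - (i + j)) * v ^ j)" for u v
  have T: "T u v = u ^ (2 * n + 1) * R (1 / u) (v / u)" if "u \<noteq> 0" for u v
    unfolding T_def R bipoly_def sum_distrib_left
  proof (intro sum.cong refl)
    fix i j assume "i \<in> {..n}" "j \<in> {..n}"
    then have "u ^ (2 * n + 1) = u ^ (2 * n + 1 - (i + j)) * (u ^ i * u ^ j)"
      by (simp flip: power_add)
    then show "c i j * u ^ (2 * n + 1 - (i + j)) * v ^ j =
        u ^ (2 * n + 1) * (c i j * (1 / u) ^ i * (v / u) ^ j)"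
      using that by (simp add: power_divide)
  qed
  have T0: "T 0 v = 0" for v
    unfolding T_def by (intro sum.neutral ballI) (auto simp: power_0_left)
  have pT: "polyfun2 T" unfolding T_def by (intro polyfun2_intros)
  obtain y z where "R y z \<noteq> 0" "y \<noteq> 0" using nzpoly_nonzero_fst[OF assms] .
  then have "T (1 / y) (z / y) \<noteq> 0" by (simp add: T)
  then have "nzpoly T" by (intro nzpolyI[OF pT])
  moreover have "u \<noteq> 0 \<and> R (1 / u) (v / u) \<noteq> 0" if "T u v \<noteq> 0" for u v
    using that T0 T by (cases "u = 0") auto
  ultimately show ?thesis using that by blast
qed

lemma veq_chart_uv0:
  fixes S T :: "'k::field_char_0 vfield"
  assumes "veq S T"
  shows "veq (chart_uv0 S) (chart_uv0 T)"
proof -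
  have *: "(\<lambda>u v. f (1 / u) (v / u)) \<doteq> (\<lambda>u v. g (1 / u) (v / u))" if "f \<doteq> g"
    for f g :: "'k \<Rightarrow> 'k \<Rightarrow> 'k"
  proof -
    from that obtain R where R: "nzpoly R" "\<And>y z. R y z \<noteq> 0 \<Longrightarrow> f y z = g y z"
      unfolding geq_def by blast
    from nzpoly_chart_uv0[OF R(1)] obtain T where
      "nzpoly T" "\<And>u v. T u v \<noteq> 0 \<Longrightarrow> R (1 / u) (v / u) \<noteq> 0" by metis
    with R show ?thesis by (intro geqI[of T]) auto
  qed
  note st = assms[unfolded veq_def]
  note fs = st[THEN conjunct1, THEN *] and sn = st[THEN conjunct2, THEN *]
  show ?thesis
    unfolding veq_def chart_uv0_def fst_conv snd_conv
    using geq_cong2[OF fs sn, where H = "\<lambda>u v A B. - u\<^sup>2 * A"]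
      geq_cong2[OF fs sn, where H = "\<lambda>u v A B. u * (B - v * A)"] by simp
qed

lemma regularised_veq:
  fixes S T :: "'k::field_char_0 vfield"
  assumes "veq S T"
  shows "regularised d S \<longleftrightarrow> regularised d T"
proof -
  have "veq (chart_uv0 S) (chart_uv0 T)" "veq (chart_UV0 S) (chart_UV0 T)"
    using assms by (simp_all add: chart_UV0_eq_vswap veq_vswap veq_chart_uv0)
  then show ?thesis
    using assms by (simp add: regularised_def base_point_veq cascades_regular_veq)
qed

section \<open>Base points with a prescribed linear part\<close>

text \<open>Kept abstract because it is instantiated twice on Laurent series, by d/dx and by x
  d/dx.\<close>

locale derivation =
  fixes d :: "'k::field_char_0 \<Rightarrow> 'k"
  assumes d_add: "d (x + y) = d x + d y"
    and d_mult: "d (x * y) = d x * y + x * d y"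
begin

lemma d_0 [simp]: "d 0 = 0"
  using d_add[of 0 0] by simp

lemma d_1 [simp]: "d 1 = 0"
  using d_mult[of 1 1] by simp

lemma d_minus: "d (- x) = - d x"
  using d_add[of x "- x"] by (simp add: eq_neg_iff_add_eq_0 add.commute)

lemma d_of_nat [simp]: "d (of_nat n) = 0"
  by (induction n) (simp_all add: d_add)

lemma d_numeral [simp]: "d (numeral n) = 0"
  using d_of_nat[of "numeral n"] by simp

lemma d_inverse: "d (inverse x) = - d x / x\<^sup>2"
proof (cases "x = 0")
  case False
  then have "d x * inverse x + x * d (inverse x) = 0"
    using d_mult[of x "inverse x"] by simp
  then have "x * d (inverse x) = - (d x * inverse x)"
    by (simp add: eq_neg_iff_add_eq_0 add.commute)
  then have "inverse x * (x * d (inverse x)) = inverse x * - (d x * inverse x)"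
    by (rule arg_cong)
  then show ?thesis using False by (simp add: power2_eq_square field_simps)
qed simp

lemma d_divide: "d (x / y) = (d x * y - x * d y) / y\<^sup>2"
  by (cases "y = 0") (simp_all add: divide_inverse[of x y] d_mult d_inverse,
      simp_all add: power2_eq_square field_simps)

lemma d_power: "d (x ^ n) = of_nat n * x ^ (n - 1) * d x"
proof (induction n)
  case (Suc n)
  then show ?case by (cases n) (simp_all add: d_mult algebra_simps)
qed simp

text \<open>In this lemma and the next \<open>u = 0\<close> is the exceptional curve, and the field there is
  \<open>m \<partial>u + (\<dots> / u) \<partial>v\<close>; the numerator has eigenvalue \<open>m\<close> here and \<open>2 m\<close> in the next lemma. After one,
  respectively two, blow-ups the pole along the exceptional curve has a constant coefficient, the
  difference of the two sides of the criterion. If that is not zero, one more blow-up shows that the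
  pole persists.\<close>

lemma cascades_regular_simple:
  assumes f: "fst S \<doteq> (\<lambda>u v. m + u * F1 u v + (v - c) * F2 u v)"
    and g: "snd S \<doteq> (\<lambda>u v. (m * (v - c) + k * u + u\<^sup>2 * A u v + u * (v - c) * B u v + (v - c)\<^sup>2 * C u v) / u)"
    and "regular_at F1 0 c" "regular_at F2 0 c" "regular_at A 0 c" "regular_at B 0 c" "regular_at C 0 c"
    and m: "m \<noteq> 0"
  shows "base_point S 0 c" and "cascades_regular d S 0 c \<longleftrightarrow> k = d c"
proof -
  from assms obtain F1c F2c Ac Bc Cc where reg: "has_value F1 0 c F1c" "has_value F2 0 c F2c"
    "has_value A 0 c Ac" "has_value B 0 c Bc" "has_value C 0 c Cc"
    unfolding regular_at_iff by blast
  have "indeterminate_at (snd S) 0 c"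
  proof (rule indeterminateI[where j = 1 and k = 1])
    show "snd S \<doteq> (\<lambda>u v. ((v - c) ^ 1 * (m + (v - c) * C u v) +
        u * (k + u * A u v + (v - c) * B u v)) / u ^ 1)"
      using g by (simp add: algebra_simps power2_eq_square)
    show "has_value (\<lambda>u v. m + (v - c) * C u v) 0 c m"
      by (rule has_value_eq, (rule has_value_intros reg)+) simp
    show "has_value (\<lambda>u v. k + u * A u v + (v - c) * B u v) 0 c k"
      by (rule has_value_eq, (rule has_value_intros reg)+) simp
  qed (use m in auto)
  then show "base_point S 0 c" by (simp add: base_point_def)
  \<comment> \<open>The coefficient of 1/u left after the blow-up v = c + u w: the term m w of the
    numerator cancels against w u', and the motion of the centre contributes - d c.\<close>
  define \<kappa> where "\<kappa> = k - d c"
  define Su where "Su = (\<lambda>u w. m + u * (F1 u (c + u * w) + w * F2 u (c + u * w)),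
    \<lambda>u w. (\<kappa> + u * (A u (c + u * w) + w * B u (c + u * w) + w\<^sup>2 * C u (c + u * w)
       - w * (F1 u (c + u * w) + w * F2 u (c + u * w)))) / u)"
  define L where "L U V = U\<^sup>2 * A (U * V) (c + V) + U * B (U * V) (c + V) + C (U * V) (c + V)" for U V
  define M where "M U V = U * F1 (U * V) (c + V) + F2 (U * V) (c + V) - L U V" for U V
  define SU where "SU = (\<lambda>U V. (- \<kappa> * U + V * M U V) / V,
    \<lambda>U V. (m + k * U + V * L U V - U * d c) / U)"
  have S: "veq S (\<lambda>u v. m + u * F1 u v + (v - c) * F2 u v,
      \<lambda>u v. (m * (v - c) + k * u + u\<^sup>2 * A u v + u * (v - c) * B u v + (v - c)\<^sup>2 * C u v) / u)"
    using f g by (simp add: veq_def)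
  have Su: "veq (blowup_uv d 0 c S) Su"
    apply (rule veq_trans[OF veq_blowup_uv[OF S]])
    unfolding blowup_uv_def Su_def
    apply (rule veqI; rule geqI[OF nzpoly_fst])
     apply (simp add: algebra_simps)
    apply (simp add: field_simps \<kappa>_def power2_eq_square)
    done
  have SU: "veq (blowup_UV d 0 c S) SU"
    apply (rule veq_trans[OF veq_blowup_UV[OF S]])
    unfolding blowup_UV_def SU_def
    by (rule veqI; rule geqI[OF nzpoly_mult[OF nzpoly_fst nzpoly_snd]])
      (simp_all add: field_simps \<kappa>_def power2_eq_square L_def M_def)
  note ruv = reg[THEN has_value_blowup_uv, simplified]
  note rUV = reg[THEN has_value_blowup_UV, simplified]
  have L0: "has_value L w 0 (w\<^sup>2 * Ac + w * Bc + Cc)" for w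
    unfolding L_def by (intro has_value_intros rUV)
  have M0: "has_value M w 0 (w * F1c + F2c - (w\<^sup>2 * Ac + w * Bc + Cc))" for w
    unfolding M_def by (intro has_value_intros rUV L0)
  have regf: "regular_at (fst Su) 0 w" for w
    unfolding Su_def fst_conv by (rule has_value_regular, (rule has_value_intros ruv)+)
  \<comment> \<open>At the origin of the second chart there is a pole. It does no harm: a pole is
    not a base point, and regularity is asked in only one of the two charts.\<close>
  have gpole: "pole_at (snd SU) 0 0"
    unfolding SU_def snd_conv
    by (rule poleI[OF geq_refl, where v = m], rule has_value_eq, (rule has_value_intros L0)+)
      (use m in \<open>auto intro: nzpoly_intros\<close>)
  have greg: "regular_at (snd SU) w 0" if "w \<noteq> 0" for w
    unfolding SU_def snd_conv by (rule has_value_regular, (rule has_value_intros L0 that)+)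
  show "cascades_regular d S 0 c \<longleftrightarrow> k = d c"
  proof (cases "k = d c")
    case True
    then have \<kappa>: "\<kappa> = 0" by (simp add: \<kappa>_def)
    have "snd Su \<doteq> (\<lambda>u w. A u (c + u * w) + w * B u (c + u * w) + w\<^sup>2 * C u (c + u * w)
       - w * (F1 u (c + u * w) + w * F2 u (c + u * w)))"
      unfolding Su_def \<kappa> by (rule geqI[OF nzpoly_fst]) simp
    moreover have "has_value (\<lambda>u w. A u (c + u * w) + w * B u (c + u * w) + w\<^sup>2 * C u (c + u * w)
       - w * (F1 u (c + u * w) + w * F2 u (c + u * w))) 0 w (Ac + w * Bc + w\<^sup>2 * Cc - w * (F1c + w * F2c))" for w
      by (intro has_value_intros ruv)
    ultimately have "regular_at (snd Su) 0 w" for w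
      using has_value_regular regular_at_geq by blast
    with regf have Su_reg: "vf_regular_at Su 0 w" for w by (simp add: vf_regular_at_def)
    have "fst SU \<doteq> M" unfolding SU_def \<kappa> by (rule geqI[OF nzpoly_snd]) simp
    with M0 have "regular_at (fst SU) w 0" for w
      using has_value_regular regular_at_geq by blast
    with greg gpole have "\<not> base_point SU w 0" for w
      unfolding base_point_def using pole_not_indeterminate regular_not_indeterminate by metis
    with Su_reg show ?thesis
      using True by (subst cascades_regular_iff)
        (auto simp: base_point_veq[OF Su] base_point_veq[OF SU] vf_regular_at_veq[OF Su]
          vf_regular_not_base)
  next
    case False
    then have \<kappa>: "\<kappa> \<noteq> 0" by (simp add: \<kappa>_def)
    \<comment> \<open>The residue enters the first component as - \<kappa> U / V, which is 0/0 at
      the origin, so the cascade continues there.\<close>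
    have base: "base_point SU 0 0"
    proof -
      have "indeterminate_at (\<lambda>y z. fst SU z y) 0 0"
      proof (rule indeterminateI[where j = 1 and k = 1])
        show "(\<lambda>y z. fst SU z y) \<doteq> (\<lambda>u v. ((v - 0) ^ 1 * (- \<kappa>) + u * M v u) / u ^ 1)"
          by (simp add: SU_def mult.commute)
        show "has_value (\<lambda>u v. - \<kappa>) 0 0 (- \<kappa>)" by (rule has_value_const)
        show "has_value (\<lambda>u v. M v u) 0 0 (F2c - Cc)" using has_value_swap[OF M0[of 0]] by simp
      qed (use \<kappa> in auto)
      then show ?thesis by (simp add: indeterminate_at_swap[of "fst SU"] base_point_def)
    qed
    \<comment> \<open>In both charts of this further blow-up the field has a pole along the whole
      exceptional curve and no base point, so the cascade ends without regularity.\<close>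
    define Tu where "Tu = (\<lambda>u v. (- \<kappa> + v * M u (u * v)) / v,
      \<lambda>u v. (m + u * (k + v * L u (u * v) - d c + \<kappa> - v * M u (u * v))) / u\<^sup>2)"
    define TU where "TU = (\<lambda>U V. (- m + V * (- \<kappa> * U + M (U * V) V - k * U - L (U * V) V + U * d c)) / V\<^sup>2,
      \<lambda>U V. (m + V * (k * U + L (U * V) V - U * d c)) / (U * V))"
    have Tu: "veq (blowup_uv d 0 0 SU) Tu"
      unfolding blowup_uv_def SU_def Tu_def
      by (rule veqI; rule geqI[OF nzpoly_mult[OF nzpoly_fst nzpoly_snd]])
        (simp_all add: field_simps power2_eq_square)
    have TU: "veq (blowup_UV d 0 0 SU) TU"
      unfolding blowup_UV_def SU_def TU_def
      by (rule veqI; rule geqI[OF nzpoly_mult[OF nzpoly_fst nzpoly_snd]])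
        (simp_all add: field_simps power2_eq_square)
    have M: "has_value (\<lambda>u v. M u (u * v)) 0 w (F2c - Cc)"
      "has_value (\<lambda>U V. M (U * V) V) w 0 (F2c - Cc)"
      "has_value (\<lambda>u v. L u (u * v)) 0 w Cc" "has_value (\<lambda>U V. L (U * V) V) w 0 Cc" for w
      using has_value_blowup_uv[OF M0[of 0], of w] has_value_blowup_UV[OF M0[of 0], of w]
        has_value_blowup_uv[OF L0[of 0], of w] has_value_blowup_UV[OF L0[of 0], of w] by simp_all
    have fTu: "definite_at (fst Tu) 0 w" for w
      unfolding Tu_def fst_conv
      by (rule definite_divide, (rule has_value_intros M)+) (use \<kappa> in \<open>auto intro: nzpoly_intros polyfun2_intros\<close>)
    have sTu: "pole_at (snd Tu) 0 w" for w
      unfolding Tu_def snd_conv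
      by (rule pole_divide, (rule has_value_intros M)+) (use m in \<open>auto intro: nzpoly_intros\<close>)
    have fTU: "pole_at (fst TU) w 0" for w
      unfolding TU_def fst_conv
      by (rule pole_divide, (rule has_value_intros M)+) (use m in \<open>auto intro: nzpoly_intros\<close>)
    have sTU: "pole_at (snd TU) w 0" for w
      unfolding TU_def snd_conv
      by (rule pole_divide, (rule has_value_intros M)+) (use m in \<open>auto intro: nzpoly_intros\<close>)
    have "\<not> base_point Tu 0 w" "\<not> base_point TU w 0" "\<not> vf_regular_at Tu 0 w" "\<not> vf_regular_at TU w 0" for w
      using fTu[of w] sTu[of w] fTU[of w] sTU[of w]
      by (auto simp: base_point_def vf_regular_at_def definite_not_indeterminate
          pole_not_indeterminate pole_not_regular)
    then have "\<not> cascades_regular d SU 0 0"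
      by (subst cascades_regular_iff)
        (simp add: base_point_veq[OF Tu] base_point_veq[OF TU] vf_regular_at_veq[OF Tu] vf_regular_at_veq[OF TU])
    with base have "\<not> cascades_regular d S 0 c"
      by (subst cascades_regular_iff) (auto simp: base_point_veq[OF SU] cascades_regular_veq[OF SU])
    with False show ?thesis by simp
  qed
qed

lemma cascades_regular_double:
  assumes f: "fst S \<doteq> (\<lambda>u v. m + f10 * u + f01 * (v - c) +
      u\<^sup>2 * F1 u v + u * (v - c) * F2 u v + (v - c)\<^sup>2 * F3 u v)"
    and g: "snd S \<doteq> (\<lambda>u v. (2 * m * (v - c) + k * u + g20 * u\<^sup>2 + g11 * u * (v - c) + g02 * (v - c)\<^sup>2 +
      u ^ 3 * A u v + u\<^sup>2 * (v - c) * B u v + u * (v - c)\<^sup>2 * C u v + (v - c) ^ 3 * E u v) / u)"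
    and "regular_at F1 0 c" "regular_at F2 0 c" "regular_at F3 0 c"
      "regular_at A 0 c" "regular_at B 0 c" "regular_at C 0 c" "regular_at E 0 c"
    and m: "m \<noteq> 0" and c1: "c1 = (d c - k) / m"
  shows "base_point S 0 c"
    and "cascades_regular d S 0 c \<longleftrightarrow> g20 + (g11 - f10) * c1 + (g02 - f01) * c1\<^sup>2 = d c1"
proof -
  from assms obtain F1c F2c F3c Ac Bc Cc Ec where reg: "has_value F1 0 c F1c" "has_value F2 0 c F2c"
    "has_value F3 0 c F3c" "has_value A 0 c Ac" "has_value B 0 c Bc" "has_value C 0 c Cc" "has_value E 0 c Ec"
    unfolding regular_at_iff by blast
  have "indeterminate_at (snd S) 0 c"
  proof (rule indeterminateI[where j = 1 and k = 1])
    show "snd S \<doteq> (\<lambda>u v. ((v - c) ^ 1 * (2 * m + g02 * (v - c) + (v - c)\<^sup>2 * E u v) +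
        u * (k + g20 * u + g11 * (v - c) + u\<^sup>2 * A u v + u * (v - c) * B u v + (v - c)\<^sup>2 * C u v)) / u ^ 1)"
      using g by (simp add: algebra_simps power2_eq_square power3_eq_cube)
    show "has_value (\<lambda>u v. 2 * m + g02 * (v - c) + (v - c)\<^sup>2 * E u v) 0 c (2 * m)"
      by (rule has_value_eq, (rule has_value_intros reg)+) simp
    show "has_value (\<lambda>u v. k + g20 * u + g11 * (v - c) + u\<^sup>2 * A u v + u * (v - c) * B u v + (v - c)\<^sup>2 * C u v) 0 c k"
      by (rule has_value_eq, (rule has_value_intros reg)+) simp
  qed (use m in auto)
  then show "base_point S 0 c" by (simp add: base_point_def)
  \<comment> \<open>Under v = c + u w the numerator becomes m w + k - d c at u = 0, with the single
    zero c1. There the eigenvalue has dropped from 2 m to m, and the previous lemma applies.\<close>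
  have e: "d c = m * c1 + k" using m by (simp add: c1)
  define p where "p w = g20 + (g11 - f10) * w + (g02 - f01) * w\<^sup>2" for w
  define r where "r U = g20 * U\<^sup>2 + (g11 - f10) * U + (g02 - f01)" for U
  define H where "H u w = A u (c + u * w) + w * B u (c + u * w) + w\<^sup>2 * C u (c + u * w) + w ^ 3 * E u (c + u * w)
    - w * (F1 u (c + u * w) + w * F2 u (c + u * w) + w\<^sup>2 * F3 u (c + u * w))" for u w
  define Q where "Q U V = U ^ 3 * A (U * V) (c + V) + U\<^sup>2 * B (U * V) (c + V) + U * C (U * V) (c + V) + E (U * V) (c + V)" for U V
  define W where "W U V = U\<^sup>2 * F1 (U * V) (c + V) + U * F2 (U * V) (c + V) + F3 (U * V) (c + V)" for U V
  define Su where "Su = (\<lambda>u w. m + u * (f10 + f01 * w + u * (F1 u (c + u * w) + w * F2 u (c + u * w) + w\<^sup>2 * F3 u (c + u * w))),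
    \<lambda>u w. (m * (w - c1) + u * p w + u\<^sup>2 * H u w) / u)"
  define SU where "SU = (\<lambda>U V. (- m + m * c1 * U - V * r U + V\<^sup>2 * (W U V - Q U V)) / V,
    \<lambda>U V. (2 * m - m * c1 * U + V * (g20 * U\<^sup>2 + g11 * U + g02 + V * Q U V)) / U)"
  let ?S = "(\<lambda>u v. m + f10 * u + f01 * (v - c) +
      u\<^sup>2 * F1 u v + u * (v - c) * F2 u v + (v - c)\<^sup>2 * F3 u v,
      \<lambda>u v. (2 * m * (v - c) + k * u + g20 * u\<^sup>2 + g11 * u * (v - c) + g02 * (v - c)\<^sup>2 +
      u ^ 3 * A u v + u\<^sup>2 * (v - c) * B u v + u * (v - c)\<^sup>2 * C u v + (v - c) ^ 3 * E u v) / u)"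
  have S: "veq S ?S" using f g by (simp add: veq_def)
  have Su: "veq (blowup_uv d 0 c S) Su"
    apply (rule veq_trans[OF veq_blowup_uv[OF S]])
    unfolding blowup_uv_def Su_def
    apply (rule veqI; rule geqI[OF nzpoly_fst])
     apply (simp add: algebra_simps power2_eq_square)
    apply (simp add: field_simps e p_def H_def power2_eq_square power3_eq_cube)
    done
  have SU: "veq (blowup_UV d 0 c S) SU"
    apply (rule veq_trans[OF veq_blowup_UV[OF S]])
    unfolding blowup_UV_def SU_def
    apply (rule veqI; rule geqI[OF nzpoly_mult[OF nzpoly_fst nzpoly_snd]])
     apply (simp add: field_simps e power2_eq_square power3_eq_cube r_def W_def Q_def)
    apply (simp add: field_simps e power2_eq_square power3_eq_cube Q_def)
    done
  note ruv = reg[THEN has_value_blowup_uv, simplified]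
  note rUV = reg[THEN has_value_blowup_UV, simplified]
  have H0: "has_value H 0 w (Ac + w * Bc + w\<^sup>2 * Cc + w ^ 3 * Ec - w * (F1c + w * F2c + w\<^sup>2 * F3c))" for w
    unfolding H_def by (intro has_value_intros ruv)
  have Q0: "has_value Q w 0 (w ^ 3 * Ac + w\<^sup>2 * Bc + w * Cc + Ec)" for w
    unfolding Q_def by (intro has_value_intros rUV)
  have W0: "has_value W w 0 (w\<^sup>2 * F1c + w * F2c + F3c)" for w
    unfolding W_def by (intro has_value_intros rUV)
  \<comment> \<open>The number \<open>p c1\<close> takes the place of k; the rest of
    \<open>p\<close> is divisible by w - c1.\<close>
  have "base_point Su 0 c1 \<and> (cascades_regular d Su 0 c1 \<longleftrightarrow> p c1 = d c1)"
  proof -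
    have a: "fst Su \<doteq> (\<lambda>u w. m + u * (f10 + f01 * w + u * (F1 u (c + u * w) + w * F2 u (c + u * w) + w\<^sup>2 * F3 u (c + u * w)))
        + (w - c1) * 0)"
      by (simp add: Su_def)
    have b: "snd Su \<doteq> (\<lambda>u w. (m * (w - c1) + p c1 * u + u\<^sup>2 * H u w
        + u * (w - c1) * (g11 - f10 + (g02 - f01) * (w + c1)) + (w - c1)\<^sup>2 * 0) / u)"
      by (simp add: Su_def p_def algebra_simps power2_eq_square)
    have "regular_at (\<lambda>u w. f10 + f01 * w + u * (F1 u (c + u * w) + w * F2 u (c + u * w) + w\<^sup>2 * F3 u (c + u * w))) 0 c1"
      "regular_at (\<lambda>u w. 0) 0 c1" "regular_at H 0 c1" "regular_at (\<lambda>u w. g11 - f10 + (g02 - f01) * (w + c1)) 0 c1"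
      by (rule has_value_regular, (rule has_value_intros ruv H0)+)+
    note ab = a b this(1,2,3,4,2) m
    show ?thesis
      using cascades_regular_simple[OF ab] by blast
  qed
  note base_u = this
  have regf: "regular_at (fst Su) 0 w" for w
    unfolding Su_def fst_conv by (rule has_value_regular, (rule has_value_intros ruv)+)
  have poleg: "pole_at (snd Su) 0 w" if "w \<noteq> c1" for w
    unfolding Su_def snd_conv p_def
    by (rule pole_divide, (rule has_value_intros H0)+)
      (use m that in \<open>auto intro: nzpoly_intros\<close>)
  have other_u: "\<not> base_point Su 0 w" if "w \<noteq> c1" for w
    using regf[of w] poleg[OF that]
    by (simp add: base_point_def regular_not_indeterminate pole_not_indeterminate)
  have dU: "definite_at (snd SU) w 0" for w
    unfolding SU_def snd_conv
    by (rule definite_divide, (rule has_value_intros Q0)+) (use m in \<open>auto intro: nzpoly_intros\<close>)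
  have poleU: "pole_at (fst SU) w 0" if "c1 * w \<noteq> 1" for w
  proof -
    have "- m + m * c1 * w = m * (c1 * w - 1)" by (simp add: algebra_simps)
    with that m have nz: "- m + m * c1 * w \<noteq> 0" by auto
    show ?thesis
      unfolding SU_def fst_conv r_def
      by (rule pole_divide, (rule has_value_intros W0 Q0)+)
        (use nz in \<open>auto intro: nzpoly_intros\<close>)
  qed
  have other_U: "\<not> base_point SU w 0" if "c1 * w \<noteq> 1" for w
    using dU[of w] poleU[OF that]
    by (simp add: base_point_def definite_not_indeterminate pole_not_indeterminate)
  \<comment> \<open>If c1 \<noteq> 0, the same point appears in the other chart at w = 1 / c1, with
    m c1 in place of m. Its criterion is that of c1 multiplied by - w^2.\<close>
  have base_U: "cascades_regular d SU w 0 \<longleftrightarrow> p c1 = d c1" if w: "c1 * w = 1" for w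
  proof -
    have nz: "c1 \<noteq> 0" "w \<noteq> 0" using w by auto
    then have c1w: "c1 = 1 / w" using w by (simp add: eq_divide_eq)
    have a: "fst (vswap SU) \<doteq> (\<lambda>u v. m * c1 + u * ((g20 * v\<^sup>2 + g11 * v + g02 + u * Q v u) / v) +
       (v - w) * (- (2 * m * c1) / v))"
      by (rule geqI[OF nzpoly_snd]) (simp add: SU_def vswap_def c1w field_simps nz)
    have b: "snd (vswap SU) \<doteq> (\<lambda>u v. (m * c1 * (v - w) + (- r w) * u + u\<^sup>2 * (W v u - Q v u)
       + u * (v - w) * (- (g20 * (v + w) + g11 - f10)) + (v - w)\<^sup>2 * 0) / u)"
      by (rule geqI[OF nzpoly_fst])
        (simp add: SU_def vswap_def c1w field_simps nz r_def power2_eq_square)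
    have "regular_at (\<lambda>u v. (g20 * v\<^sup>2 + g11 * v + g02 + u * Q v u) / v) 0 w"
      "regular_at (\<lambda>u v. - (2 * m * c1) / v) 0 w" "regular_at (\<lambda>u v. W v u - Q v u) 0 w"
      "regular_at (\<lambda>u v. - (g20 * (v + w) + g11 - f10)) 0 w" "regular_at (\<lambda>u v. 0) 0 w"
      by (rule has_value_regular, (rule has_value_intros has_value_swap[OF Q0] has_value_swap[OF W0] nz)+)+
    then have "cascades_regular d (vswap SU) 0 w \<longleftrightarrow> - r w = d w"
      by (rule cascades_regular_simple(2)[OF a b]) (use m nz in simp)
    also have "d w = - d c1 * w\<^sup>2"
    proof -
      have "d c1 * w + c1 * d w = 0" using d_mult[of c1 w] w by simp
      then have "w * (d c1 * w + c1 * d w) = 0" by simp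
      then have "d c1 * w\<^sup>2 + (c1 * w) * d w = 0" by (simp add: algebra_simps power2_eq_square)
      then show ?thesis using w by (simp add: eq_neg_iff_add_eq_0 add.commute)
    qed
    also have "- r w = - p c1 * w\<^sup>2"
      using nz by (simp add: r_def p_def c1w field_simps power2_eq_square)
    finally show ?thesis using nz by (simp add: cascades_regular_vswap)
  qed
  have "cascades_regular d S 0 c \<longleftrightarrow> p c1 = d c1"
  proof -
    have "base_point Su 0 w \<longleftrightarrow> w = c1" for w using base_u other_u by blast
    moreover have "base_point SU w 0 \<Longrightarrow> cascades_regular d SU w 0 \<longleftrightarrow> p c1 = d c1" for w
      using base_U other_U by blast
    ultimately show ?thesis
      using base_u by (subst cascades_regular_iff)
        (auto simp: base_point_veq[OF Su] base_point_veq[OF SU] cascades_regular_veq[OF Su]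
           cascades_regular_veq[OF SU])
  qed
  then show "cascades_regular d S 0 c \<longleftrightarrow> g20 + (g11 - f10) * c1 + (g02 - f01) * c1\<^sup>2 = d c1"
    by (simp add: p_def)
qed

end

section \<open>The cascade of the system at infinity\<close>

lemma cascades_regularI:
  fixes S :: "'k::field_char_0 vfield"
  assumes uv: "veq (blowup_uv d a b S) S1" and UV: "veq (blowup_UV d a b S) S2"
    and "\<And>c. base_point S1 0 c \<Longrightarrow> cascades_regular d S1 0 c"
    and "\<And>c. base_point S2 c 0 \<Longrightarrow> cascades_regular d S2 c 0"
    and "(\<exists>c. base_point S1 0 c) \<or> (\<exists>c. base_point S2 c 0) \<or>
      (\<forall>c. vf_regular_at S1 0 c) \<or> (\<forall>c. vf_regular_at S2 c 0)"
  shows "cascades_regular d S a b"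
proof -
  have "base_point (blowup_uv d a b S) = base_point S1" "base_point (blowup_UV d a b S) = base_point S2"
    "vf_regular_at (blowup_uv d a b S) = vf_regular_at S1" "vf_regular_at (blowup_UV d a b S) = vf_regular_at S2"
    by (intro ext base_point_veq vf_regular_at_veq uv UV)+
  then show ?thesis
    by (subst cascades_regular_iff)
      (simp add: cascades_regular_veq[OF uv] cascades_regular_veq[OF UV] assms(3-5))
qed

lemma definite_not_base:
  "definite_at f a b \<Longrightarrow> definite_at g a b \<Longrightarrow> \<not> base_point (f, g) a b"
  by (simp add: base_point_def definite_not_indeterminate)

lemma has_value_definite: "has_value f a b v \<Longrightarrow> definite_at f a b"
  by (auto simp: definite_at_def regular_at_iff)

lemma definite_frac:
  fixes N :: "'k::field_char_0 \<Rightarrow> 'k \<Rightarrow> 'k"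
  shows "polyfun2 N \<Longrightarrow> nzpoly E \<Longrightarrow> N a b \<noteq> 0 \<or> E a b \<noteq> 0 \<Longrightarrow> definite_at (\<lambda>y z. N y z / E y z) a b"
  by (rule definite_divide[OF has_value_poly])

lemma nzpoly_line [nzpoly_intros]:
  fixes a :: "'k::field_char_0"
  shows "b \<noteq> 0 \<Longrightarrow> nzpoly (\<lambda>y z. z + b)" "b \<noteq> 0 \<Longrightarrow> nzpoly (\<lambda>y z. y + b)"
    "nzpoly (\<lambda>y z. 1 + a * z)"
    "nzpoly (\<lambda>y z. 1 + a * y)" "nzpoly (\<lambda>y z. 1 + a * (y * z))" "nzpoly (\<lambda>y z. a * (y * z) - 1)"
    "nzpoly (\<lambda>y z. a * y - 1)" "nzpoly (\<lambda>y z. a * (y\<^sup>2 * z) - 1)" "nzpoly (\<lambda>y z. a * (y * z\<^sup>2) - 1)"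
  by (rule nzpolyI[of _ 0 0], (intro polyfun2_intros), (simp; fail))+

lemma nzpoly_line_0 [nzpoly_intros]:
  fixes a :: "'k::field_char_0"
  shows "nzpoly (\<lambda>y z. z + a * y)" "nzpoly (\<lambda>y z. y + a * z)"
  by (rule nzpolyI[of _ 0 1], (intro polyfun2_intros), (simp; fail))
    (rule nzpolyI[of _ 1 0], (intro polyfun2_intros), (simp; fail))

lemma geqI2:
  fixes R1 R2 :: "'k::field_char_0 \<Rightarrow> 'k \<Rightarrow> 'k"
  shows "nzpoly R1 \<Longrightarrow> nzpoly R2 \<Longrightarrow> (\<And>y z. R1 y z \<noteq> 0 \<Longrightarrow> R2 y z \<noteq> 0 \<Longrightarrow> f y z = g y z) \<Longrightarrow> f \<doteq> g"
  by (rule geqI[of "\<lambda>y z. R1 y z * R2 y z"]) (auto intro: nzpoly_mult)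

text \<open>Time is rescaled so that \<open>d\<close> is \<open>x d/dx\<close>. With \<open>r = (x q)' / q\<^sup>2\<close>, \<open>h = \<eta> x\<close> and
  \<open>k = \<kappa>\<^sub>0 x / q\<^sup>2\<close> the field \<open>Sys\<close> below is \<open>x\<close> times the transformed system; \<open>r\<close> is left without an
  equation, so \<open>q\<close> is arbitrary.\<close>

locale d7_field = derivation d for d :: "'k::field_char_0 \<Rightarrow> 'k" +
  fixes q r h k C :: 'k
  assumes q: "q \<noteq> 0" and h: "h \<noteq> 0" and k: "k \<noteq> 0"
    and C: "C = h\<^sup>2 - r\<^sup>2 / 4"
    and dq: "d q = r * q\<^sup>2 - q" and dh: "d h = h" and dk: "d k = k * (3 - 2 * r * q)"
begin

definition Sys :: "'k vfield" where
  "Sys = (\<lambda>y z. (- 4 * y\<^sup>2 * (z + q) ^ 3 * (2 * z + q) - y * (z + q)\<^sup>2 * (r * (3 * z + 4 * q) - 2)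
      + C * (z + q)\<^sup>2 - k * (2 * q + z)) / (z + q)\<^sup>2,
    \<lambda>y z. z * (4 * y * (z + q)\<^sup>2 + r * (z + 2 * q) - 1))"

text \<open>The factor \<open>v + q * u\<close> is (z + q) / y: the polar line z = - q, which meets
  the line at infinity in the origin of this chart.\<close>

definition Su0 :: "'k vfield" where
  "Su0 = (\<lambda>u v. (4 * (v + q * u) ^ 3 * (2 * v + q * u) + u\<^sup>2 * (v + q * u)\<^sup>2 * (r * (3 * v + 4 * q * u) - 2 * u - u\<^sup>2 * C)
       + k * u ^ 5 * (2 * q * u + v)) / (u\<^sup>2 * (v + q * u)\<^sup>2),
    \<lambda>u v. (v * (4 * (v + q * u) ^ 3 * (3 * v + 2 * q * u) + u\<^sup>2 * (v + q * u)\<^sup>2 * (r * (4 * v + 6 * q * u) - 3 * u - u\<^sup>2 * C)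
       + k * u ^ 5 * (2 * q * u + v))) / (u ^ 3 * (v + q * u)\<^sup>2))"

definition SU0 :: "'k vfield" where
  "SU0 = (\<lambda>U V. (- 4 * U\<^sup>2 * (1 + q * V) ^ 3 * (3 + 2 * q * V) - V\<^sup>2 * (1 + q * V)\<^sup>2 * U * r * (4 + 6 * q * V)
       + 3 * U * V ^ 3 * (1 + q * V)\<^sup>2 + V ^ 4 * (1 + q * V)\<^sup>2 * C - k * V ^ 5 * (1 + 2 * q * V)) / (V ^ 3 * (1 + q * V)\<^sup>2),
    \<lambda>U V. (- 4 * U * (1 + q * V)\<^sup>2 - V\<^sup>2 * (r * (1 + 2 * q * V) - V)) / V\<^sup>2)"

text \<open>On the polar line z = - q the numerator reduces to - k q, which is not zero: a pole,
  never 0/0.\<close>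

lemma Sys_no_base: "\<not> base_point Sys a b"
  unfolding Sys_def
proof (rule definite_not_base)
  show "definite_at (\<lambda>y z. (- 4 * y\<^sup>2 * (z + q) ^ 3 * (2 * z + q) - y * (z + q)\<^sup>2 * (r * (3 * z + 4 * q) - 2)
      + C * (z + q)\<^sup>2 - k * (2 * q + z)) / (z + q)\<^sup>2) a b"
  proof (rule definite_frac)
    have "- (k * (2 * q + b)) \<noteq> 0" if "b + q = 0"
      using that q k by (simp add: eq_neg_iff_add_eq_0[symmetric])
    then show "- 4 * a\<^sup>2 * (b + q) ^ 3 * (2 * b + q) - a * (b + q)\<^sup>2 * (r * (3 * b + 4 * q) - 2)
      + C * (b + q)\<^sup>2 - k * (2 * q + b) \<noteq> 0 \<or> (b + q)\<^sup>2 \<noteq> 0"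
      by (cases "b + q = 0") simp_all
  qed (intro polyfun2_intros nzpoly_intros q)+
qed (rule has_value_definite[OF has_value_poly], intro polyfun2_intros)

lemma Su0: "veq (chart_uv0 Sys) Su0"
proof -
  have e: "v / u + q = (v + q * u) / u" if "u \<noteq> 0" for u v
    using that by (simp add: add_divide_distrib)
  show ?thesis
    unfolding chart_uv0_def Sys_def Su0_def fst_conv snd_conv
    by (rule veqI; rule geqI2[of "\<lambda>u v. u" "\<lambda>u v. v + q * u"]; (intro nzpoly_intros)?)
    (simp add: e divide_simps; algebra)+
qed

lemma SU0: "veq (chart_UV0 Sys) SU0"
proof -
  have e: "1 / V + q = (1 + q * V) / V" if "V \<noteq> 0" for V
    using that by (simp add: add_divide_distrib)
  show ?thesis
    unfolding chart_UV0_def Sys_def SU0_def fst_conv snd_conv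
    by (rule veqI; rule geqI2[of "\<lambda>U V. V" "\<lambda>U V. 1 + q * V"]; (intro nzpoly_intros)?)
    (simp add: e divide_simps; algebra)+
qed

text \<open>On the polar line only the term with k survives in the numerators, and off the origin it
  is not zero; on the line at infinity the leading power of v does the same for v \<noteq>
  0.\<close>

lemma Su0_no_base: "base_point Su0 a b \<Longrightarrow> a = 0 \<and> b = 0"
proof (rule ccontr)
  assume base: "base_point Su0 a b" and ab: "\<not> (a = 0 \<and> b = 0)"
  have n: "k * a ^ 5 * (2 * q * a + b) \<noteq> 0 \<and> a \<noteq> 0 \<and> b \<noteq> 0" if "b + q * a = 0"
  proof -
    have "b = - (q * a)" using that by (simp add: eq_neg_iff_add_eq_0)
    then show ?thesis using ab q k by auto
  qed
  have "\<not> base_point Su0 a b"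
    unfolding Su0_def
    by (rule definite_not_base; rule definite_frac; (intro polyfun2_intros nzpoly_intros)?)
      (use n ab in \<open>cases "b + q * a = 0"; cases "a = 0"; simp\<close>)+
  with base show False by blast
qed

lemma SU0_no_base: "base_point SU0 a b \<Longrightarrow> a = 0 \<and> b = 0"
proof (rule ccontr)
  assume base: "base_point SU0 a b" and ab: "\<not> (a = 0 \<and> b = 0)"
  have n: "k * b ^ 5 * (1 + 2 * q * b) \<noteq> 0 \<and> b \<noteq> 0" if "1 + q * b = 0"
  proof -
    have "q * b = - 1" using that by (simp add: eq_neg_iff_add_eq_0 add.commute)
    then have "1 + 2 * q * b = - 1" by (simp add: mult.assoc)
    moreover have "b \<noteq> 0" using that by auto
    ultimately show ?thesis using k by (metis mult_eq_0_iff neg_equal_0_iff_equal one_neq_zero power_eq_0_iff)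
  qed
  have "\<not> base_point SU0 a b"
    unfolding SU0_def
    by (rule definite_not_base; rule definite_frac; (intro polyfun2_intros nzpoly_intros)?)
      (use n ab in \<open>cases "1 + q * b = 0"; cases "b = 0"; simp\<close>)+
  with base show False by blast
qed

text \<open>Digits count blow-ups and a prime tells the two charts of a blow-up apart. \<open>SA1\<close> has coordinates
  \<open>(y, 1/z)\<close> and \<open>SA2\<close> has \<open>(y z, 1/z)\<close>. A base point on an exceptional curve that is not the origin
  of one of the two charts is seen in both of them, and has to be followed twice.\<close>

definition SA1 :: "'k vfield" where
  "SA1 = (\<lambda>U V. (- 4 * U\<^sup>2 * (1 + q * V) * (2 + q * V) - V * U * r * (3 + 4 * q * V)
       + V\<^sup>2 * (2 * U + C - k * V * (1 + 2 * q * V) / (1 + q * V)\<^sup>2)) / V\<^sup>2,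
    \<lambda>U V. (- 4 * U * (1 + q * V)\<^sup>2 - V * r * (1 + 2 * q * V) + V\<^sup>2) / V)"

definition SA1' :: "'k vfield" where
  "SA1' = (\<lambda>u v. (- 4 * (1 + q * (u * v)) * (3 + 2 * q * (u * v)) + u * v\<^sup>2 * (- r * (4 + 6 * q * (u * v)) + 3 * u * v
       + u * v\<^sup>2 * C - k * u\<^sup>2 * v ^ 3 * (1 + 2 * q * (u * v)) / (1 + q * (u * v))\<^sup>2)) / (u * v ^ 3),
    \<lambda>u v. (4 * (1 + q * (u * v)) * (2 + q * (u * v)) + u * v\<^sup>2 * (r * (3 + 4 * q * (u * v)) - 2 * u * v
       - u * v\<^sup>2 * C + k * u\<^sup>2 * v ^ 3 * (1 + 2 * q * (u * v)) / (1 + q * (u * v))\<^sup>2)) / (u\<^sup>2 * v\<^sup>2))"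

definition SA2 :: "'k vfield" where
  "SA2 = (\<lambda>U V. (- 4 * U\<^sup>2 * (1 + q * V) - 2 * r * U * (1 + q * V) + C
       + V * (U - k * (1 + 2 * q * V) / (1 + q * V)\<^sup>2)) / V,
    \<lambda>U V. - 4 * U * (1 + q * V)\<^sup>2 - r * (1 + 2 * q * V) + V)"

definition SA2' :: "'k vfield" where
  "SA2' = (\<lambda>u v. (- 4 * (1 + q * (u * v)) * (2 + q * (u * v)) - v * r * (3 + 4 * q * (u * v))
       + v\<^sup>2 * (2 * u + C - k * u * v * (1 + 2 * q * (u * v)) / (1 + q * (u * v))\<^sup>2)) / v\<^sup>2,
    \<lambda>u v. (4 * (1 + q * (u * v)) + v * (2 * r * (1 + q * (u * v)) - u * v - v * C
       + k * u * v\<^sup>2 * (1 + 2 * q * (u * v)) / (1 + q * (u * v))\<^sup>2)) / (u * v))"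

lemma SA1: "veq (blowup_UV d 0 0 SU0) SA1"
  unfolding blowup_UV_def SU0_def SA1_def fst_conv snd_conv
  apply (rule veqI; rule geqI2[of "\<lambda>U V. V" "\<lambda>U V. 1 + q * V"]; (intro nzpoly_intros)?)
   apply (simp add: divide_simps, algebra)
  apply (simp add: divide_simps, algebra)
  done

lemma SA1': "veq (blowup_uv d 0 0 SU0) SA1'"
  unfolding blowup_uv_def SU0_def SA1'_def fst_conv snd_conv
  apply (rule veqI; rule geqI2[of "\<lambda>U V. U * V" "\<lambda>U V. 1 + q * (U * V)"]; (intro nzpoly_intros)?)
   apply (simp add: divide_simps, algebra)
  apply (simp add: divide_simps, algebra)
  done

lemma SA2: "veq (blowup_UV d 0 0 SA1) SA2"
  unfolding blowup_UV_def SA1_def SA2_def fst_conv snd_conv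
  apply (rule veqI; rule geqI2[of "\<lambda>U V. V" "\<lambda>U V. 1 + q * V"]; (intro nzpoly_intros)?)
   apply (simp add: divide_simps, algebra)
  apply (simp add: divide_simps, algebra)
  done

lemma SA2': "veq (blowup_uv d 0 0 SA1) SA2'"
  unfolding blowup_uv_def SA1_def SA2'_def fst_conv snd_conv
  apply (rule veqI; rule geqI2[of "\<lambda>U V. U * V" "\<lambda>U V. 1 + q * (U * V)"]; (intro nzpoly_intros)?)
   apply (simp add: divide_simps, algebra)
  apply (simp add: divide_simps, algebra)
  done

text \<open>For a solution of the Painleve equation \<open>G\<close> is \<open>\<alpha> x / 4\<close>, so that \<open>d G = G\<close>.\<close>

definition G :: 'k where "G = (d r - r) / 4 - q * C - k"

text \<open>Completing the square turns the equation into (4 a + r)^2 = (2 h)^2. As d h = h, both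
  values of 4 a + r are eigenvectors of d, so d a is known without differentiating a square
  root.\<close>

lemma root_cases:
  assumes "4 * a\<^sup>2 + 2 * r * a = C"
  shows "4 * a + r \<noteq> 0" "d (4 * a + r) = 4 * a + r" "4 * d a = 4 * a + r - d r"
proof -
  have "(4 * a + r - 2 * h) * (4 * a + r + 2 * h) = 0"
    using assms C by (simp add: field_simps power2_eq_square)
  then have *: "4 * a + r = 2 * h \<or> 4 * a + r = - 2 * h" by (auto simp: eq_neg_iff_add_eq_0)
  then show "4 * a + r \<noteq> 0" using h by auto
  show 1: "d (4 * a + r) = 4 * a + r"
    using * by (auto simp: d_mult d_minus dh)
  have "d (4 * a + r) = 4 * d a + d r" by (simp add: d_add d_mult)
  with 1 show "4 * d a = 4 * a + r - d r" by (simp add: algebra_simps)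
qed

text \<open>With m = - (4 a + r) one finds \<open>g11 = f10\<close>, \<open>g02 = f01\<close> and
  \<open>g20 = 0\<close>, so the criterion of the double point reads d c1 = 0 for c1 = - G / m.
  Since d m = m, this is d G = G.\<close>

lemma SA2_double:
  assumes a: "4 * a\<^sup>2 + 2 * r * a = C"
  shows "base_point SA2 a 0" and "cascades_regular d SA2 a 0 \<longleftrightarrow> d G = G"
proof -
  define m where "m = - 4 * a - r"
  have m: "m \<noteq> 0" using root_cases(1)[OF a] by (auto simp: m_def eq_neg_iff_add_eq_0)
  have dm: "d m = m" using root_cases(2)[OF a] d_minus[of "4 * a + r"] by (simp add: m_def)
  \<comment> \<open>Expansion at v = a, sorted as \<open>cascades_regular_double\<close> requires;
    the exchange of coordinates moves the exceptional curve V = 0 to u = 0.\<close>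
  have f: "fst (vswap SA2) \<doteq> (\<lambda>u v. m + (2 * m * q + 1) * u + (- 4) * (v - a) +
      u\<^sup>2 * (- 4 * q\<^sup>2 * v) + u * (v - a) * (- 8 * q) + (v - a)\<^sup>2 * 0)"
    unfolding SA2_def vswap_def m_def
    by (rule geqI[OF nzpoly_fst]) (simp add: algebra_simps power2_eq_square)
  have g: "snd (vswap SA2) \<doteq> (\<lambda>u v. (2 * m * (v - a) + (- q * C + a - k) * u + 0 * u\<^sup>2
       + (2 * m * q + 1) * u * (v - a) + (- 4) * (v - a)\<^sup>2
       + u ^ 3 * (k * q\<^sup>2 / (1 + q * u)\<^sup>2) + u\<^sup>2 * (v - a) * 0 + u * (v - a)\<^sup>2 * (- 4 * q) + (v - a) ^ 3 * 0) / u)"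
    unfolding SA2_def vswap_def m_def fst_conv snd_conv unfolding a[symmetric]
    apply (rule geqI2[of "\<lambda>u v. u" "\<lambda>u v. 1 + q * u"]; (intro nzpoly_intros)?)
    apply (simp add: divide_simps, algebra)
    done
  have hv: "regular_at (\<lambda>u v. - 4 * q\<^sup>2 * v) 0 a" "regular_at (\<lambda>u v. - 8 * q) 0 a"
     "regular_at (\<lambda>u v. 0) 0 a" "regular_at (\<lambda>u v. - 4 * q) 0 a"
     "regular_at (\<lambda>u v. k * q\<^sup>2 / (1 + q * u)\<^sup>2) 0 a"
    by (rule has_value_regular, (rule has_value_intros | (simp; fail))+)+
  have dr: "d r = 4 * a + r - 4 * d a" using root_cases(3)[OF a] by (simp add: algebra_simps)
  have c1: "- (G / m) = (d a - (- q * C + a - k)) / m"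
  proof -
    have "4 * (d a - (- q * C + a - k)) = 4 * (- G)"
      unfolding G_def dr by (simp add: field_simps)
    then have "d a - (- q * C + a - k) = - G" by (simp only: mult_cancel_left) simp
    then show ?thesis by simp
  qed
  note D = cascades_regular_double[OF f g hv(1,2,3,5,3,4,3) m c1]
  show "base_point SA2 a 0" using D(1) by (simp add: base_point_vswap)
  have "d (- (G / m)) = - (d G - G) / m"
    using m by (simp add: d_minus d_divide dm field_simps power2_eq_square)
  then show "cascades_regular d SA2 a 0 \<longleftrightarrow> d G = G"
    using D(2) m by (auto simp: cascades_regular_vswap)
qed

text \<open>The base point a of \<open>SA2\<close>, seen as c = 1 / a. Now c1 = G / (m a^3), and the
  remaining terms of the criterion compensate the derivative of a^3, so that again d G = G is
  left.\<close>

lemma SA2'_double: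
  assumes c: "c \<noteq> 0" "4 + 2 * r * c - c\<^sup>2 * C = 0"
  shows "base_point SA2' 0 c" and "cascades_regular d SA2' 0 c \<longleftrightarrow> d G = G"
proof -
  define a where "a = 1 / c"
  have a: "4 * a\<^sup>2 + 2 * r * a = C"
    using c by (simp add: a_def field_simps power2_eq_square)
  have a0: "a \<noteq> 0" and ca: "c = 1 / a" using c by (simp_all add: a_def)
  define m where "m = - 4 * a - r"
  have m: "m \<noteq> 0" using root_cases(1)[OF a] by (auto simp: m_def eq_neg_iff_add_eq_0)
  have dm: "d m = m" using root_cases(2)[OF a] d_minus[of "4 * a + r"] by (simp add: m_def)
  have f: "fst SA2' \<doteq> (\<lambda>u v. a * m + (- 12 * q * a - 4 * r * q + 2 - k / a) * u + (16 * a ^ 3 + 3 * r * a\<^sup>2) * (v - c) +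
      u\<^sup>2 * (- 4 * q\<^sup>2 + k * q\<^sup>2 * u * v ^ 3 / (1 + q * (u * v))\<^sup>2) + u * (v - c) * (12 * q * a / v - k)
      + (v - c)\<^sup>2 * (- 8 * (2 * a ^ 3 / v + a\<^sup>2 / v\<^sup>2) - 3 * r * a\<^sup>2 / v))"
    unfolding SA2'_def m_def ca fst_conv unfolding a[symmetric]
    apply (rule geqI2[of "\<lambda>u v. v" "\<lambda>u v. 1 + q * (u * v)"]; (intro nzpoly_intros)?)
    apply (simp add: divide_simps a0, algebra)
    done
  have g: "snd SA2' \<doteq> (\<lambda>u v. (2 * (a * m) * (v - c) + (4 * q + 2 * r * q / a - 1 / a + k / a\<^sup>2) * u + 0 * u\<^sup>2
       + (2 * r * q - 1 + 2 * k / a) * u * (v - c) + (4 * a ^ 3) * (v - c)\<^sup>2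
       + u ^ 3 * (- k * q\<^sup>2 * v ^ 4 / (1 + q * (u * v))\<^sup>2) + u\<^sup>2 * (v - c) * 0 + u * (v - c)\<^sup>2 * k
       + (v - c) ^ 3 * (- 4 * a ^ 3 / v)) / u)"
    unfolding SA2'_def m_def ca snd_conv unfolding a[symmetric]
    apply (rule geqI2[of "\<lambda>u v. u * v" "\<lambda>u v. 1 + q * (u * v)"]; (intro nzpoly_intros)?)
    apply (simp add: divide_simps a0, algebra)
    done
  have hv: "regular_at (\<lambda>u v. - 4 * q\<^sup>2 + k * q\<^sup>2 * u * v ^ 3 / (1 + q * (u * v))\<^sup>2) 0 c"
    "regular_at (\<lambda>u v. 12 * q * a / v - k) 0 c"
    "regular_at (\<lambda>u v. - 8 * (2 * a ^ 3 / v + a\<^sup>2 / v\<^sup>2) - 3 * r * a\<^sup>2 / v) 0 c"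
    "regular_at (\<lambda>u v. - k * q\<^sup>2 * v ^ 4 / (1 + q * (u * v))\<^sup>2) 0 c"
    "regular_at (\<lambda>u v. 0) 0 c" "regular_at (\<lambda>u v. k) 0 c"
    "regular_at (\<lambda>u v. - 4 * a ^ 3 / v) 0 c"
    by (rule has_value_regular, (rule has_value_intros | (simp add: c; fail))+)+
  have am: "a * m \<noteq> 0" using a0 m by simp
  have dc: "d c = - d a / a\<^sup>2" by (simp add: ca d_divide)
  have dr: "d r = 4 * a + r - 4 * d a" using root_cases(3)[OF a] by (simp add: algebra_simps)
  have G: "G = a - d a - q * C - k"
  proof -
    have "4 * G = 4 * (a - d a - q * C - k)"
      unfolding G_def dr by (simp add: field_simps)
    then show ?thesis by (simp only: mult_cancel_left) simp
  qed
  have c1: "G / m / a ^ 3 = (d c - (4 * q + 2 * r * q / a - 1 / a + k / a\<^sup>2)) / (a * m)"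
    unfolding G dc unfolding a[symmetric] using a0 m by (simp add: divide_simps, algebra)
  note D = cascades_regular_double[OF f g hv am c1]
  show "base_point SA2' 0 c" using D(1) .
  have 1: "d (G / m / a ^ 3) = (d G - G) / (m * a ^ 3) - 3 * G * d a / (m * a ^ 4)"
    using m a0 by (simp add: d_divide d_mult d_power dm power2_eq_square power3_eq_cube power4_eq_xxxx field_simps)
  have 2: "0 + ((2 * r * q - 1 + 2 * k / a) - (- 12 * q * a - 4 * r * q + 2 - k / a)) * (G / m / a ^ 3) +
     (4 * a ^ 3 - (16 * a ^ 3 + 3 * r * a\<^sup>2)) * (G / m / a ^ 3)\<^sup>2 = - 3 * G * d a / (m * a ^ 4)"
  proof -
    have da: "d a = a - q * C - k - G" by (simp add: G)
    \<comment> \<open>With d a replaced by a - q C - k - G this is an identity in G, hence it is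
      proved for an arbitrary g.\<close>
    have "0 + ((2 * r * q - 1 + 2 * k / a) - (- 12 * q * a - 4 * r * q + 2 - k / a)) * (g / m / a ^ 3) +
      (4 * a ^ 3 - (16 * a ^ 3 + 3 * r * a\<^sup>2)) * (g / m / a ^ 3)\<^sup>2
      = - 3 * g * (a - q * (4 * a\<^sup>2 + 2 * r * a) - k - g) / (m * a ^ 4)" for g
    proof -
      have 1: "4 * a ^ 3 - (16 * a ^ 3 + 3 * r * a\<^sup>2) = 3 * a\<^sup>2 * m" unfolding m_def by algebra
      show ?thesis unfolding 1 using m a0 by (simp add: divide_simps, algebra)
    qed
    from this[of G] show ?thesis unfolding da a .
  qed
  show "cascades_regular d SA2' 0 c \<longleftrightarrow> d G = G"
    unfolding D(2) 1 2 using m a0 by auto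
qed

text \<open>An actual base point on the exceptional curve keeps the cascade of \<open>SU0\<close>
  running and transmits the condition d G = G back to it.\<close>

lemma SA1_base: "base_point SA1 0 0"
proof -
  have "indeterminate_at (\<lambda>u v. fst SA1 v u) 0 0"
  proof (rule indeterminateI[where j = 2 and k = 2])
    show "(\<lambda>u v. fst SA1 v u) \<doteq> (\<lambda>u v. ((v - 0)\<^sup>2 * (- 4 * (1 + q * u) * (2 + q * u)) +
       u * (- v * r * (3 + 4 * q * u) + u * (2 * v + C - k * u * (1 + 2 * q * u) / (1 + q * u)\<^sup>2))) / u\<^sup>2)"
      unfolding SA1_def by (simp add: algebra_simps power2_eq_square)
    show "has_value (\<lambda>u v. - 4 * (1 + q * u) * (2 + q * u)) 0 0 (- 4 * (1 + q * 0) * (2 + q * 0))"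
      by (intro has_value_intros)
    show "has_value (\<lambda>u v. - v * r * (3 + 4 * q * u) + u * (2 * v + C - k * u * (1 + 2 * q * u) / (1 + q * u)\<^sup>2)) 0 0
      (- 0 * r * (3 + 4 * q * 0) + 0 * (2 * 0 + C - k * 0 * (1 + 2 * q * 0) / (1 + q * 0)\<^sup>2))"
      by (intro has_value_intros; simp)
  qed auto
  then show ?thesis by (simp add: base_point_def indeterminate_at_swap[of "fst SA1"])
qed

text \<open>Without a base point here the demand on its cascade would be void, and no condition on q
  would follow.\<close>

lemma SU0_base: "base_point SU0 0 0"
proof -
  have "indeterminate_at (\<lambda>u v. snd SU0 v u) 0 0"
  proof (rule indeterminateI[where j = 1 and k = 2])
    show "(\<lambda>u v. snd SU0 v u) \<doteq> (\<lambda>u v. ((v - 0) ^ 1 * (- 4 * (1 + q * u)\<^sup>2) +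
       u * (- u * (r * (1 + 2 * q * u) - u))) / u\<^sup>2)"
      unfolding SU0_def by (simp add: algebra_simps power2_eq_square)
    show "has_value (\<lambda>u v. - 4 * (1 + q * u)\<^sup>2) 0 0 (- 4 * (1 + q * 0)\<^sup>2)"
      by (intro has_value_intros)
    show "has_value (\<lambda>u v. - u * (r * (1 + 2 * q * u) - u)) 0 0
      (- 0 * (r * (1 + 2 * q * 0) - 0))"
      by (intro has_value_intros; simp)
  qed auto
  then show ?thesis by (simp add: base_point_def indeterminate_at_swap[of "snd SU0"])
qed

lemma SA1_no_base: "base_point SA1 c 0 \<Longrightarrow> c = 0"
  unfolding SA1_def
  by (erule contrapos_pp, rule definite_not_base; rule definite_divide, (rule has_value_intros | (simp; fail))+)
    (auto intro!: nzpoly_intros)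

lemma SA1'_no_base: "\<not> base_point SA1' 0 c"
  unfolding SA1'_def
  by (rule definite_not_base; rule definite_divide, (rule has_value_intros | (simp; fail))+)
    (auto intro!: nzpoly_intros)

lemma SA2_no_base: "base_point SA2 c 0 \<Longrightarrow> 4 * c\<^sup>2 + 2 * r * c = C"
proof (rule ccontr)
  assume *: "base_point SA2 c 0" "4 * c\<^sup>2 + 2 * r * c \<noteq> C"
  have "\<not> base_point SA2 c 0"
    unfolding SA2_def
  proof (rule definite_not_base)
    show "definite_at (\<lambda>U V. (- 4 * U\<^sup>2 * (1 + q * V) - 2 * r * U * (1 + q * V) + C
       + V * (U - k * (1 + 2 * q * V) / (1 + q * V)\<^sup>2)) / V) c 0"
      by (rule definite_divide, (rule has_value_intros | (simp; fail))+)
        (use * in \<open>auto intro!: nzpoly_intros simp: algebra_simps\<close>)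
    show "definite_at (\<lambda>U V. - 4 * U * (1 + q * V)\<^sup>2 - r * (1 + 2 * q * V) + V) c 0"
      by (rule has_value_definite, (rule has_value_intros)+)
  qed
  with * show False by blast
qed

lemma SA2'_no_base: "base_point SA2' 0 c \<Longrightarrow> c \<noteq> 0 \<and> 4 + 2 * r * c - c\<^sup>2 * C = 0"
proof (rule ccontr)
  assume *: "base_point SA2' 0 c" "\<not> (c \<noteq> 0 \<and> 4 + 2 * r * c - c\<^sup>2 * C = 0)"
  have "\<not> base_point SA2' 0 c"
    unfolding SA2'_def
    by (rule definite_not_base; rule definite_divide, (rule has_value_intros | (simp; fail))+)
      (use * in \<open>auto intro!: nzpoly_intros simp: algebra_simps power2_eq_square\<close>)
  with * show False by blast
qed

text \<open>The discriminant is a square because C = h^2 - r^2 / 4; the base points therefore have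
  coordinates in the field itself.\<close>

lemma root_exists: "\<exists>a. 4 * a\<^sup>2 + 2 * r * a = C"
  by (rule exI[of _ "(2 * h - r) / 4"]) (simp add: C field_simps power2_eq_square)

text \<open>Sufficiency has to treat all roots in both charts; for necessity one root is enough, as
  each gives the same condition.\<close>

lemma cascades_SA1: "cascades_regular d SA1 0 0 \<longleftrightarrow> d G = G"
proof
  assume "d G = G"
  then show "cascades_regular d SA1 0 0"
    by (intro cascades_regularI[OF SA2' SA2])
      (use SA2_no_base SA2'_no_base SA2_double SA2'_double root_exists in blast)+
next
  assume "cascades_regular d SA1 0 0"
  then have "\<forall>c. base_point SA2 c 0 \<longrightarrow> cascades_regular d SA2 c 0"
    by (subst (asm) cascades_regular_iff) (simp add: base_point_veq[OF SA2] cascades_regular_veq[OF SA2])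
  then show "d G = G" using root_exists SA2_double by blast
qed

lemma cascades_SU0: "cascades_regular d SU0 0 0 \<longleftrightarrow> d G = G"
proof
  assume "d G = G"
  then show "cascades_regular d SU0 0 0"
    by (intro cascades_regularI[OF SA1' SA1])
      (use SA1_no_base SA1'_no_base SA1_base cascades_SA1 in blast)+
next
  assume "cascades_regular d SU0 0 0"
  then have "\<forall>c. base_point SA1 c 0 \<longrightarrow> cascades_regular d SA1 c 0"
    by (subst (asm) cascades_regular_iff) (simp add: base_point_veq[OF SA1] cascades_regular_veq[OF SA1])
  then show "d G = G" using cascades_SA1 SA1_base by blast
qed

section \<open>The cascade along the moving pole\<close>

text \<open>\<open>SB1\<close> has coordinates \<open>(1/y, z)\<close>; its base point \<open>z = - q\<close> is \<open>1/z = - 1/q\<close> in \<open>SB1'\<close>, from where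
  the cascade continues through \<open>SC2\<close>, \<open>SC3'\<close> instead of \<open>SB2'\<close>, \<open>SB3\<close>. The point \<open>z = 0\<close> is resolved
  in \<open>SBa\<close>.\<close>

definition SB1 :: "'k vfield" where
  "SB1 = (\<lambda>u z. (4 * (z + q) ^ 3 * (2 * z + q) + u * (z + q)\<^sup>2 * (r * (3 * z + 4 * q) - 2 - u * C)
       + k * u\<^sup>2 * (2 * q + z)) / (z + q)\<^sup>2,
    \<lambda>u z. (z * (4 * (z + q)\<^sup>2 + u * (r * (z + 2 * q) - 1))) / u)"

definition SB1' :: "'k vfield" where
  "SB1' = (\<lambda>U V. (- 4 * (1 + q * U)\<^sup>2 + U\<^sup>2 * V * (U - r * (1 + 2 * q * U))) / (U\<^sup>2 * V),
    \<lambda>U V. (4 * (1 + q * U) ^ 3 * (3 + 2 * q * U) + V * (1 + q * U)\<^sup>2 * (r * U\<^sup>2 * (4 + 6 * q * U) - 3 * U ^ 3 - U ^ 4 * V * C)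
       + k * U ^ 5 * V\<^sup>2 * (1 + 2 * q * U)) / (U ^ 3 * (1 + q * U)\<^sup>2))"

definition SBa :: "'k vfield" where
  "SBa = (\<lambda>u w. 4 * (q + u * w) * (2 * u * w + q) + u * (r * (3 * u * w + 4 * q) - 2 - u * C)
       + k * u\<^sup>2 * (2 * q + u * w) / (q + u * w)\<^sup>2,
    \<lambda>u w. w * (- 4 * (q + u * w) * w - 2 * r * (q + u * w) + 1 + u * C - k * u * (2 * q + u * w) / (q + u * w)\<^sup>2))"

definition SBa' :: "'k vfield" where
  "SBa' = (\<lambda>U V. 4 * (V + q) + U * (2 * r * (V + q) - 1 - U * V * C) + k * U\<^sup>2 * V * (2 * q + V) / (V + q)\<^sup>2,
    \<lambda>U V. (4 * (V + q)\<^sup>2 + U * V * (r * (V + 2 * q) - 1)) / U)"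

definition SB2 :: "'k vfield" where
  "SB2 = (\<lambda>u w. (w\<^sup>2 * u * (4 * w * (2 * u * w - q) + r * (3 * u * w + q) - 2 - u * C) + k * (u * w + q)) / w\<^sup>2,
    \<lambda>u w. (u * w\<^sup>2 * (- 4 * u * w\<^sup>2 + 1 - r * (2 * u * w + q) + u * C) - k * (q + u * w)) / (u * w))"

definition SB2' :: "'k vfield" where
  "SB2' = (\<lambda>U V. (V * (4 * V + U * (r * (2 * V + q) - 1 - U * V * C)) + k * U\<^sup>2 * (q + V)) / V,
    \<lambda>U V. (4 * V * (V - q) + U * (r * V\<^sup>2 - V)) / U)"

definition SB3 :: "'k vfield" where
  "SB3 = (\<lambda>u v. (u * (v * (4 * v + r * (2 * u * v + q) - 1 - u\<^sup>2 * v * C) + k * (q + u * v))) / v,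
    \<lambda>u v. (- 4 * q * v + u * (- r * u * v\<^sup>2 - r * q * v + u\<^sup>2 * v\<^sup>2 * C - k * (q + u * v))) / u)"

definition SB3' :: "'k vfield" where
  "SB3' = (\<lambda>U V. (4 * q + V * (r * U * (V + q) - U\<^sup>2 * V\<^sup>2 * C + k * U\<^sup>2 * (q + V))) / V,
    \<lambda>U V. (4 * (V - q) + U * (r * V\<^sup>2 - V)) / U)"

text \<open>Composing the blow-ups, \<open>w\<close> is y^2 (z + q)^3. Its base point w = - k / 2
  balances a double zero of z + q against a triple pole of y.\<close>

definition SB4 :: "'k vfield" where
  "SB4 = (\<lambda>u w. (w * u * (4 * u * w + r * (2 * u\<^sup>2 * w + q) - 1 - u ^ 3 * w * C) + k * (q + u\<^sup>2 * w)) / w,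
    \<lambda>u w. (- 4 * q * w - 2 * k * q + u * ((1 - 2 * r * q) * w - u * (4 * w\<^sup>2 + 2 * k * w) - 3 * r * u\<^sup>2 * w\<^sup>2
       + 2 * u ^ 3 * w\<^sup>2 * C)) / u)"

definition SB4' :: "'k vfield" where
  "SB4' = (\<lambda>U V. (4 * q + 2 * k * q * U + V * (U * (2 * r * q - 1) + V * (4 * U + 2 * k * U\<^sup>2) + 3 * r * U\<^sup>2 * V\<^sup>2
       - 2 * U ^ 3 * V ^ 3 * C)) / V,
    \<lambda>U V. (- 4 * q + U * (- r * U * V ^ 3 - r * q * V + U\<^sup>2 * V ^ 4 * C - k * (q + U * V\<^sup>2))) / U)"

text \<open>The factor \<open>q * t - 1\<close> is q times the coordinate U = 1/z of
  \<open>SB1'\<close>. It equals - 1 on the exceptional curve t = 0, so its powers in denominators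
  are harmless there.\<close>

definition SC2 :: "'k vfield" where
  "SC2 = (\<lambda>t w. (t * (- 4 * q ^ 4 / (q * t - 1)\<^sup>2 + w * (1 - 2 * r * q))) / w,
    \<lambda>t w. (t * (12 * q ^ 5 * t / (q * t - 1) ^ 3 + w * (4 * r * q * (2 * q * t - 1) / (q * t - 1) - 4
        - (q * t - 1) * t * w * C / q)) + k * (q * t - 1)\<^sup>2 * w\<^sup>2 * (2 * q * t - 1) / q ^ 4) / t)"

definition SC2' :: "'k vfield" where
  "SC2' = (\<lambda>T V. (T * V * (- 4 * q ^ 4 * T\<^sup>2 / (q * (T * V) - 1)\<^sup>2 + T * (1 - 2 * r * q)
         - T * (4 * q ^ 4 * T * (1 + 2 * q * T * V) / (q * (T * V) - 1) ^ 3
         + r * (4 * q / (q * (T * V) - 1) + 6 * q) - 3 - (q * (T * V) - 1) * V * C / q))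
         - k * (q * (T * V) - 1)\<^sup>2 * (2 * q * T * V - 1) / q ^ 4) / (T * V),
    \<lambda>T V. (T\<^sup>2 * V * (4 * q ^ 4 * T * (1 + 2 * q * T * V) / (q * (T * V) - 1) ^ 3
         + r * (4 * q / (q * (T * V) - 1) + 6 * q) - 3 - (q * (T * V) - 1) * V * C / q)
         + k * (q * (T * V) - 1)\<^sup>2 * (2 * q * T * V - 1) / q ^ 4) / T\<^sup>2)"

definition SC3 :: "'k vfield" where
  "SC3 = (\<lambda>t m. (- 4 * q ^ 4 / (q * t - 1)\<^sup>2 + m * t * (1 - 2 * r * q)) / m,
    \<lambda>t m. (4 * q ^ 4 / (q * t - 1)\<^sup>2 + t * (12 * q ^ 5 / (q * t - 1) ^ 3
         + m * (4 * r * q * (2 * q * t - 1) / (q * t - 1) - 4 - (q * t - 1) * t\<^sup>2 * m * C / q)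
         + k * (q * t - 1)\<^sup>2 * m\<^sup>2 * (2 * q * t - 1) / q ^ 4 - m * (1 - 2 * r * q))) / t)"

definition SC3' :: "'k vfield" where
  "SC3' = (\<lambda>y w. (- 4 * q ^ 4 * y / (q * (y * w) - 1)\<^sup>2 + w * (y * (1 - 2 * r * q) - 12 * q ^ 5 * y\<^sup>2 / (q * (y * w) - 1) ^ 3
         - y * (4 * r * q * (2 * q * y * w - 1) / (q * (y * w) - 1) - 4 - (q * (y * w) - 1) * y * w\<^sup>2 * C / q)
         - k * (q * (y * w) - 1)\<^sup>2 * (2 * q * y * w - 1) / q ^ 4)) / w,
    \<lambda>y w. (w * (12 * q ^ 5 * y\<^sup>2 / (q * (y * w) - 1) ^ 3
         + y * (4 * r * q * (2 * q * y * w - 1) / (q * (y * w) - 1) - 4 - (q * (y * w) - 1) * y * w\<^sup>2 * C / q)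
         + k * (q * (y * w) - 1)\<^sup>2 * (2 * q * y * w - 1) / q ^ 4)) / y)"

definition SC4 :: "'k vfield" where
  "SC4 = (\<lambda>y m. (- 4 * q ^ 4 / (q * (y\<^sup>2 * m) - 1)\<^sup>2 + m * (y * (5 - 2 * r * q) - 12 * q ^ 5 * y\<^sup>2 / (q * (y\<^sup>2 * m) - 1) ^ 3
        - y * (4 * r * q * (2 * q * y\<^sup>2 * m - 1) / (q * (y\<^sup>2 * m) - 1) - (q * (y\<^sup>2 * m) - 1) * y ^ 3 * m\<^sup>2 * C / q)
        - k * (q * (y\<^sup>2 * m) - 1)\<^sup>2 * (2 * q * y\<^sup>2 * m - 1) / q ^ 4)) / m,
    \<lambda>y m. (4 * q ^ 4 / (q * (y\<^sup>2 * m) - 1)\<^sup>2 + 2 * k * (q * (y\<^sup>2 * m) - 1)\<^sup>2 * m * (2 * q * y\<^sup>2 * m - 1) / q ^ 4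
        + y * (24 * q ^ 5 * y * m / (q * (y\<^sup>2 * m) - 1) ^ 3 + m * (8 * r * q * (2 * q * y\<^sup>2 * m - 1) / (q * (y\<^sup>2 * m) - 1)
           - 9 + 2 * r * q - 2 * (q * (y\<^sup>2 * m) - 1) * y ^ 3 * m\<^sup>2 * C / q))) / y)"

definition SC4' :: "'k vfield" where
  "SC4' = (\<lambda>n w. (- 4 * q ^ 4 * n / (q * (n * w\<^sup>2) - 1)\<^sup>2 - 2 * k * (q * (n * w\<^sup>2) - 1)\<^sup>2 * (2 * q * n * w\<^sup>2 - 1) / q ^ 4
        + w * (n * (9 - 2 * r * q) - 24 * q ^ 5 * n\<^sup>2 * w / (q * (n * w\<^sup>2) - 1) ^ 3
        - n * (8 * r * q * (2 * q * n * w\<^sup>2 - 1) / (q * (n * w\<^sup>2) - 1) - 2 * (q * (n * w\<^sup>2) - 1) * n * w ^ 3 * C / q))) / w,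
    \<lambda>n w. (n * (12 * q ^ 5 * n * w\<^sup>2 / (q * (n * w\<^sup>2) - 1) ^ 3
         + w * (4 * r * q * (2 * q * n * w\<^sup>2 - 1) / (q * (n * w\<^sup>2) - 1) - 4 - (q * (n * w\<^sup>2) - 1) * n * w ^ 3 * C / q))
         + k * (q * (n * w\<^sup>2) - 1)\<^sup>2 * (2 * q * n * w\<^sup>2 - 1) / q ^ 4) / n)"

section \<open>Verification of the blow-up charts\<close>

lemma SB1: "veq (blowup_uv d 0 0 Su0) SB1"
proof -
  have e: "0 + u * v + q * (0 + u) = u * (v + q)" for u v by (simp add: algebra_simps)
  show ?thesis
    unfolding blowup_uv_def Su0_def SB1_def fst_conv snd_conv e
    by (rule veqI; rule geqI2[of "\<lambda>u v. u" "\<lambda>u v. v + q"]; (intro nzpoly_intros q)?)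
    (simp add: divide_simps; algebra)+
qed

lemma SB1': "veq (blowup_UV d 0 0 Su0) SB1'"
proof -
  have e: "0 + v + q * (0 + u * v) = v * (1 + q * u)" for u v by (simp add: algebra_simps)
  show ?thesis
    unfolding blowup_UV_def Su0_def SB1'_def fst_conv snd_conv e
    by (rule veqI; rule geqI2[of "\<lambda>u v. u * v" "\<lambda>u v. 1 + q * u"]; (intro nzpoly_intros)?)
    (simp add: divide_simps; algebra)+
qed

lemma SBa: "veq (blowup_uv d 0 0 SB1) SBa"
  unfolding blowup_uv_def SB1_def SBa_def fst_conv snd_conv
  apply (rule veqI; rule geqI2[of "\<lambda>u v. u" "\<lambda>u v. q + u * v"]; (intro nzpoly_intros)?)
     apply (rule nzpolyI[of _ 0 0]; (intro polyfun2_intros)?; simp add: q)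
    apply (simp add: divide_simps add.commute[of _ q]; algebra)
   apply (rule nzpolyI[of _ 0 0]; (intro polyfun2_intros)?; simp add: q)
  apply (simp add: divide_simps add.commute[of _ q]; algebra)
  done

lemma SBa': "veq (blowup_UV d 0 0 SB1) SBa'"
  unfolding blowup_UV_def SB1_def SBa'_def fst_conv snd_conv
  by (rule veqI; rule geqI2[of "\<lambda>u v. u * v" "\<lambda>u v. v + q"]; (intro nzpoly_intros q)?)
    (simp add: divide_simps; algebra)+

lemma SB2: "veq (blowup_uv d 0 (- q) SB1) SB2"
  unfolding blowup_uv_def SB1_def SB2_def fst_conv snd_conv d_minus dq
  by (rule veqI; rule geqI2[of "\<lambda>u v. u" "\<lambda>u v. v"]; (intro nzpoly_intros q)?)
    (simp add: divide_simps; algebra)+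

lemma SB2': "veq (blowup_UV d 0 (- q) SB1) SB2'"
  unfolding blowup_UV_def SB1_def SB2'_def fst_conv snd_conv d_minus dq
  by (rule veqI; rule geqI2[of "\<lambda>u v. u" "\<lambda>u v. v"]; (intro nzpoly_intros q)?)
    (simp add: divide_simps; algebra)+

lemma SB3: "veq (blowup_uv d 0 0 SB2') SB3"
  unfolding blowup_uv_def SB2'_def SB3_def fst_conv snd_conv
  by (rule veqI; rule geqI2[of "\<lambda>u v. u" "\<lambda>u v. v"]; (intro nzpoly_intros q)?)
    (simp add: divide_simps; algebra)+

lemma SB3': "veq (blowup_UV d 0 0 SB2') SB3'"
  unfolding blowup_UV_def SB2'_def SB3'_def fst_conv snd_conv
  by (rule veqI; rule geqI2[of "\<lambda>u v. u" "\<lambda>u v. v"]; (intro nzpoly_intros q)?)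
    (simp add: divide_simps; algebra)+

lemma SB4: "veq (blowup_uv d 0 0 SB3) SB4"
  unfolding blowup_uv_def SB3_def SB4_def fst_conv snd_conv
  by (rule veqI; rule geqI2[of "\<lambda>u v. u" "\<lambda>u v. v"]; (intro nzpoly_intros q)?)
    (simp add: divide_simps; algebra)+

lemma SB4': "veq (blowup_UV d 0 0 SB3) SB4'"
  unfolding blowup_UV_def SB3_def SB4'_def fst_conv snd_conv
  by (rule veqI; rule geqI2[of "\<lambda>u v. u" "\<lambda>u v. v"]; (intro nzpoly_intros q)?)
    (simp add: divide_simps; algebra)+

lemma SC2: "veq (blowup_uv d (- 1 / q) 0 SB1') SC2"
proof -
  have e: "- 1 / q + u = (q * u - 1) / q" "1 + q * ((q * u - 1) / q) = q * u" for u
    using q by (simp_all add: field_simps)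
  show ?thesis
    unfolding blowup_uv_def SB1'_def SC2_def fst_conv snd_conv e d_minus d_divide dq
    by (rule veqI; rule geqI2[of "\<lambda>u v. u * v" "\<lambda>u v. q * u - 1"]; (intro nzpoly_intros)?)
    (simp add: divide_simps dq q; algebra)+
qed

lemma SC2': "veq (blowup_UV d (- 1 / q) 0 SB1') SC2'"
proof -
  have e: "- 1 / q + u = (q * u - 1) / q" "1 + q * ((q * u - 1) / q) = q * u" for u
    using q by (simp_all add: field_simps)
  show ?thesis
    unfolding blowup_UV_def SB1'_def SC2'_def fst_conv snd_conv e d_minus d_divide dq
    by (rule veqI; rule geqI2[of "\<lambda>u v. u * v" "\<lambda>u v. q * (u * v) - 1"]; (intro nzpoly_intros)?)
    (simp add: divide_simps dq q; algebra)+
qed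

lemma SC3: "veq (blowup_uv d 0 0 SC2) SC3"
  unfolding blowup_uv_def SC2_def SC3_def fst_conv snd_conv
  by (rule veqI; rule geqI2[of "\<lambda>u v. u * v" "\<lambda>u v. q * u - 1"]; (intro nzpoly_intros)?)
    (simp add: divide_simps q; algebra)+

lemma SC3': "veq (blowup_UV d 0 0 SC2) SC3'"
  unfolding blowup_UV_def SC2_def SC3'_def fst_conv snd_conv
  by (rule veqI; rule geqI2[of "\<lambda>u v. u * v" "\<lambda>u v. q * (u * v) - 1"]; (intro nzpoly_intros)?)
    (simp add: divide_simps q; algebra)+

lemma SC4: "veq (blowup_uv d 0 0 SC3') SC4"
proof -
  have e: "(0 + u) * (0 + u * v) = u\<^sup>2 * v" for u v :: 'k by (simp add: power2_eq_square)
  show ?thesis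
    unfolding blowup_uv_def SC3'_def SC4_def fst_conv snd_conv e
    by (rule veqI; rule geqI2[of "\<lambda>u v. u * v" "\<lambda>u v. q * (u\<^sup>2 * v) - 1"]; (intro nzpoly_intros)?)
    (simp add: divide_simps q; algebra)+
qed

lemma SC4': "veq (blowup_UV d 0 0 SC3') SC4'"
proof -
  have e: "(0 + u * v) * (0 + v) = u * v\<^sup>2" for u v :: 'k by (simp add: power2_eq_square)
  show ?thesis
    unfolding blowup_UV_def SC3'_def SC4'_def fst_conv snd_conv e
    by (rule veqI; rule geqI2[of "\<lambda>u v. u * v" "\<lambda>u v. q * (u * v\<^sup>2) - 1"]; (intro nzpoly_intros)?)
    (simp add: divide_simps q; algebra)+
qed

section \<open>Base points on the exceptional curves\<close>

lemma SB1_no_base: "base_point SB1 0 c \<Longrightarrow> c = 0 \<or> c = - q"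
proof (rule ccontr)
  assume *: "base_point SB1 0 c" "\<not> (c = 0 \<or> c = - q)"
  have c: "c + q \<noteq> 0" using * by (simp add: eq_neg_iff_add_eq_0)
  have "\<not> base_point SB1 0 c"
    unfolding SB1_def
    by (rule definite_not_base; rule definite_divide, (rule has_value_intros | (simp add: q k; fail))+)
      (use * c q in \<open>auto intro!: nzpoly_intros\<close>)
  with * show False by blast
qed

lemma SB1_base: "base_point SB1 0 0"
proof -
  have "indeterminate_at (snd SB1) 0 0"
  proof (rule indeterminateI[where j = 1 and k = 1])
    show "snd SB1 \<doteq> (\<lambda>u v. ((v - 0) ^ 1 * (4 * (v + q)\<^sup>2) + u * (v * (r * (v + 2 * q) - 1))) / u ^ 1)"
      unfolding SB1_def by (simp add: algebra_simps)
    show "has_value (\<lambda>u v. 4 * (v + q)\<^sup>2) 0 0 (4 * (0 + q)\<^sup>2)"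
      by (intro has_value_intros)
    show "has_value (\<lambda>u v. v * (r * (v + 2 * q) - 1)) 0 0 (0 * (r * (0 + 2 * q) - 1))"
      by (intro has_value_intros)
  qed (use q in auto)
  then show ?thesis by (simp add: base_point_def)
qed

lemma SB1'_no_base: "base_point SB1' c 0 \<Longrightarrow> c = - 1 / q"
proof (rule ccontr)
  assume *: "base_point SB1' c 0" "c \<noteq> - 1 / q"
  have "1 + q * c = q * (c - (- 1 / q))" using q by (simp add: field_simps)
  moreover have "c - (- 1 / q) \<noteq> 0" using *(2) by (metis right_minus_eq)
  ultimately have c: "1 + q * c \<noteq> 0" using q by (metis mult_eq_0_iff)
  have "\<not> base_point SB1' c 0"
    unfolding SB1'_def
    by (rule definite_not_base; rule definite_divide, (rule has_value_intros | (simp add: q k; fail))+)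
      (use * c q in \<open>auto intro!: nzpoly_intros\<close>)
  with * show False by blast
qed

text \<open>In the coordinates (1/y, y z) no denominator vanishes at u = 0, because q \<noteq> 0.
  The cascade at z = 0 is over after a single blow-up.\<close>

lemma SBa_regular: "vf_regular_at SBa 0 c"
  unfolding SBa_def vf_regular_at_def fst_conv snd_conv
  by (rule conjI; rule has_value_regular, (rule has_value_intros | (simp add: q k; fail))+)

lemma SBa'_no_base: "\<not> base_point SBa' c 0"
  unfolding SBa'_def
proof (rule definite_not_base)
  show "definite_at (\<lambda>U V. 4 * (V + q) + U * (2 * r * (V + q) - 1 - U * V * C) + k * U\<^sup>2 * V * (2 * q + V) / (V + q)\<^sup>2) c 0"
    by (rule has_value_definite, (rule has_value_intros | (simp add: q k; fail))+)
  show "definite_at (\<lambda>U V. (4 * (V + q)\<^sup>2 + U * V * (r * (V + 2 * q) - 1)) / U) c 0"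
    by (rule definite_divide, (rule has_value_intros)+) (use q in \<open>auto intro!: nzpoly_intros\<close>)
qed

lemma SB2_no_base: "\<not> base_point SB2 0 c"
  unfolding SB2_def
  by (rule definite_not_base; rule definite_divide, (rule has_value_intros | (simp add: q k; fail))+)
    (use q k in \<open>auto intro!: nzpoly_intros\<close>)

lemma SB2'_no_base: "base_point SB2' c 0 \<Longrightarrow> c = 0"
  unfolding SB2'_def
  by (erule contrapos_pp, rule definite_not_base; rule definite_divide, (rule has_value_intros | (simp add: q k; fail))+)
    (use q k in \<open>auto intro!: nzpoly_intros\<close>)

lemma SB2'_base: "base_point SB2' 0 0"
proof -
  have "indeterminate_at (\<lambda>u v. fst SB2' v u) 0 0"
  proof (rule indeterminateI[where j = 2 and k = 1])
    show "(\<lambda>u v. fst SB2' v u) \<doteq> (\<lambda>u v. ((v - 0)\<^sup>2 * (k * (q + u)) + u * (4 * u + v * (r * (2 * u + q) - 1 - v * u * C))) / u ^ 1)"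
      unfolding SB2'_def by (simp add: algebra_simps)
    show "has_value (\<lambda>u v. k * (q + u)) 0 0 (k * (q + 0))"
      by (intro has_value_intros)
    show "has_value (\<lambda>u v. 4 * u + v * (r * (2 * u + q) - 1 - v * u * C)) 0 0 (4 * 0 + 0 * (r * (2 * 0 + q) - 1 - 0 * 0 * C))"
      by (intro has_value_intros)
  qed (use q k in auto)
  then show ?thesis by (simp add: base_point_def indeterminate_at_swap[of "fst SB2'"])
qed

lemma SB3_no_base: "base_point SB3 0 c \<Longrightarrow> c = 0"
  unfolding SB3_def
  by (erule contrapos_pp, rule definite_not_base; rule definite_divide, (rule has_value_intros | (simp add: q k; fail))+)
    (use q k in \<open>auto intro!: nzpoly_intros\<close>)

lemma SB3_base: "base_point SB3 0 0"
proof -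
  have "indeterminate_at (snd SB3) 0 0"
  proof (rule indeterminateI[where j = 1 and k = 1])
    show "snd SB3 \<doteq> (\<lambda>u v. ((v - 0) ^ 1 * (- 4 * q) + u * (- r * u * v\<^sup>2 - r * q * v + u\<^sup>2 * v\<^sup>2 * C - k * (q + u * v))) / u ^ 1)"
      unfolding SB3_def by (simp add: algebra_simps)
    show "has_value (\<lambda>u v. - 4 * q) 0 0 (- 4 * q)"
      by (intro has_value_intros)
    show "has_value (\<lambda>u v. - r * u * v\<^sup>2 - r * q * v + u\<^sup>2 * v\<^sup>2 * C - k * (q + u * v)) 0 0
      (- r * 0 * 0\<^sup>2 - r * q * 0 + 0\<^sup>2 * 0\<^sup>2 * C - k * (q + 0 * 0))"
      by (intro has_value_intros)
  qed (use q in auto)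
  then show ?thesis by (simp add: base_point_def)
qed

lemma SB3'_no_base: "\<not> base_point SB3' c 0"
  unfolding SB3'_def
  by (rule definite_not_base; rule definite_divide, (rule has_value_intros | (simp add: q k; fail))+)
    (use q k in \<open>auto intro!: nzpoly_intros\<close>)

lemma SB4_no_base: "base_point SB4 0 c \<Longrightarrow> c = - k / 2"
proof (rule ccontr)
  assume *: "base_point SB4 0 c" "\<not> (c = - k / 2)"
  have "- 4 * q * c - 2 * k * q = - 4 * q * (c - (- k / 2))"
    using q k by (simp add: field_simps flip: power_add)
  moreover have "c - (- k / 2) \<noteq> 0" using *(2) by (metis right_minus_eq)
  ultimately have c: "- 4 * q * c - 2 * k * q \<noteq> 0" using q k by (simp only: mult_eq_0_iff) (simp add: q k)
  have "\<not> base_point SB4 0 c"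
    unfolding SB4_def
    by (rule definite_not_base; rule definite_divide, (rule has_value_intros | (simp add: q k; fail))+)
      (use c q k in \<open>auto intro!: nzpoly_intros\<close>)
  with * show False by blast
qed

lemma SB4'_no_base: "base_point SB4' c 0 \<Longrightarrow> c = - 2 / k"
proof (rule ccontr)
  assume *: "base_point SB4' c 0" "\<not> (c = - 2 / k)"
  have "4 * q + 2 * k * q * c = 2 * k * q * (c - (- 2 / k))"
    using q k by (simp add: field_simps flip: power_add)
  moreover have "c - (- 2 / k) \<noteq> 0" using *(2) by (metis right_minus_eq)
  ultimately have c: "4 * q + 2 * k * q * c \<noteq> 0" using q k by (simp only: mult_eq_0_iff) (simp add: q k)
  have "\<not> base_point SB4' c 0"
    unfolding SB4'_def
    by (rule definite_not_base; rule definite_divide, (rule has_value_intros | (simp add: q k; fail))+)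
      (use c q k in \<open>auto intro!: nzpoly_intros\<close>)
  with * show False by blast
qed

lemma SC2_no_base: "base_point SC2 0 c \<Longrightarrow> c = 0"
  unfolding SC2_def
  by (erule contrapos_pp, rule definite_not_base; rule definite_divide, (rule has_value_intros | (simp add: q k; fail))+)
    (use q k in \<open>auto intro!: nzpoly_intros\<close>)

lemma SC2_base: "base_point SC2 0 0"
proof -
  have "indeterminate_at (snd SC2) 0 0"
  proof (rule indeterminateI[where j = 2 and k = 1])
    show "snd SC2 \<doteq> (\<lambda>t w. ((w - 0)\<^sup>2 * (k * (q * t - 1)\<^sup>2 * (2 * q * t - 1) / q ^ 4) +
       t * (12 * q ^ 5 * t / (q * t - 1) ^ 3 + w * (4 * r * q * (2 * q * t - 1) / (q * t - 1) - 4
        - (q * t - 1) * t * w * C / q))) / t ^ 1)"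
      unfolding SC2_def by (simp add: mult_ac add_ac)
    show "has_value (\<lambda>t w. k * (q * t - 1)\<^sup>2 * (2 * q * t - 1) / q ^ 4) 0 0 (k * (q * 0 - 1)\<^sup>2 * (2 * q * 0 - 1) / q ^ 4)"
      by (rule has_value_intros | (simp add: q; fail))+
    show "has_value (\<lambda>t w. 12 * q ^ 5 * t / (q * t - 1) ^ 3 + w * (4 * r * q * (2 * q * t - 1) / (q * t - 1) - 4
        - (q * t - 1) * t * w * C / q)) 0 0 (12 * q ^ 5 * 0 / (q * 0 - 1) ^ 3 + 0 * (4 * r * q * (2 * q * 0 - 1) / (q * 0 - 1) - 4
        - (q * 0 - 1) * 0 * 0 * C / q))"
      by (rule has_value_intros | (simp add: q; fail))+
  qed (use q k in auto)
  then show ?thesis by (simp add: base_point_def)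
qed

lemma SC2'_no_base: "\<not> base_point SC2' c 0"
  unfolding SC2'_def
  by (rule definite_not_base; rule definite_divide, (rule has_value_intros | (simp add: q k; fail))+)
    (use q k in \<open>auto intro!: nzpoly_intros\<close>)

lemma SC3_no_base: "\<not> base_point SC3 0 c"
  unfolding SC3_def
  by (rule definite_not_base; rule definite_divide, (rule has_value_intros | (simp add: q k; fail))+)
    (use q k in \<open>auto intro!: nzpoly_intros\<close>)

lemma SC3'_no_base: "base_point SC3' c 0 \<Longrightarrow> c = 0"
  unfolding SC3'_def
  by (erule contrapos_pp, rule definite_not_base; rule definite_divide, (rule has_value_intros | (simp add: q k; fail))+)
    (use q k in \<open>auto intro!: nzpoly_intros\<close>)

lemma SC3'_base: "base_point SC3' 0 0"
proof -
  let ?H = "\<lambda>w y. y * (1 - 2 * r * q) - 12 * q ^ 5 * y\<^sup>2 / (q * (y * w) - 1) ^ 3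
         - y * (4 * r * q * (2 * q * y * w - 1) / (q * (y * w) - 1) - 4 - (q * (y * w) - 1) * y * w\<^sup>2 * C / q)
         - k * (q * (y * w) - 1)\<^sup>2 * (2 * q * y * w - 1) / q ^ 4"
  have "indeterminate_at (\<lambda>w y. fst SC3' y w) 0 0"
  proof (rule indeterminateI[where j = 1 and k = 1])
    show "(\<lambda>w y. fst SC3' y w) \<doteq> (\<lambda>w y. ((y - 0) ^ 1 * (- 4 * q ^ 4 / (q * (y * w) - 1)\<^sup>2) + w * ?H w y) / w ^ 1)"
      unfolding SC3'_def by (simp add: mult.commute)
    show "has_value (\<lambda>w y. - 4 * q ^ 4 / (q * (y * w) - 1)\<^sup>2) 0 0 (- 4 * q ^ 4 / (q * (0 * 0) - 1)\<^sup>2)"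
      by (rule has_value_intros | (simp add: q; fail))+
    show "has_value ?H 0 0 (?H 0 0)"
      by (rule has_value_intros | (simp add: q; fail))+
  qed (use q in auto)
  then show ?thesis by (simp add: base_point_def indeterminate_at_swap[of "fst SC3'"])
qed

lemma SC4_no_base: "base_point SC4 0 c \<Longrightarrow> c = 2 * q ^ 8 / k"
proof (rule ccontr)
  assume *: "base_point SC4 0 c" "\<not> (c = 2 * q ^ 8 / k)"
  have "4 * q ^ 4 - 2 * k * c / q ^ 4 = (- 2 * k / q ^ 4) * (c - 2 * q ^ 8 / k)"
    using q k by (simp add: field_simps flip: power_add)
  moreover have "c - (2 * q ^ 8 / k) \<noteq> 0" using *(2) by (metis right_minus_eq)
  ultimately have c: "4 * q ^ 4 - 2 * k * c / q ^ 4 \<noteq> 0" using q k by (simp only: mult_eq_0_iff) (simp add: q k)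
  have "\<not> base_point SC4 0 c"
    unfolding SC4_def
    by (rule definite_not_base; rule definite_divide, (rule has_value_intros | (simp add: q k; fail))+)
      (use c q k in \<open>auto intro!: nzpoly_intros\<close>)
  with * show False by blast
qed

lemma SC4'_no_base: "base_point SC4' c 0 \<Longrightarrow> c = k / (2 * q ^ 8)"
proof (rule ccontr)
  assume *: "base_point SC4' c 0" "\<not> (c = k / (2 * q ^ 8))"
  have "- 4 * q ^ 4 * c + 2 * k / q ^ 4 = (- 4 * q ^ 4) * (c - k / (2 * q ^ 8))"
    using q k by (simp add: field_simps flip: power_add)
  moreover have "c - (k / (2 * q ^ 8)) \<noteq> 0" using *(2) by (metis right_minus_eq)
  ultimately have c: "- 4 * q ^ 4 * c + 2 * k / q ^ 4 \<noteq> 0" using q k by (simp only: mult_eq_0_iff) (simp add: q k)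
  have "\<not> base_point SC4' c 0"
    unfolding SC4'_def
    by (rule definite_not_base; rule definite_divide, (rule has_value_intros | (simp add: q k; fail))+)
      (use c q k in \<open>auto intro!: nzpoly_intros\<close>)
  with * show False by blast
qed


text \<open>The formulas for d k and d q alone make the criterion an identity, whatever r is: the
  zeros of y3 impose no condition on q.\<close>

lemma SB4_double: "base_point SB4 0 (- k / 2)" "cascades_regular d SB4 0 (- k / 2)"
proof -
  define c where "c = - k / 2"
  have kc: "k = - 2 * c" and c: "c \<noteq> 0" using k by (simp_all add: c_def)
  have f: "fst SB4 \<doteq> (\<lambda>u v. - 2 * q + (r * q - 1) * u + 2 * q / c * (v - c) +
      u\<^sup>2 * (k + 4 * v + 2 * r * u * v - u\<^sup>2 * v * C) + u * (v - c) * 0 + (v - c)\<^sup>2 * (- 2 * q / (c * v)))"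
    unfolding SB4_def fst_conv unfolding kc
    apply (rule geqI[of "\<lambda>u v. v"]; (intro nzpoly_intros)?)
    apply (simp add: divide_simps c; algebra)
    done
  have g: "snd SB4 \<doteq> (\<lambda>u v. (2 * (- 2 * q) * (v - c) + (1 - 2 * r * q) * c * u + 0 * u\<^sup>2
       + (1 - 2 * r * q) * u * (v - c) + 0 * (v - c)\<^sup>2
       + u ^ 3 * (- 3 * r * v\<^sup>2 + 2 * u * v\<^sup>2 * C) + u\<^sup>2 * (v - c) * (- 4 * v) + u * (v - c)\<^sup>2 * 0 + (v - c) ^ 3 * 0) / u)"
    unfolding SB4_def snd_conv unfolding kc
    apply (rule geqI[of "\<lambda>u v. u"]; (intro nzpoly_intros)?)
    apply (simp add: divide_simps c; algebra)
    done
  have hv: "regular_at (\<lambda>u v. k + 4 * v + 2 * r * u * v - u\<^sup>2 * v * C) 0 c"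
    "regular_at (\<lambda>u v. 0) 0 c"
    "regular_at (\<lambda>u v. - 2 * q / (c * v)) 0 c"
    "regular_at (\<lambda>u v. - 3 * r * v\<^sup>2 + 2 * u * v\<^sup>2 * C) 0 c"
    "regular_at (\<lambda>u v. - 4 * v) 0 c"
    by (rule has_value_regular, (rule has_value_intros | (simp add: c; fail))+)+
  have dc: "d c = c * (3 - 2 * r * q)" by (simp add: c_def d_minus d_divide d_mult dk field_simps)
  have c1: "- c / q = (d c - (1 - 2 * r * q) * c) / (- 2 * q)" using q by (simp add: dc field_simps)
  have m: "- 2 * q \<noteq> 0" using q by simp
  note D = cascades_regular_double[OF f g hv(1,2,3,4,5,2,2) m c1]
  have "d (- c / q) = - (c * (4 - 3 * r * q)) / q"
    using q by (simp add: d_minus d_divide dc dq field_simps power2_eq_square)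
  moreover have "0 + ((1 - 2 * r * q) - (r * q - 1)) * (- c / q) + (0 - 2 * q / c) * (- c / q)\<^sup>2
      = - (c * (4 - 3 * r * q)) / q"
    using q c by (simp add: field_simps power2_eq_square)
  ultimately show "base_point SB4 0 (- k / 2)" "cascades_regular d SB4 0 (- k / 2)"
    using D unfolding c_def by simp_all
qed

text \<open>The point w = - k / 2 of \<open>SB4\<close> in the coordinate 1 / w.\<close>

lemma SB4'_double: "base_point SB4' (- 2 / k) 0" "cascades_regular d SB4' (- 2 / k) 0"
proof -
  define c where "c = - 2 / k"
  have kc: "k = - 2 / c" and c: "c \<noteq> 0" using k by (simp_all add: c_def)
  have f: "fst (vswap SB4') \<doteq> (\<lambda>u v. k * q + (- r * q) * u + q * k\<^sup>2 * (v - c) +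
      u\<^sup>2 * (- r * u * v + u\<^sup>2 * v\<^sup>2 * C - k * v) + u * (v - c) * 0 + (v - c)\<^sup>2 * (- q * k\<^sup>2 / v))"
    unfolding SB4'_def vswap_def fst_conv snd_conv unfolding kc
    apply (rule geqI[of "\<lambda>u v. v"]; (intro nzpoly_intros)?)
    apply (simp add: divide_simps c; algebra)
    done
  have g: "snd (vswap SB4') \<doteq> (\<lambda>u v. (2 * (k * q) * (v - c) + (2 * r * q - 1) * c * u + 0 * u\<^sup>2
       + (2 * r * q - 1) * u * (v - c) + 0 * (v - c)\<^sup>2
       + u ^ 3 * (3 * r * v\<^sup>2 - 2 * u * v ^ 3 * C) + u\<^sup>2 * (v - c) * (2 * k * v) + u * (v - c)\<^sup>2 * 0 + (v - c) ^ 3 * 0) / u)"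
    unfolding SB4'_def vswap_def fst_conv snd_conv unfolding kc
    apply (rule geqI[of "\<lambda>u v. u"]; (intro nzpoly_intros)?)
    apply (simp add: divide_simps c; algebra)
    done
  have hv: "regular_at (\<lambda>u v. - r * u * v + u\<^sup>2 * v\<^sup>2 * C - k * v) 0 c"
    "regular_at (\<lambda>u v. 0) 0 c"
    "regular_at (\<lambda>u v. - q * k\<^sup>2 / v) 0 c"
    "regular_at (\<lambda>u v. 3 * r * v\<^sup>2 - 2 * u * v ^ 3 * C) 0 c"
    "regular_at (\<lambda>u v. 2 * k * v) 0 c"
    by (rule has_value_regular, (rule has_value_intros | (simp add: c; fail))+)+
  have dc: "d c = - c * (3 - 2 * r * q)"
    using k by (simp add: c_def d_minus d_divide d_mult dk field_simps power2_eq_square)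
  have c1: "- c\<^sup>2 * (- 1 / q) = (d c - (2 * r * q - 1) * c) / (k * q)"
    using q c by (simp add: dc kc divide_simps; algebra)
  have m: "k * q \<noteq> 0" using q k by simp
  note D = cascades_regular_double[OF f g hv(1,2,3,4,5,2,2) m c1]
  have "d (- c\<^sup>2 * (- 1 / q)) = (c\<^sup>2 / q) * (3 * r * q - 5)"
    using q by (simp add: d_minus d_divide d_mult d_power dc dq divide_simps; algebra)
  moreover have "0 + ((2 * r * q - 1) - (- r * q)) * (- c\<^sup>2 * (- 1 / q)) + (0 - q * k\<^sup>2) * (- c\<^sup>2 * (- 1 / q))\<^sup>2
      = (c\<^sup>2 / q) * (3 * r * q - 5)"
    using q c by (simp add: kc divide_simps; algebra)
  ultimately show "base_point SB4' (- 2 / k) 0" "cascades_regular d SB4' (- 2 / k) 0"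
    using D unfolding c_def by (simp_all add: base_point_vswap cascades_regular_vswap)
qed


text \<open>The same point once more, in other coordinates: composing the blow-ups, m = q^3 z^5 /
  (y^2 (z + q)^3), and z = - q, y^2 (z + q)^3 = - k / 2 give m = 2 q^8 / k.\<close>

lemma SC4_double: "base_point SC4 0 (2 * q ^ 8 / k)" "cascades_regular d SC4 0 (2 * q ^ 8 / k)"
proof -
  define c where "c = 2 * q ^ 8 / k"
  have kc: "k = 2 * q ^ 8 / c" and c: "c \<noteq> 0" using k q by (simp_all add: c_def)
  \<comment> \<open>\<open>p\<close> is treated as an independent quantity, tied to u and v only by
    q u^2 v = p + 1, which keeps the identities small.\<close>
  define p where "p u v = q * (u\<^sup>2 * v) - 1" for u v
  have p_0: "p 0 v = - 1" for v by (simp add: p_def)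
  have pp: "2 * q * u\<^sup>2 * v - 1 = 2 * p u v + 1" for u v by (simp add: p_def)
  have p_nz: "nzpoly p" unfolding p_def by (intro nzpoly_intros)
  have p_val: "has_value p 0 c (- 1)"
    using has_value_poly[OF nzpoly_polyfun2[OF p_nz], of 0 c] by (simp add: p_0)
  \<comment> \<open>The terms in \<open>p\<close> are expanded at p = - 1 by repeated division by p
    + 1 = q u^2 v, each division yielding a factor u^2; \<open>1 - 2 * p\<close>,
    \<open>2 * p - 3\<close> and \<open>1 - p + p\<^sup>2\<close> are the cofactors that
    remain.\<close>
  let ?F1 = "\<lambda>u v. - 8 * q ^ 5 - u\<^sup>2 * (4 * q ^ 6 * v * (1 - 2 * p u v)) / (p u v)\<^sup>2 - 12 * q ^ 5 / (p u v) ^ 3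
       - 4 * r * q\<^sup>2 * u * v / p u v + u\<^sup>2 * p u v * v\<^sup>2 * C / q
       - k * (4 * q * v + u\<^sup>2 * q\<^sup>2 * v\<^sup>2 * (2 * p u v - 3)) / q ^ 4"
  let ?A = "\<lambda>u v. u * (4 * q ^ 6 * v\<^sup>2 * (1 - 2 * p u v)) / (p u v)\<^sup>2 + u * (2 * k * v ^ 3 * (2 * p u v - 3)) / q\<^sup>2
       + 8 * r * q\<^sup>2 * v\<^sup>2 / p u v + u * (24 * q ^ 6 * v\<^sup>2 * (1 - p u v + (p u v)\<^sup>2)) / (p u v) ^ 3
       - u * 2 * p u v * v ^ 3 * C / q"
  have f: "fst SC4 \<doteq> (\<lambda>u v. - k / q ^ 4 + (5 - 6 * r * q) * u + 4 * q ^ 4 / c\<^sup>2 * (v - c) +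
      u\<^sup>2 * ?F1 u v + u * (v - c) * 0 + (v - c)\<^sup>2 * (- 4 * q ^ 4 / (c\<^sup>2 * v)))"
    unfolding SC4_def fst_conv p_def[symmetric] pp unfolding kc
    apply (rule geqI2[of "\<lambda>u v. v" p]; (intro nzpoly_intros p_nz)?)
    subgoal for u v
    proof -
      assume nz: "v \<noteq> 0" "p u v \<noteq> 0"
      have "q * (u\<^sup>2 * v) = p u v + 1" by (simp add: p_def)
      then show ?thesis using nz q c by (simp add: divide_simps; algebra)
    qed
    done
  have g: "snd SC4 \<doteq> (\<lambda>u v. (2 * (- k / q ^ 4) * (v - c) + (10 * r * q - 9) * c * u + 0 * u\<^sup>2
       + (10 * r * q - 9) * u * (v - c) + 0 * (v - c)\<^sup>2
       + u ^ 3 * ?A u v + u\<^sup>2 * (v - c) * (8 * k * v / q ^ 3) + u * (v - c)\<^sup>2 * 0 + (v - c) ^ 3 * 0) / u)"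
    unfolding SC4_def snd_conv p_def[symmetric] pp unfolding kc
    apply (rule geqI2[of "\<lambda>u v. u" p]; (intro nzpoly_intros p_nz)?)
    subgoal for u v
    proof -
      assume nz: "u \<noteq> 0" "p u v \<noteq> 0"
      have "q * (u\<^sup>2 * v) = p u v + 1" by (simp add: p_def)
      then show ?thesis using nz q c by (simp add: divide_simps; algebra)
    qed
    done
  have hv: "regular_at ?F1 0 c" "regular_at (\<lambda>u v. 0) 0 c"
    "regular_at (\<lambda>u v. - 4 * q ^ 4 / (c\<^sup>2 * v)) 0 c"
    "regular_at ?A 0 c" "regular_at (\<lambda>u v. 8 * k * v / q ^ 3) 0 c"
    by (rule has_value_regular, (rule has_value_intros p_val | (simp add: q c; fail))+)+
  have dc: "d c = c * (10 * r * q - 11)"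
    using k q by (simp add: c_def d_divide d_mult d_power dk dq divide_simps; algebra)
  have c1: "c\<^sup>2 / q ^ 4 = (d c - (10 * r * q - 9) * c) / (- k / q ^ 4)"
    using q c by (simp add: dc kc divide_simps; algebra)
  have m: "- k / q ^ 4 \<noteq> 0" using q k by simp
  note D = cascades_regular_double[OF f g hv(1,2,3,4,5,2,2) m c1]
  have "d (c\<^sup>2 / q ^ 4) = c\<^sup>2 / q ^ 4 * (16 * r * q - 18)"
    using q by (simp add: d_minus d_divide d_mult d_power dc dq divide_simps; algebra)
  moreover have "0 + ((10 * r * q - 9) - (5 - 6 * r * q)) * (c\<^sup>2 / q ^ 4) + (0 - 4 * q ^ 4 / c\<^sup>2) * (c\<^sup>2 / q ^ 4)\<^sup>2
      = c\<^sup>2 / q ^ 4 * (16 * r * q - 18)"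
    using q c by (simp add: divide_simps; algebra)
  ultimately show "base_point SC4 0 (2 * q ^ 8 / k)" "cascades_regular d SC4 0 (2 * q ^ 8 / k)"
    using D unfolding c_def by simp_all
qed

text \<open>The point of \<open>SC4_double\<close> in the coordinate n = 1 / m.\<close>

lemma SC4'_double: "base_point SC4' (k / (2 * q ^ 8)) 0" "cascades_regular d SC4' (k / (2 * q ^ 8)) 0"
proof -
  define c where "c = k / (2 * q ^ 8)"
  have kc: "k = 2 * q ^ 8 * c" and c: "c \<noteq> 0" using k q by (simp_all add: c_def)
  define p where "p u v = q * (v * u\<^sup>2) - 1" for u v
  have p_0: "p 0 v = - 1" for v by (simp add: p_def)
  have pp: "2 * q * v * u\<^sup>2 - 1 = 2 * p u v + 1" for u v by (simp add: p_def)
  have p_nz: "nzpoly p" unfolding p_def using nzpoly_swap[OF nzpoly_line(9)] .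
  have p_val: "has_value p 0 c (- 1)"
    using has_value_poly[OF nzpoly_polyfun2[OF p_nz], of 0 c] by (simp add: p_0)
  let ?F1 = "\<lambda>u v. 12 * q ^ 5 * v / (p u v) ^ 3 + 4 * r * q\<^sup>2 * u * v / p u v - u\<^sup>2 * p u v * v * C / q
       + k * (4 * q + u\<^sup>2 * q\<^sup>2 * v * (2 * p u v - 3)) / q ^ 4"
  let ?A = "\<lambda>u v. - u * (4 * q ^ 6 * v ^ 3 * (1 - 2 * p u v)) / (p u v)\<^sup>2 - u * (2 * k * v\<^sup>2 * (2 * p u v - 3)) / q\<^sup>2
       - 8 * r * q\<^sup>2 * v\<^sup>2 / p u v - u * (24 * q ^ 6 * v ^ 3 * (1 - p u v + (p u v)\<^sup>2)) / (p u v) ^ 3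
       + u * 2 * p u v * v\<^sup>2 * C / q"
  have f: "fst (vswap SC4') \<doteq> (\<lambda>u v. - 2 * q ^ 4 + (4 * r * q - 4) * u + 2 * q ^ 4 / c * (v - c) +
      u\<^sup>2 * ?F1 u v + u * (v - c) * 0 + (v - c)\<^sup>2 * (- 2 * q ^ 4 / (c * v)))"
    unfolding SC4'_def vswap_def fst_conv snd_conv p_def[symmetric] pp unfolding kc
    apply (rule geqI2[of "\<lambda>u v. v" p]; (intro nzpoly_intros p_nz)?)
    subgoal for u v
    proof -
      assume nz: "v \<noteq> 0" "p u v \<noteq> 0"
      have "q * (v * u\<^sup>2) = p u v + 1" by (simp add: p_def)
      then show ?thesis using nz q c by (simp add: divide_simps; algebra)
    qed
    done
  have g: "snd (vswap SC4') \<doteq> (\<lambda>u v. (2 * (- 2 * q ^ 4) * (v - c) + (9 - 10 * r * q) * c * u + 0 * u\<^sup>2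
       + (9 - 10 * r * q) * u * (v - c) + 0 * (v - c)\<^sup>2
       + u ^ 3 * ?A u v + u\<^sup>2 * (v - c) * (16 * q ^ 5 * v) + u * (v - c)\<^sup>2 * 0 + (v - c) ^ 3 * 0) / u)"
    unfolding SC4'_def vswap_def fst_conv snd_conv p_def[symmetric] pp unfolding kc
    apply (rule geqI2[of "\<lambda>u v. u" p]; (intro nzpoly_intros p_nz)?)
    subgoal for u v
    proof -
      assume nz: "u \<noteq> 0" "p u v \<noteq> 0"
      have "q * (v * u\<^sup>2) = p u v + 1" by (simp add: p_def)
      then show ?thesis using nz q c by (simp add: divide_simps; algebra)
    qed
    done
  have hv: "regular_at ?F1 0 c" "regular_at (\<lambda>u v. 0) 0 c"
    "regular_at (\<lambda>u v. - 2 * q ^ 4 / (c * v)) 0 c"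
    "regular_at ?A 0 c" "regular_at (\<lambda>u v. 16 * q ^ 5 * v) 0 c"
    by (rule has_value_regular, (rule has_value_intros p_val | (simp add: q c; fail))+)+
  have dc: "d c = - c * (10 * r * q - 11)"
    using k q by (simp add: c_def d_divide d_mult d_power dk dq divide_simps; algebra)
  have c1: "- c / q ^ 4 = (d c - (9 - 10 * r * q) * c) / (- 2 * q ^ 4)"
    using q c by (simp add: dc divide_simps; algebra)
  have m: "- 2 * q ^ 4 \<noteq> 0" using q k by simp
  note D = cascades_regular_double[OF f g hv(1,2,3,4,5,2,2) m c1]
  have "d (- c / q ^ 4) = (- c / q ^ 4) * (15 - 14 * r * q)"
    using q by (simp add: d_minus d_divide d_mult d_power dc dq divide_simps; algebra)
  moreover have "0 + ((9 - 10 * r * q) - (4 * r * q - 4)) * (- c / q ^ 4) + (0 - 2 * q ^ 4 / c) * (- c / q ^ 4)\<^sup>2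
      = (- c / q ^ 4) * (15 - 14 * r * q)"
    using q c by (simp add: divide_simps; algebra)
  ultimately show "base_point SC4' (k / (2 * q ^ 8)) 0" "cascades_regular d SC4' (k / (2 * q ^ 8)) 0"
    using D unfolding c_def by (simp_all add: base_point_vswap cascades_regular_vswap)
qed

section \<open>Assembly of the cascade\<close>

lemma cascades_SB1_0: "cascades_regular d SB1 0 0"
  by (rule cascades_regularI[OF SBa SBa']) (use SBa_regular SBa'_no_base vf_regular_not_base in blast)+

lemma cascades_SB3: "cascades_regular d SB3 0 0"
  by (rule cascades_regularI[OF SB4 SB4'])
    (use SB4_no_base SB4'_no_base SB4_double SB4'_double in blast)+

lemma cascades_SB2': "cascades_regular d SB2' 0 0"
  by (rule cascades_regularI[OF SB3 SB3'])
    (use SB3_no_base SB3'_no_base SB3_base cascades_SB3 in blast)+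

lemma cascades_SB1_q: "cascades_regular d SB1 0 (- q)"
  by (rule cascades_regularI[OF SB2 SB2'])
    (use SB2_no_base SB2'_no_base SB2'_base cascades_SB2' in blast)+

lemma cascades_SC3': "cascades_regular d SC3' 0 0"
  by (rule cascades_regularI[OF SC4 SC4'])
    (use SC4_no_base SC4'_no_base SC4_double SC4'_double in blast)+

lemma cascades_SC2: "cascades_regular d SC2 0 0"
  by (rule cascades_regularI[OF SC3 SC3'])
    (use SC3_no_base SC3'_no_base SC3'_base cascades_SC3' in blast)+

lemma cascades_SB1': "cascades_regular d SB1' (- 1 / q) 0"
  by (rule cascades_regularI[OF SC2 SC2'])
    (use SC2_no_base SC2'_no_base SC2_base cascades_SC2 in blast)+

lemma cascades_Su0: "cascades_regular d Su0 0 0"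
  by (rule cascades_regularI[OF SB1 SB1'])
    (use SB1_no_base SB1'_no_base SB1_base cascades_SB1_0 cascades_SB1_q cascades_SB1' in blast)+

lemma regularised_Sys: "regularised d Sys \<longleftrightarrow> d G = G"
proof -
  have "regularised d Sys \<longleftrightarrow>
    (\<forall>a b. base_point Su0 a b \<longrightarrow> cascades_regular d Su0 a b) \<and>
    (\<forall>a b. base_point SU0 a b \<longrightarrow> cascades_regular d SU0 a b)"
    by (simp add: regularised_def Sys_no_base base_point_veq[OF Su0] base_point_veq[OF SU0]
        cascades_regular_veq[OF Su0] cascades_regular_veq[OF SU0])
  also have "\<dots> \<longleftrightarrow> cascades_regular d SU0 0 0"
    using cascades_Su0 Su0_no_base SU0_no_base SU0_base by metis
  finally show ?thesis by (simp add: cascades_SU0)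
qed

end

section \<open>Laurent expansions of the coefficients\<close>

lemma laurent_zero_iff:
  assumes "(\<lambda>w. f (x0 + w)) has_laurent_expansion F"
  shows "(\<forall>\<^sub>F x in at x0. f x = 0) \<longleftrightarrow> F = 0"
proof
  assume ev: "\<forall>\<^sub>F x in at x0. f x = 0"
  show "F = 0"
  proof (rule ccontr)
    assume "F \<noteq> 0"
    then have "\<forall>\<^sub>F x in at x0. f x \<noteq> 0"
      using has_laurent_expansion_eventually_nonzero_iff[OF assms] by blast
    with ev have "\<forall>\<^sub>F x in at x0. False" by eventually_elim simp
    then show False by simp
  qed
next
  assume "F = 0"
  with assms have "\<forall>\<^sub>F w in at 0. f (x0 + w) = 0"
    by (auto simp: has_laurent_expansion_def elim: eventually_mono)
  then show "\<forall>\<^sub>F x in at x0. f x = 0"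
    by (subst eventually_at_to_0) (simp add: add.commute)
qed

text \<open>Expansion in x is available only for numerical y and z. Testing at constant series is
  enough, since these are infinitely many and a nonzero polynomial has finitely many roots.\<close>

lemma polyfun2_fls_zero:
  assumes "polyfun2 N" "\<And>y z. N (fls_const y) (fls_const z) = (0 :: complex fls)"
  shows "N Y Z = 0"
proof -
  from assms(1) obtain P where P: "\<And>y z. N y z = poly (poly P [:y:]) z"
    unfolding polyfun2_iff_poly by blast
  have inf: "infinite (range (fls_const :: complex \<Rightarrow> complex fls))"
    by (subst finite_image_iff) (auto simp: inj_on_def infinite_UNIV_char_0 fls_eq_iff split: if_splits)
  have "poly P [:fls_const y:] = 0" for y
  proof (rule ccontr)
    assume "poly P [:fls_const y:] \<noteq> 0"
    then have "finite {z. poly (poly P [:fls_const y:]) z = 0}" by (rule poly_roots_finite)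
    moreover have "range fls_const \<subseteq> {z. poly (poly P [:fls_const y:]) z = 0}"
      using assms(2) P by auto
    ultimately show False using inf finite_subset by blast
  qed
  then have sub: "(\<lambda>c. [:c:]) ` range fls_const \<subseteq> {x. poly P x = 0}" by auto
  have "infinite ((\<lambda>c. [:c:]) ` range (fls_const :: complex \<Rightarrow> complex fls))"
    using inf by (subst finite_image_iff) (auto simp: inj_on_def)
  then have "P = 0" using sub poly_roots_finite finite_subset by blast
  then show ?thesis by (simp add: P)
qed

lemma polyfun2_bipoly: "polyfun2 (bipoly n c)"
  unfolding polyfun2_def by blast

lemma bipoly_nonzero:
  fixes c :: "nat \<Rightarrow> nat \<Rightarrow> 'k::field_char_0"
  assumes "i \<le> n" "j \<le> n" "c i j \<noteq> 0"
  shows "nzpoly (bipoly n c)"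
proof -
  define P where "P = (\<Sum>i\<le>n. monom (\<Sum>j\<le>n. monom (c i j) j) i)"
  have "coeff (coeff P i) j = c i j"
    using assms(1,2) by (simp add: P_def coeff_sum if_distrib sum.delta cong: if_cong)
  then have "P \<noteq> 0" using assms(3) by auto
  then obtain y z where "poly (poly P [:y:]) z \<noteq> 0" using poly2_nonzero_value by blast
  also have "poly (poly P [:y:]) z = bipoly n c y z"
    by (simp add: P_def bipoly_def poly_sum poly_monom poly_const_pow sum_distrib_right
        sum_distrib_left mult_ac)
  finally show ?thesis by (intro nzpolyI[OF polyfun2_bipoly])
qed

lemma bipoly_laurent:
  assumes "\<And>i j. (\<lambda>w. c i j (x0 + w)) has_laurent_expansion c' i j"
  shows "(\<lambda>w. bipoly n (\<lambda>i j. c i j (x0 + w)) y z) has_laurent_expansion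
    bipoly n c' (fls_const y) (fls_const z)"
  unfolding bipoly_def fls_const_power[symmetric]
  by (intro laurent_expansion_intros assms)

lemma eventually_bipoly_nz:
  assumes "(\<lambda>w. e i j (x0 + w)) has_laurent_expansion e'" "e' \<noteq> 0" "i \<le> n" "j \<le> n"
  shows "\<forall>\<^sub>F x in at x0. nzpoly (bipoly n (\<lambda>i j. e i j x))"
proof -
  have "\<forall>\<^sub>F x in at x0. e i j x \<noteq> 0"
    using has_laurent_expansion_eventually_nonzero_iff[OF assms(1)] assms(2) by blast
  then show ?thesis
    by eventually_elim (rule bipoly_nonzero[OF assms(3,4)])
qed

text \<open>\<open>regularised_on\<close> asks for some expansion; the choice is immaterial because
  any two agree as rational functions over the Laurent series. This reduces its existential
  quantifier to one explicit field.\<close>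

lemma expands_at_unique:
  assumes "expands_at x0 F f" "expands_at x0 F g"
  shows "f \<doteq> g"
proof -
  from assms(1) obtain n c e c' e' i j where 1:
    "\<And>i j. (\<lambda>w. c i j (x0 + w)) has_laurent_expansion c' i j"
    "\<And>i j. (\<lambda>w. e i j (x0 + w)) has_laurent_expansion e' i j"
    "i \<le> n" "j \<le> n" "e' i j \<noteq> 0"
    "\<forall>\<^sub>F x in at x0. \<forall>y z. bipoly n (\<lambda>i j. e i j x) y z \<noteq> 0 \<longrightarrow>
        F x y z = bipoly n (\<lambda>i j. c i j x) y z / bipoly n (\<lambda>i j. e i j x) y z"
    "\<And>y z. f y z = bipoly n c' y z / bipoly n e' y z"
    unfolding expands_at_def by blast
  from assms(2) obtain m a b a' b' k l where 2:
    "\<And>i j. (\<lambda>w. a i j (x0 + w)) has_laurent_expansion a' i j"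
    "\<And>i j. (\<lambda>w. b i j (x0 + w)) has_laurent_expansion b' i j"
    "k \<le> m" "l \<le> m" "b' k l \<noteq> 0"
    "\<forall>\<^sub>F x in at x0. \<forall>y z. bipoly m (\<lambda>i j. b i j x) y z \<noteq> 0 \<longrightarrow>
        F x y z = bipoly m (\<lambda>i j. a i j x) y z / bipoly m (\<lambda>i j. b i j x) y z"
    "\<And>y z. g y z = bipoly m a' y z / bipoly m b' y z"
    unfolding expands_at_def by blast
  \<comment> \<open>The cross-multiplied difference of the two quotients. It vanishes for numerical
    y, z near x0, hence as a series at constant arguments, hence identically.\<close>
  define P where "P Y Z = bipoly n c' Y Z * bipoly m b' Y Z - bipoly m a' Y Z * bipoly n e' Y Z" for Y Z
  have pP: "polyfun2 P" unfolding P_def by (intro polyfun2_intros polyfun2_bipoly)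
  have "P (fls_const y) (fls_const z) = 0" for y z
  proof -
    let ?h = "\<lambda>x. bipoly n (\<lambda>i j. c i j x) y z * bipoly m (\<lambda>i j. b i j x) y z
        - bipoly m (\<lambda>i j. a i j x) y z * bipoly n (\<lambda>i j. e i j x) y z"
    have ev: "\<forall>\<^sub>F x in at x0. ?h x = 0"
      using eventually_bipoly_nz[where e = e, OF 1(2,5,3,4)] eventually_bipoly_nz[where e = b, OF 2(2,5,3,4)] 1(6) 2(6)
    proof eventually_elim
      case (elim x)
      let ?e = "bipoly n (\<lambda>i j. e i j x)" and ?b = "bipoly m (\<lambda>i j. b i j x)"
      have "(\<lambda>y z. bipoly n (\<lambda>i j. c i j x) y z * ?b y z) \<doteq> (\<lambda>y z. bipoly m (\<lambda>i j. a i j x) y z * ?e y z)"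
      proof (rule geqI2[OF elim(1,2)])
        fix y z assume nz: "?e y z \<noteq> 0" "?b y z \<noteq> 0"
        then have "bipoly n (\<lambda>i j. c i j x) y z / ?e y z = bipoly m (\<lambda>i j. a i j x) y z / ?b y z"
          using elim(3,4) by metis
        then show "bipoly n (\<lambda>i j. c i j x) y z * ?b y z = bipoly m (\<lambda>i j. a i j x) y z * ?e y z"
          using nz by (simp add: frac_eq_eq)
      qed
      from geq_poly_eq[OF this] show ?case
        by (simp add: polyfun2_mult polyfun2_bipoly)
    qed
    have "(\<lambda>w. ?h (x0 + w)) has_laurent_expansion P (fls_const y) (fls_const z)"
      unfolding P_def by (intro laurent_expansion_intros bipoly_laurent 1 2)
    then show ?thesis using ev laurent_zero_iff[of ?h] by blast
  qed
  then have "P Y Z = 0" for Y Z by (rule polyfun2_fls_zero[OF pP])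
  then have eq: "bipoly n c' Y Z * bipoly m b' Y Z = bipoly m a' Y Z * bipoly n e' Y Z" for Y Z
    by (simp add: P_def)
  show ?thesis
    by (rule geqI2[OF bipoly_nonzero[where c = e', OF 1(3,4,5)] bipoly_nonzero[where c = b', OF 2(3,4,5)]])
      (simp add: 1(7) 2(7) frac_eq_eq eq)
qed

section \<open>Differential polynomials on Laurent series\<close>

primrec dp_fls :: "diff_poly \<Rightarrow> complex fls \<Rightarrow> complex \<Rightarrow> complex fls" where
  "dp_fls (DConst c) Q x0 = fls_const c"
| "dp_fls DVar Q x0 = fls_const x0 + fls_X"
| "dp_fls (DJet k) Q x0 = (fls_deriv ^^ k) Q"
| "dp_fls (DAdd A B) Q x0 = dp_fls A Q x0 + dp_fls B Q x0"
| "dp_fls (DMult A B) Q x0 = dp_fls A Q x0 * dp_fls B Q x0"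

lemma deriv_jet_laurent:
  assumes "(\<lambda>w. q (x0 + w)) has_laurent_expansion Q"
  shows "(\<lambda>w. (deriv ^^ k) q (x0 + w)) has_laurent_expansion (fls_deriv ^^ k) Q"
proof (induction k)
  case (Suc k)
  have "deriv (\<lambda>w. (deriv ^^ k) q (x0 + w)) = (\<lambda>w. deriv ((deriv ^^ k) q) (x0 + w))"
  proof
    fix w show "deriv (\<lambda>w. (deriv ^^ k) q (x0 + w)) w = deriv ((deriv ^^ k) q) (x0 + w)"
    using deriv_shift_0[of "(deriv ^^ k) q" "x0 + w"] deriv_shift_0[of "\<lambda>w. (deriv ^^ k) q (x0 + w)" w]
    by (simp add: o_def add_ac)
  qed
  with has_laurent_expansion_deriv[OF Suc] show ?case by simp
qed (use assms in simp)

lemma dp_laurent: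
  assumes "(\<lambda>w. q (x0 + w)) has_laurent_expansion Q"
  shows "(\<lambda>w. dp_eval A q (x0 + w)) has_laurent_expansion dp_fls A Q x0"
  by (induction A) (auto intro!: laurent_expansion_intros deriv_jet_laurent assms)

lemma dp_holds_iff:
  assumes "open D" and "\<And>x0. x0 \<in> D \<Longrightarrow> (\<lambda>w. q (x0 + w)) has_laurent_expansion Q x0"
  shows "dp_holds D A q \<longleftrightarrow> (\<forall>x0\<in>D. dp_fls A (Q x0) x0 = 0)"
  unfolding dp_holds_def eventually_cosparse_open_eq[OF assms(1)]
  using laurent_zero_iff[OF dp_laurent[OF assms(2)]] by blast

primrec dpow :: "diff_poly \<Rightarrow> nat \<Rightarrow> diff_poly" where
  "dpow A 0 = DConst 1"
| "dpow A (Suc n) = DMult A (dpow A n)"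

lemma dp_eval_dpow [simp]: "dp_eval (dpow A n) q x = dp_eval A q x ^ n"
  by (induction n) simp_all

lemma dp_fls_dpow [simp]: "dp_fls (dpow A n) Q x0 = dp_fls A Q x0 ^ n"
  by (induction n) simp_all

lemma dp_eval_meromorphic:
  assumes "q meromorphic_on D"
  shows "dp_eval A q meromorphic_on D"
  unfolding meromorphic_on_def
proof
  fix x0 assume "x0 \<in> D"
  then obtain Q where "(\<lambda>w. q (x0 + w)) has_laurent_expansion Q"
    using assms unfolding meromorphic_on_def by blast
  then show "\<exists>F. (\<lambda>w. dp_eval A q (x0 + w)) has_laurent_expansion F"
    using dp_laurent by blast
qed

section \<open>The coefficients of the transformed system\<close>

notation DAdd (infixl "\<boxplus>" 65)
notation DMult (infixl "\<boxtimes>" 70)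

abbreviation "dq \<equiv> DJet 0"
abbreviation "dR \<equiv> DVar \<boxtimes> DJet 1 \<boxplus> dq"

text \<open>The coefficient C cleared of its denominator: 4 q^4 C = 4 \<eta>^2 x^2 q^4 - R^2, where
  r = R / q^2 and R = (x q)'.\<close>

definition dT :: "complex \<Rightarrow> diff_poly" where
  "dT \<eta> = DConst 4 \<boxtimes> dpow (DConst \<eta>) 2 \<boxtimes> dpow DVar 2 \<boxtimes> dpow dq 4 \<boxplus> DConst (- 1) \<boxtimes> dpow dR 2"

text \<open>Rows are the powers of \<open>y\<close>, columns those of \<open>z\<close>.\<close>

definition num_y :: "complex \<Rightarrow> complex \<Rightarrow> diff_poly list list" where
  "num_y \<eta> \<kappa> =
    [[dpow dq 2 \<boxtimes> dT \<eta> \<boxplus> DConst (- 8) \<boxtimes> DConst \<kappa> \<boxtimes> DVar \<boxtimes> dpow dq 3,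
      DConst 2 \<boxtimes> dq \<boxtimes> dT \<eta> \<boxplus> DConst (- 4) \<boxtimes> DConst \<kappa> \<boxtimes> DVar \<boxtimes> dpow dq 2,
      dT \<eta>],
     map ((\<boxtimes>) (DConst (- 4) \<boxtimes> dpow dq 2))
      [dpow dq 2 \<boxtimes> (DConst 4 \<boxtimes> dR \<boxtimes> dq \<boxplus> DConst (- 2) \<boxtimes> dpow dq 2),
       DConst 2 \<boxtimes> dq \<boxtimes> (DConst 4 \<boxtimes> dR \<boxtimes> dq \<boxplus> DConst (- 2) \<boxtimes> dpow dq 2) \<boxplus> DConst 3 \<boxtimes> dpow dq 2 \<boxtimes> dR,
       DConst 4 \<boxtimes> dR \<boxtimes> dq \<boxplus> DConst (- 2) \<boxtimes> dpow dq 2 \<boxplus> DConst 6 \<boxtimes> dq \<boxtimes> dR,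
       DConst 3 \<boxtimes> dR],
     map ((\<boxtimes>) (DConst (- 16) \<boxtimes> dpow dq 4))
      [dpow dq 4, DConst 5 \<boxtimes> dpow dq 3, DConst 9 \<boxtimes> dpow dq 2, DConst 7 \<boxtimes> dq, DConst 2]]"

definition den_y :: "diff_poly list list" where
  "den_y =
    [[DConst 4 \<boxtimes> DVar \<boxtimes> dpow dq 6, DConst 8 \<boxtimes> DVar \<boxtimes> dpow dq 5, DConst 4 \<boxtimes> DVar \<boxtimes> dpow dq 4]]"

definition num_z :: "diff_poly list list" where
  "num_z =
    [[DConst 0, DConst 2 \<boxtimes> dq \<boxtimes> dR \<boxplus> DConst (- 1) \<boxtimes> dpow dq 2, dR],
     map ((\<boxtimes>) (DConst 4 \<boxtimes> dpow dq 2)) [DConst 0, dpow dq 2, DConst 2 \<boxtimes> dq, DConst 1]]"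

definition den_z :: "diff_poly list list" where
  "den_z =
    [[DVar \<boxtimes> dpow dq 2]]"

text \<open>Entries outside the ragged table are zero, so all tables can be read with the common
  bound 4 on both exponents.\<close>

definition ent :: "diff_poly list list \<Rightarrow> nat \<Rightarrow> nat \<Rightarrow> diff_poly" where
  "ent T i j = (if i < length T \<and> j < length (T ! i) then T ! i ! j else DConst 0)"

text \<open>\<open>R\<close> stands for \<open>(x q)'\<close>.\<close>

definition NY :: "'k::field \<Rightarrow> 'k \<Rightarrow> 'k \<Rightarrow> 'k \<Rightarrow> 'k \<Rightarrow> 'k \<Rightarrow> 'k \<Rightarrow> 'k" where
  "NY \<eta> \<kappa> x q R y z = - 16 * q ^ 4 * y\<^sup>2 * (z + q) ^ 3 * (2 * z + q)
     - 4 * y * (z + q)\<^sup>2 * q\<^sup>2 * (R * (3 * z + 4 * q) - 2 * q\<^sup>2)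
     + (z + q)\<^sup>2 * (4 * \<eta>\<^sup>2 * x\<^sup>2 * q ^ 4 - R\<^sup>2) - 4 * \<kappa> * x * q\<^sup>2 * (2 * q + z)"

definition NZ :: "'k::field \<Rightarrow> 'k \<Rightarrow> 'k \<Rightarrow> 'k \<Rightarrow> 'k" where
  "NZ q R y z = 4 * q\<^sup>2 * y * z * (z + q)\<^sup>2 + z * (R * (z + 2 * q) - q\<^sup>2)"

lemma bipoly_4:
  "bipoly 4 c y z =
     c 0 0 + c 0 1 * z + c 0 2 * z ^ 2 + c 0 3 * z ^ 3 + c 0 4 * z ^ 4
   + (c 1 0 + c 1 1 * z + c 1 2 * z ^ 2 + c 1 3 * z ^ 3 + c 1 4 * z ^ 4) * y
   + (c 2 0 + c 2 1 * z + c 2 2 * z ^ 2 + c 2 3 * z ^ 3 + c 2 4 * z ^ 4) * y ^ 2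
   + (c 3 0 + c 3 1 * z + c 3 2 * z ^ 2 + c 3 3 * z ^ 3 + c 3 4 * z ^ 4) * y ^ 3
   + (c 4 0 + c 4 1 * z + c 4 2 * z ^ 2 + c 4 3 * z ^ 3 + c 4 4 * z ^ 4) * y ^ 4"
  for c :: "nat \<Rightarrow> nat \<Rightarrow> 'k::comm_semiring_1"
proof -
  have "{..4::nat} = {0, 1, 2, 3, 4}" by auto
  then show ?thesis unfolding bipoly_def by (simp add: algebra_simps)
qed

lemma num_y_eval:
  "bipoly 4 (\<lambda>i j. dp_eval (ent (num_y \<eta> \<kappa>) i j) q x) y z = NY \<eta> \<kappa> x (q x) (x * deriv q x + q x) y z"
  unfolding bipoly_4 NY_def num_y_def ent_def dT_def by simp algebra

lemma num_y_fls:
  "bipoly 4 (\<lambda>i j. dp_fls (ent (num_y \<eta> \<kappa>) i j) Q x0) y z =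
     NY (fls_const \<eta>) (fls_const \<kappa>) (fls_const x0 + fls_X) Q ((fls_const x0 + fls_X) * fls_deriv Q + Q) y z"
  unfolding bipoly_4 NY_def num_y_def ent_def dT_def by simp algebra

lemma den_y_eval:
  "bipoly 4 (\<lambda>i j. dp_eval (ent den_y i j) q x) y z = 4 * x * (q x) ^ 4 * (z + q x)\<^sup>2"
  unfolding bipoly_4 den_y_def ent_def by simp algebra

lemma den_y_fls:
  "bipoly 4 (\<lambda>i j. dp_fls (ent den_y i j) Q x0) y z = 4 * (fls_const x0 + fls_X) * Q ^ 4 * (z + Q)\<^sup>2"
  unfolding bipoly_4 den_y_def ent_def by simp algebra

lemma num_z_eval:
  "bipoly 4 (\<lambda>i j. dp_eval (ent num_z i j) q x) y z = NZ (q x) (x * deriv q x + q x) y z"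
  unfolding bipoly_4 NZ_def num_z_def ent_def by simp algebra

lemma num_z_fls:
  "bipoly 4 (\<lambda>i j. dp_fls (ent num_z i j) Q x0) y z = NZ Q ((fls_const x0 + fls_X) * fls_deriv Q + Q) y z"
  unfolding bipoly_4 NZ_def num_z_def ent_def by simp algebra

lemma den_z_eval: "bipoly 4 (\<lambda>i j. dp_eval (ent den_z i j) q x) y z = x * (q x)\<^sup>2"
  unfolding bipoly_4 den_z_def ent_def by simp

lemma den_z_fls: "bipoly 4 (\<lambda>i j. dp_fls (ent den_z i j) Q x0) y z = (fls_const x0 + fls_X) * Q\<^sup>2"
  unfolding bipoly_4 den_z_def ent_def by simp

lemma rhs_y_eq:
  assumes "4 * x * q ^ 4 * (z + q)\<^sup>2 \<noteq> 0"
  shows "rhs_y \<eta> \<kappa> q p x y z = NY \<eta> \<kappa> x q (x * p + q) y z / (4 * x * q ^ 4 * (z + q)\<^sup>2)"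
proof -
  have "x \<noteq> 0" "q \<noteq> 0" "q + z \<noteq> 0" using assms by (auto simp: add.commute)
  then show ?thesis
    unfolding rhs_y_def NY_def add.commute[of z q] by (simp add: divide_simps; algebra)
qed

lemma rhs_z_eq:
  assumes "x * q\<^sup>2 \<noteq> 0"
  shows "rhs_z q p x y z = NZ q (x * p + q) y z / (x * q\<^sup>2)"
proof -
  have "x \<noteq> 0" "q \<noteq> 0" using assms by auto
  then show ?thesis
    unfolding rhs_z_def NZ_def by (simp add: divide_simps; algebra)
qed

lemma fst_bg_D7:
  "bipoly 4 (\<lambda>i j. dp_eval (ent den_y i j) q x) y z \<noteq> 0 \<Longrightarrow>
    fst (bg_D7 \<eta> \<kappa> q) x y z = bipoly 4 (\<lambda>i j. dp_eval (ent (num_y \<eta> \<kappa>) i j) q x) y z /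
      bipoly 4 (\<lambda>i j. dp_eval (ent den_y i j) q x) y z"
  unfolding num_y_eval den_y_eval bg_D7_def fst_conv by (rule rhs_y_eq)

lemma snd_bg_D7:
  "bipoly 4 (\<lambda>i j. dp_eval (ent den_z i j) q x) y z \<noteq> 0 \<Longrightarrow>
    snd (bg_D7 \<eta> \<kappa> q) x y z = bipoly 4 (\<lambda>i j. dp_eval (ent num_z i j) q x) y z /
      bipoly 4 (\<lambda>i j. dp_eval (ent den_z i j) q x) y z"
  unfolding num_z_eval den_z_eval bg_D7_def snd_conv by (rule rhs_z_eq)

lemma coefficients_bg:
  assumes "q meromorphic_on D" "open D" "\<forall>\<^sub>\<approx>x\<in>D. q x \<noteq> 0"
  shows "coefficients_from D q (\<lambda>p. fst (bg_D7 \<eta> \<kappa> p))" "coefficients_from D q (\<lambda>p. snd (bg_D7 \<eta> \<kappa> p))"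
proof -
  have x: "\<forall>\<^sub>\<approx>x\<in>D. x \<noteq> 0"
    using assms(2) by (auto simp: eventually_cosparse_open_eq intro: eventually_neq_at_within)
  have nz: "\<forall>\<^sub>\<approx>x\<in>D. dp_eval (ent den_y 0 0) q x \<noteq> 0" "\<forall>\<^sub>\<approx>x\<in>D. dp_eval (ent den_z 0 0) q x \<noteq> 0"
    using x assms(3) by (eventually_elim; simp add: ent_def den_y_def den_z_def)+
  have "\<forall>\<^sub>\<approx>x\<in>D. \<exists>i\<le>4. \<exists>j\<le>4. dp_eval (ent den_y i j) q x \<noteq> 0"
    "\<forall>\<^sub>\<approx>x\<in>D. \<exists>i\<le>4. \<exists>j\<le>4. dp_eval (ent den_z i j) q x \<noteq> 0"
    using nz by (eventually_elim; blast)+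
  note B = this
  show "coefficients_from D q (\<lambda>p. fst (bg_D7 \<eta> \<kappa> p))"
    unfolding coefficients_from_def using fst_bg_D7 B(1) dp_eval_meromorphic[OF assms(1)] by blast
  show "coefficients_from D q (\<lambda>p. snd (bg_D7 \<eta> \<kappa> p))"
    unfolding coefficients_from_def using snd_bg_D7 B(2) dp_eval_meromorphic[OF assms(1)] by blast
qed

section \<open>The regularising condition\<close>

text \<open>If \<open>q\<close> solves the Painleve equation, then \<open>x q q'' + q q' - x q'^2 - 4 \<eta>^2 x q^4 - 4 \<kappa> q = \<alpha> q^3\<close>.
  The condition is that the left-hand side divided by \<open>q^3\<close> is constant.\<close>

definition dE :: "complex \<Rightarrow> complex \<Rightarrow> diff_poly" where
  "dE \<eta> \<kappa> = DVar \<boxtimes> dq \<boxtimes> DJet 2 \<boxplus> dq \<boxtimes> DJet 1 \<boxplus> DConst (- 1) \<boxtimes> DVar \<boxtimes> dpow (DJet 1) 2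
     \<boxplus> DConst (- 4) \<boxtimes> dpow (DConst \<eta>) 2 \<boxtimes> DVar \<boxtimes> dpow dq 4 \<boxplus> DConst (- 4) \<boxtimes> DConst \<kappa> \<boxtimes> dq"

text \<open>The total derivative of \<open>dE\<close>, written out because \<open>diff_poly\<close>
  is pure syntax; \<open>dp_fls_dE'\<close> confirms it.\<close>

definition dE' :: "complex \<Rightarrow> complex \<Rightarrow> diff_poly" where
  "dE' \<eta> \<kappa> = DConst 2 \<boxtimes> dq \<boxtimes> DJet 2 \<boxplus> DConst (- 1) \<boxtimes> DVar \<boxtimes> DJet 1 \<boxtimes> DJet 2 \<boxplus> DVar \<boxtimes> dq \<boxtimes> DJet 3
     \<boxplus> DConst (- 4) \<boxtimes> dpow (DConst \<eta>) 2 \<boxtimes> dpow dq 4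
     \<boxplus> DConst (- 16) \<boxtimes> dpow (DConst \<eta>) 2 \<boxtimes> DVar \<boxtimes> dpow dq 3 \<boxtimes> DJet 1
     \<boxplus> DConst (- 4) \<boxtimes> DConst \<kappa> \<boxtimes> DJet 1"

text \<open>The numerator of the derivative of \<open>dE\<close> / q^3, over the denominator
  q^4.\<close>

definition reg_cond :: "complex \<Rightarrow> complex \<Rightarrow> diff_poly" where
  "reg_cond \<eta> \<kappa> = dE' \<eta> \<kappa> \<boxtimes> dq \<boxplus> DConst (- 3) \<boxtimes> dE \<eta> \<kappa> \<boxtimes> DJet 1"

interpretation fls_derivation: derivation "fls_deriv :: complex fls \<Rightarrow> complex fls"
  by unfold_locales simp_all

lemma dp_fls_dE': "dp_fls (dE' \<eta> \<kappa>) Q x0 = fls_deriv (dp_fls (dE \<eta> \<kappa>) Q x0)"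
  unfolding dE'_def dE_def
  by (simp add: fls_derivation.d_power numeral_2_eq_2 numeral_3_eq_3; algebra)

lemma dp_fls_reg_cond:
  "dp_fls (reg_cond \<eta> \<kappa>) Q x0 =
    fls_deriv (dp_fls (dE \<eta> \<kappa>) Q x0) * Q - 3 * dp_fls (dE \<eta> \<kappa>) Q x0 * fls_deriv Q"
  unfolding reg_cond_def by (simp add: dp_fls_dE')

text \<open>At x0 = 0 the germ of x is the formal variable and not zero, so rescaling by x works at
  the fixed singularity x = 0 as well.\<close>

lemma fls_const_plus_X_nonzero: "fls_const x0 + fls_X \<noteq> (0 :: complex fls)"
proof
  assume "fls_const x0 + fls_X = 0"
  then have "fls_deriv (fls_const x0 + fls_X) = 0" by simp
  then show False by simp
qed

lemma expands_bg:
  assumes "(\<lambda>w. q (x0 + w)) has_laurent_expansion Q" "Q \<noteq> 0"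
  defines "X \<equiv> fls_const x0 + fls_X"
  shows "expands_at x0 (fst (bg_D7 \<eta> \<kappa> q))
      (\<lambda>y z. NY (fls_const \<eta>) (fls_const \<kappa>) X Q (X * fls_deriv Q + Q) y z / (4 * X * Q ^ 4 * (z + Q)\<^sup>2))"
    and "expands_at x0 (snd (bg_D7 \<eta> \<kappa> q)) (\<lambda>y z. NZ Q (X * fls_deriv Q + Q) y z / (X * Q\<^sup>2))"
proof -
  note L = dp_laurent[OF assms(1)]
  \<comment> \<open>The constant entry of each denominator is a numerical multiple of x times a
    power of q, so its series is nonzero.\<close>
  have nz: "dp_fls (ent den_y 0 0) Q x0 \<noteq> 0" "dp_fls (ent den_z 0 0) Q x0 \<noteq> 0"
    using assms(2) fls_const_plus_X_nonzero[of x0]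
    by (simp_all add: ent_def den_y_def den_z_def flip: X_def)
  show "expands_at x0 (fst (bg_D7 \<eta> \<kappa> q))
      (\<lambda>y z. NY (fls_const \<eta>) (fls_const \<kappa>) X Q (X * fls_deriv Q + Q) y z / (4 * X * Q ^ 4 * (z + Q)\<^sup>2))"
    unfolding expands_at_def
    apply (rule exI[of _ 4], rule exI[of _ "\<lambda>i j x. dp_eval (ent (num_y \<eta> \<kappa>) i j) q x"],
        rule exI[of _ "\<lambda>i j x. dp_eval (ent den_y i j) q x"],
        rule exI[of _ "\<lambda>i j. dp_fls (ent (num_y \<eta> \<kappa>) i j) Q x0"],
        rule exI[of _ "\<lambda>i j. dp_fls (ent den_y i j) Q x0"])
    using nz(1) fst_bg_D7 L by (auto simp: num_y_fls den_y_fls X_def)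
  show "expands_at x0 (snd (bg_D7 \<eta> \<kappa> q)) (\<lambda>y z. NZ Q (X * fls_deriv Q + Q) y z / (X * Q\<^sup>2))"
    unfolding expands_at_def
    apply (rule exI[of _ 4], rule exI[of _ "\<lambda>i j x. dp_eval (ent num_z i j) q x"],
        rule exI[of _ "\<lambda>i j x. dp_eval (ent den_z i j) q x"],
        rule exI[of _ "\<lambda>i j. dp_fls (ent num_z i j) Q x0"],
        rule exI[of _ "\<lambda>i j. dp_fls (ent den_z i j) Q x0"])
    using nz(2) snd_bg_D7 L by (auto simp: num_z_fls den_z_fls X_def)
qed

lemma NY_Sys:
  fixes x q R y z :: "'k::field_char_0"
  assumes "x \<noteq> 0" "q \<noteq> 0" "z + q \<noteq> 0"
  shows "x * (NY \<eta> \<kappa> x q R y z / (4 * x * q ^ 4 * (z + q)\<^sup>2)) =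
    (- 4 * y\<^sup>2 * (z + q) ^ 3 * (2 * z + q) - y * (z + q)\<^sup>2 * (R / q\<^sup>2 * (3 * z + 4 * q) - 2)
     + ((\<eta> * x)\<^sup>2 - (R / q\<^sup>2)\<^sup>2 / 4) * (z + q)\<^sup>2 - \<kappa> * x / q\<^sup>2 * (2 * q + z)) / (z + q)\<^sup>2"
  unfolding NY_def using assms by (simp add: divide_simps; algebra)

lemma NZ_Sys:
  fixes x q R y z :: "'k::field_char_0"
  assumes "x \<noteq> 0" "q \<noteq> 0"
  shows "x * (NZ q R y z / (x * q\<^sup>2)) = z * (4 * y * (z + q)\<^sup>2 + R / q\<^sup>2 * (z + 2 * q) - 1)"
  unfolding NZ_def using assms by (simp add: divide_simps; algebra)

lemma regularised_bg_fls:
  fixes Q :: "complex fls" and x0 :: complex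
  assumes Q: "Q \<noteq> 0" and nz: "\<eta> \<noteq> 0" "\<kappa> \<noteq> 0"
  defines "X \<equiv> fls_const x0 + fls_X"
  shows "regularised fls_deriv
     (\<lambda>y z. NY (fls_const \<eta>) (fls_const \<kappa>) X Q (X * fls_deriv Q + Q) y z / (4 * X * Q ^ 4 * (z + Q)\<^sup>2),
      \<lambda>y z. NZ Q (X * fls_deriv Q + Q) y z / (X * Q\<^sup>2)) \<longleftrightarrow> dp_fls (reg_cond \<eta> \<kappa>) Q x0 = 0"
    (is "regularised _ ?S \<longleftrightarrow> _")
proof -
  define H K where HK: "H = fls_const \<eta>" "K = fls_const \<kappa>"
  have HK0: "H \<noteq> 0" "K \<noteq> 0" "fls_deriv H = 0" "fls_deriv K = 0" using nz by (simp_all add: HK)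
  have X: "X \<noteq> 0" "fls_deriv X = 1" using fls_const_plus_X_nonzero by (simp_all add: X_def)
  define R where "R = X * fls_deriv Q + Q"
  define E where "E = dp_fls (dE \<eta> \<kappa>) Q x0"
  have E: "E = X * Q * fls_deriv (fls_deriv Q) + Q * fls_deriv Q - X * (fls_deriv Q)\<^sup>2
      - 4 * H\<^sup>2 * X * Q ^ 4 - 4 * K * Q"
    unfolding E_def dE_def HK by (simp add: numeral_2_eq_2 flip: X_def)
  interpret d7: d7_field "\<lambda>t. X * fls_deriv t" Q "R / Q\<^sup>2" "H * X" "K * X / Q\<^sup>2"
    "(H * X)\<^sup>2 - (R / Q\<^sup>2)\<^sup>2 / 4"
  proof
    show "X * fls_deriv Q = R / Q\<^sup>2 * Q\<^sup>2 - Q" using Q by (simp add: R_def)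
    show "X * fls_deriv (H * X) = H * X" using X HK0 by simp
    show "X * fls_deriv (K * X / Q\<^sup>2) = K * X / Q\<^sup>2 * (3 - 2 * (R / Q\<^sup>2) * Q)"
      using Q X HK0 apply (simp add: fls_derivation.d_divide fls_derivation.d_power R_def divide_simps)
      apply (simp add: algebra_simps power2_eq_square)
      done
  qed (use Q X HK0 in \<open>auto simp: algebra_simps\<close>)
  have veq: "veq (vscale X ?S) d7.Sys"
    unfolding vscale_def d7.Sys_def fst_conv snd_conv R_def[symmetric] HK[symmetric]
    by (rule veqI; rule geqI[of "\<lambda>y z. z + Q"])
      (rule nzpoly_line(1)[OF Q] NY_Sys[OF X(1) Q] NZ_Sys[OF X(1) Q] | assumption)+
  have "regularised fls_deriv ?S \<longleftrightarrow> regularised (\<lambda>t. X * fls_deriv t) (vscale X ?S)"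
    using regularised_vscale[OF X(1)] by blast
  also have "\<dots> \<longleftrightarrow> regularised (\<lambda>t. X * fls_deriv t) d7.Sys"
    using veq by (rule regularised_veq)
  also have "\<dots> \<longleftrightarrow> X * fls_deriv d7.G = d7.G"
    by (rule d7.regularised_Sys)
  finally have reg: "regularised fls_deriv ?S \<longleftrightarrow> X * fls_deriv d7.G = d7.G" .
  have R': "fls_deriv R = 2 * fls_deriv Q + X * fls_deriv (fls_deriv Q)"
    using X(2) by (simp add: R_def)
  \<comment> \<open>The derivation is X d/dx and G = X f with f = E / (4 Q^3), so d G = G means f' =
    0: the quotient E / Q^3 is constant.\<close>
  have G: "d7.G = X * (E / (4 * Q ^ 3))"
  proof -
    have "fls_deriv (R / Q\<^sup>2) = ((2 * fls_deriv Q + X * fls_deriv (fls_deriv Q)) * Q - 2 * R * fls_deriv Q) / Q ^ 3"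
      using Q by (simp add: fls_derivation.d_divide fls_derivation.d_power R' divide_simps; algebra)
    then show ?thesis
      unfolding d7.G_def E using Q X(1) by (simp add: R_def divide_simps; algebra)
  qed
  have "X * fls_deriv (X * (E / (4 * Q ^ 3))) =
      X * (E / (4 * Q ^ 3)) + X\<^sup>2 * ((fls_deriv E * Q - 3 * E * fls_deriv Q) / (4 * Q ^ 4))"
    using Q X(1) by (simp add: fls_derivation.d_divide fls_derivation.d_power X(2) divide_simps; algebra)
  then have "X * fls_deriv d7.G = d7.G \<longleftrightarrow> fls_deriv E * Q - 3 * E * fls_deriv Q = 0"
    unfolding G using Q X(1) by simp
  then show ?thesis by (simp add: reg dp_fls_reg_cond E_def)
qed

lemma regularised_on_bg:
  assumes "admissible D q" and nz: "\<eta> \<noteq> 0" "\<kappa> \<noteq> 0"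
  shows "regularised_on D (bg_D7 \<eta> \<kappa> q) \<longleftrightarrow> dp_holds D (reg_cond \<eta> \<kappa>) q"
proof -
  have D: "open D" and q: "q meromorphic_on D" and q0: "\<forall>\<^sub>\<approx>x\<in>D. q x \<noteq> 0"
    using assms(1) by (auto simp: admissible_def domain_in_C_def)
  from q obtain Q where Q: "\<And>x0. x0 \<in> D \<Longrightarrow> (\<lambda>w. q (x0 + w)) has_laurent_expansion Q x0"
    unfolding meromorphic_on_def by metis
  have Q0: "Q x0 \<noteq> 0" if "x0 \<in> D" for x0
    using q0 that has_laurent_expansion_eventually_nonzero_iff[OF Q[OF that]]
    by (auto simp: eventually_cosparse_open_eq[OF D])
  have "(\<exists>f g. expands_at x0 (fst (bg_D7 \<eta> \<kappa> q)) f \<and> expands_at x0 (snd (bg_D7 \<eta> \<kappa> q)) g \<and>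
      regularised fls_deriv (f, g)) \<longleftrightarrow> dp_fls (reg_cond \<eta> \<kappa>) (Q x0) x0 = 0" if x0: "x0 \<in> D" for x0
  proof -
    note e = expands_bg[OF Q[OF x0] Q0[OF x0], of \<eta> \<kappa>]
    note r = regularised_bg_fls[OF Q0[OF x0] nz, of x0]
    show ?thesis
    proof
      assume "\<exists>f g. expands_at x0 (fst (bg_D7 \<eta> \<kappa> q)) f \<and> expands_at x0 (snd (bg_D7 \<eta> \<kappa> q)) g \<and>
        regularised fls_deriv (f, g)"
      then obtain f g where fg: "expands_at x0 (fst (bg_D7 \<eta> \<kappa> q)) f"
        "expands_at x0 (snd (bg_D7 \<eta> \<kappa> q)) g" "regularised fls_deriv (f, g)" by blast
      from regularised_veq[OF veqI[OF expands_at_unique[OF fg(1) e(1)] expands_at_unique[OF fg(2) e(2)]]] fg(3) r show "dp_fls (reg_cond \<eta> \<kappa>) (Q x0) x0 = 0" by blast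
    next
      assume "dp_fls (reg_cond \<eta> \<kappa>) (Q x0) x0 = 0"
      with e r show "\<exists>f g. expands_at x0 (fst (bg_D7 \<eta> \<kappa> q)) f \<and> expands_at x0 (snd (bg_D7 \<eta> \<kappa> q)) g \<and>
        regularised fls_deriv (f, g)" by blast
    qed
  qed
  then show ?thesis
    unfolding regularised_on_def using dp_holds_iff[OF D Q] by blast
qed

lemma regularising_conditions_bg:
  assumes nz: "\<eta> \<noteq> 0" "\<kappa> \<noteq> 0"
  shows "regularising_conditions (bg_D7 \<eta> \<kappa>) {reg_cond \<eta> \<kappa>}"
proof -
  have "admissible UNIV (\<lambda>x. 1)"
    by (auto simp: admissible_def domain_in_C_def intro: meromorphic_intros)
  \<comment> \<open>For q = 1 all derivatives vanish and the condition reduces to - 4 \<eta>^2 = 0,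
    which is false.\<close>
  moreover have "\<not> dp_holds UNIV (reg_cond \<eta> \<kappa>) (\<lambda>x. 1)"
  proof -
    have "deriv (\<lambda>x. 1 :: complex) = (\<lambda>x. 0)" "deriv (\<lambda>x. 0 :: complex) = (\<lambda>x. 0)"
      by (simp_all add: fun_eq_iff)
    then have "dp_eval (reg_cond \<eta> \<kappa>) (\<lambda>x. 1) x = - 4 * \<eta>\<^sup>2" for x
      by (simp add: reg_cond_def dE_def dE'_def numeral_2_eq_2 numeral_3_eq_3 power2_eq_square)
    then show ?thesis using nz by (simp add: dp_holds_def)
  qed
  ultimately show ?thesis
    unfolding regularising_conditions_def using regularised_on_bg[OF _ nz] by blast
qed

lemma PIII_reg_cond:
  assumes D: "domain_in_C D" and q: "solves_PIII \<alpha> (4 * \<kappa>) (4 * \<eta>\<^sup>2) 0 D q"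
  shows "dp_holds D (reg_cond \<eta> \<kappa>) q"
proof -
  have oD: "open D" using D by (simp add: domain_in_C_def)
  have mq: "q meromorphic_on D" using q by (simp add: solves_PIII_def)
  then obtain Q where Q: "\<And>x0. x0 \<in> D \<Longrightarrow> (\<lambda>w. q (x0 + w)) has_laurent_expansion Q x0"
    unfolding meromorphic_on_def by metis
  have "dp_fls (reg_cond \<eta> \<kappa>) (Q x0) x0 = 0" if x0: "x0 \<in> D" for x0
  proof -
    \<comment> \<open>The Painleve equation multiplied by x q reads \<open>dE\<close> = \<alpha>
      q^3; differentiating q^3 then gives the condition.\<close>
    let ?A = "dE \<eta> \<kappa> \<boxplus> DConst (- \<alpha>) \<boxtimes> dpow dq 3"
    have "\<forall>\<^sub>F x in at x0. dp_eval ?A q x = 0"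
    proof -
      have "\<forall>\<^sub>F x in at x0. q x \<noteq> 0 \<and> deriv (deriv q) x = (deriv q x)\<^sup>2 / q x - deriv q x / x
          + (\<alpha> * (q x)\<^sup>2 + 4 * \<kappa>) / x + 4 * \<eta>\<^sup>2 * (q x) ^ 3 + 0 / q x"
        using q x0 oD by (auto simp: solves_PIII_def eventually_cosparse_open_eq)
      moreover have "\<forall>\<^sub>F x in at x0. x \<noteq> 0" by (rule eventually_neq_at_within)
      ultimately show ?thesis
      proof eventually_elim
        case (elim x)
        define a b c where abc: "a = q x" "b = deriv q x" "c = deriv (deriv q) x"
        have nz: "a \<noteq> 0" "x \<noteq> 0" using elim by (simp_all add: abc)
        have "x * a * c = x * a * (b\<^sup>2 / a - b / x + (\<alpha> * a\<^sup>2 + 4 * \<kappa>) / x + 4 * \<eta>\<^sup>2 * a ^ 3)"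
          using elim by (simp add: abc)
        also have "\<dots> = x * b\<^sup>2 - a * b + (\<alpha> * a ^ 3 + 4 * \<kappa> * a) + 4 * \<eta>\<^sup>2 * x * a ^ 4"
          using nz by (simp add: divide_simps; algebra)
        finally have "x * a * c = x * b\<^sup>2 - a * b + (\<alpha> * a ^ 3 + 4 * \<kappa> * a) + 4 * \<eta>\<^sup>2 * x * a ^ 4" .
        moreover have "dp_eval ?A q x = x * a * c + a * b - x * b\<^sup>2 - 4 * \<eta>\<^sup>2 * x * a ^ 4 - 4 * \<kappa> * a - \<alpha> * a ^ 3"
          by (simp add: dE_def abc numeral_2_eq_2)
        ultimately show ?case by simp
      qed
    qed
    then have "dp_fls ?A (Q x0) x0 = 0"
      using laurent_zero_iff[OF dp_laurent[OF Q[OF x0]]] by blast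
    then have E: "dp_fls (dE \<eta> \<kappa>) (Q x0) x0 = fls_const \<alpha> * Q x0 ^ 3" by simp
    show ?thesis
      unfolding dp_fls_reg_cond E by (simp add: fls_derivation.d_power power2_eq_square power3_eq_cube)
  qed
  then show ?thesis using dp_holds_iff[OF oD Q] by blast
qed

section \<open>The transformation between the two systems\<close>

text \<open>The value of z3 that the first Hamilton equation forces when y3 = q. The pair (q,
  \<open>shift_z3\<close>) is thus the Hamiltonian solution belonging to q, and the transformation
  measures other solutions from it.\<close>

definition shift_z3 :: "complex \<Rightarrow> (complex \<Rightarrow> complex) \<Rightarrow> complex \<Rightarrow> complex" where
  "shift_z3 \<eta> q t = t * \<eta> / 2 + t * deriv q t / (4 * (q t)\<^sup>2) + 1 / (4 * q t)"

definition PIII_regular_point ::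
  "complex \<Rightarrow> complex \<Rightarrow> complex \<Rightarrow> complex \<Rightarrow> (complex \<Rightarrow> complex) \<Rightarrow> complex \<Rightarrow> bool" where
  "PIII_regular_point \<alpha> \<beta> \<gamma> \<delta> q t \<longleftrightarrow> t \<noteq> 0 \<and> q analytic_on {t} \<and> q t \<noteq> 0 \<and>
     deriv (deriv q) t = (deriv q t)\<^sup>2 / q t - deriv q t / t
          + (\<alpha> * (q t)\<^sup>2 + \<beta>) / t + \<gamma> * (q t) ^ 3 + \<delta> / q t"

lemma eventually_at_nhds:
  fixes x :: "'a::t1_space"
  assumes "eventually P (at x)"
  shows "eventually (\<lambda>t. eventually P (nhds t)) (at x)"
proof -
  from assms obtain S where S: "open S" "x \<in> S" "\<And>t. t \<in> S \<Longrightarrow> t \<noteq> x \<Longrightarrow> P t"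
    unfolding eventually_at_topological by blast
  have "eventually P (nhds t)" if "t \<in> S" "t \<noteq> x" for t
    using S that unfolding eventually_nhds by (intro exI[of _ "S - {x}"]) auto
  then show ?thesis
    unfolding eventually_at_topological using S(1,2) by blast
qed

text \<open>A condition off a sparse set holds in a punctured neighbourhood of each point, hence in
  a full neighbourhood of almost every point. The latter is what \<open>solution_near\<close> asks
  for, as it speaks of nearby times.\<close>

lemma PIII_regular_points:
  assumes "solves_PIII \<alpha> \<beta> \<gamma> \<delta> D q" "open D"
  shows "\<forall>\<^sub>\<approx>x\<in>D. \<forall>\<^sub>F t in nhds x. PIII_regular_point \<alpha> \<beta> \<gamma> \<delta> q t"
proof -
  have "\<forall>\<^sub>\<approx>x\<in>D. x \<noteq> 0"
    using assms(2) by (auto simp: eventually_cosparse_open_eq intro: eventually_neq_at_within)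
  moreover have "\<forall>\<^sub>\<approx>x\<in>D. q analytic_on {x}"
    by (rule meromorphic_on_imp_analytic_cosparse) (use assms in \<open>simp add: solves_PIII_def\<close>)
  moreover note assms(1)[unfolded solves_PIII_def, THEN conjunct2]
  ultimately have "\<forall>\<^sub>\<approx>x\<in>D. PIII_regular_point \<alpha> \<beta> \<gamma> \<delta> q x"
    by eventually_elim (simp add: PIII_regular_point_def)
  then show ?thesis
    unfolding eventually_cosparse_open_eq[OF assms(2)] by (blast intro: eventually_at_nhds)
qed

lemma hamiltonian_H_D7:
  "fst (hamiltonian_system (H_D7 \<eta> \<kappa> \<kappa>i)) x y z = (4 * y\<^sup>2 * z - (2 * \<eta> * x * y\<^sup>2 + y)) / x"
  "y \<noteq> 0 \<Longrightarrow> snd (hamiltonian_system (H_D7 \<eta> \<kappa> \<kappa>i)) x y z =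
     - ((4 * y * z\<^sup>2 + \<eta> * \<kappa>i * x - \<kappa> * x / y\<^sup>2 - z * (4 * \<eta> * x * y + 1)) / x)"
proof -
  have "((\<lambda>w. H_D7 \<eta> \<kappa> \<kappa>i y w x) has_field_derivative
      1 / x * (2 * y\<^sup>2 * (2 * z) - (2 * \<eta> * x * y\<^sup>2 + y))) (at z)"
    unfolding H_D7_def by (cases "x = 0") (auto intro!: derivative_eq_intros)
  moreover have "1 / x * (2 * y\<^sup>2 * (2 * z) - (2 * \<eta> * x * y\<^sup>2 + y)) = (4 * y\<^sup>2 * z - (2 * \<eta> * x * y\<^sup>2 + y)) / x"
    by (cases "x = 0") simp_all
  ultimately show "fst (hamiltonian_system (H_D7 \<eta> \<kappa> \<kappa>i)) x y z = (4 * y\<^sup>2 * z - (2 * \<eta> * x * y\<^sup>2 + y)) / x"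
    by (simp only: hamiltonian_system_def fst_conv DERIV_imp_deriv)
  assume y: "y \<noteq> 0"
  have "((\<lambda>w. H_D7 \<eta> \<kappa> \<kappa>i w z x) has_field_derivative
      1 / x * (2 * (2 * y) * z\<^sup>2 + \<eta> * \<kappa>i * x - \<kappa> * x / y\<^sup>2 - z * (2 * \<eta> * x * (2 * y) + 1))) (at y)"
    unfolding H_D7_def
    by (rule derivative_eq_intros refl y | (simp add: y power2_eq_square divide_simps; fail))+
  moreover have "1 / x * (2 * (2 * y) * z\<^sup>2 + \<eta> * \<kappa>i * x - \<kappa> * x / y\<^sup>2 - z * (2 * \<eta> * x * (2 * y) + 1))
      = (4 * y * z\<^sup>2 + \<eta> * \<kappa>i * x - \<kappa> * x / y\<^sup>2 - z * (4 * \<eta> * x * y + 1)) / x"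
    by (simp add: mult_ac)
  ultimately show "snd (hamiltonian_system (H_D7 \<eta> \<kappa> \<kappa>i)) x y z =
     - ((4 * y * z\<^sup>2 + \<eta> * \<kappa>i * x - \<kappa> * x / y\<^sup>2 - z * (4 * \<eta> * x * y + 1)) / x)"
    by (simp only: hamiltonian_system_def snd_conv DERIV_imp_deriv)
qed

text \<open>An identity in p; at z = 0 it is the equation that defines the shift of z3.\<close>

lemma transformation_z:
  fixes x q :: complex
  assumes "x \<noteq> 0" "q \<noteq> 0"
  shows "(4 * (z + q)\<^sup>2 * (y * z + (x * \<eta> / 2 + x * p / (4 * q\<^sup>2) + 1 / (4 * q)))
      - (2 * \<eta> * x * (z + q)\<^sup>2 + (z + q))) / x = rhs_z q p x y z + p"
  unfolding rhs_z_def using assms by (simp add: divide_simps; algebra)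

text \<open>Here q'' is replaced by means of the Painleve equation. Its \<alpha> contributes
  \<alpha> / 4 = - \<kappa>i \<eta>, which matches the term - \<eta> \<kappa>i of the Hamiltonian;
  this is why \<kappa>i disappears from the transformed system.\<close>

lemma transformation_y:
  fixes x q s :: complex
  assumes "x \<noteq> 0" "q \<noteq> 0" "q + z \<noteq> 0"
    and w: "w = x * \<eta> / 2 + x * p / (4 * q\<^sup>2) + 1 / (4 * q)"
    and c: "c = p\<^sup>2 / q - p / x + (- 4 * \<kappa>i * \<eta> * q\<^sup>2 + 4 * \<kappa>) / x + 4 * \<eta>\<^sup>2 * q ^ 3 + 0 / q"
  shows "- ((4 * (z + q) * (y * z + w)\<^sup>2 + \<eta> * \<kappa>i * x - \<kappa> * x / (z + q)\<^sup>2 - (y * z + w) * (4 * \<eta> * x * (z + q) + 1)) / x)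
      = rhs_y \<eta> \<kappa> q p x y z * z + y * rhs_z q p x y z
        + (\<eta> / 2 + (p + x * c) / (4 * q\<^sup>2) - x * p\<^sup>2 / (2 * q ^ 3) - p / (4 * q\<^sup>2))"
  unfolding rhs_z_def rhs_y_def w c add.commute[of z q] using assms(1-3) by (simp add: divide_simps; algebra)

lemma shift_z3_deriv:
  assumes "q analytic_on {t}" "q t \<noteq> 0"
  shows "(shift_z3 \<eta> q has_field_derivative
    (\<eta> / 2 + (deriv q t + t * deriv (deriv q) t) / (4 * (q t)\<^sup>2) - t * (deriv q t)\<^sup>2 / (2 * q t ^ 3)
      - deriv q t / (4 * (q t)\<^sup>2))) (at t)"
proof -
  have "(q has_field_derivative deriv q t) (at t)" "(deriv q has_field_derivative deriv (deriv q) t) (at t)"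
    using assms(1) by (auto intro!: analytic_derivI analytic_intros)
  note [derivative_intros] = this
  show ?thesis
    unfolding shift_z3_def
    by (rule derivative_eq_intros refl | (simp add: assms(2); fail))+
      (use assms(2) in \<open>simp add: divide_simps; algebra\<close>)
qed

text \<open>A derivative at t depends on the germ at t, so the equality is needed near every t close
  to x, and not only at these t.\<close>

lemma solution_near_cong:
  assumes "\<forall>\<^sub>F t in nhds x. y t = y' t \<and> z t = z' t" "solution_near S y z x"
  shows "solution_near S y' z' x"
proof -
  have "\<forall>\<^sub>F t in nhds x. \<forall>\<^sub>F t in nhds t. y t = y' t \<and> z t = z' t"
    using assms(1) by (simp add: eventually_eventually)
  with assms(2) show ?thesis
    unfolding solution_near_def
  proof eventually_elim
    case (elim t)
    have eq: "y t = y' t" "z t = z' t" using eventually_nhds_x_imp_x[OF elim(2)] by auto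
    have "\<forall>\<^sub>F t in nhds t. y t = y' t" "\<forall>\<^sub>F t in nhds t. z t = z' t"
      using elim(2) by (auto elim: eventually_mono)
    from DERIV_cong_ev[OF refl this(1) refl] DERIV_cong_ev[OF refl this(2) refl] elim(1) eq
    show ?case by simp
  qed
qed

lemma solution_near_continuous:
  assumes "solution_near S y z x"
  shows "isCont y x" "isCont z x"
  using eventually_nhds_x_imp_x[OF assms[unfolded solution_near_def]] DERIV_isCont by blast+

lemma isCont_eventually_nonzero:
  fixes f :: "complex \<Rightarrow> complex"
  assumes "isCont f x" "f x \<noteq> 0"
  shows "\<forall>\<^sub>F t in nhds x. f t \<noteq> 0"
  using assms by (auto simp: eventually_nhds_conv_at isCont_def intro: tendsto_imp_eventually_ne)

context
  fixes \<eta> \<kappa> \<kappa>i :: complex and q :: "complex \<Rightarrow> complex" and x :: complex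
  assumes reg: "\<forall>\<^sub>F t in nhds x. PIII_regular_point (- 4 * \<kappa>i * \<eta>) (4 * \<kappa>) (4 * \<eta>\<^sup>2) 0 q t"
begin

lemma q_isCont: "isCont q x"
  using eventually_nhds_x_imp_x[OF reg] analytic_at_imp_isCont by (auto simp: PIII_regular_point_def)

lemma hamiltonian_to_bg:
  assumes sol: "solution_near (hamiltonian_system (H_D7 \<eta> \<kappa> \<kappa>i)) y3 z3 x"
    and nz: "y3 x \<noteq> 0" "y3 x - q x \<noteq> 0"
  shows "solution_near (bg_D7 \<eta> \<kappa> q) (\<lambda>t. (z3 t - shift_z3 \<eta> q t) / (y3 t - q t)) (\<lambda>t. y3 t - q t) x"
proof -
  note cont = solution_near_continuous(1)[OF sol]
  have "\<forall>\<^sub>F t in nhds x. y3 t \<noteq> 0" "\<forall>\<^sub>F t in nhds x. y3 t - q t \<noteq> 0"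
    by (rule isCont_eventually_nonzero[OF cont nz(1)]
        isCont_eventually_nonzero[OF isCont_diff[OF cont q_isCont] nz(2)])+
  with reg sol show ?thesis
    unfolding solution_near_def
  proof eventually_elim
    case (elim t)
    define Z where "Z = y3 t - q t"
    define Y where "Y = (z3 t - shift_z3 \<eta> q t) / Z"
    have Z: "Z \<noteq> 0" "y3 t = Z + q t" using elim by (simp_all add: Z_def)
    have Y: "z3 t = Y * Z + shift_z3 \<eta> q t" using Z by (simp add: Y_def)
    define w' where "w' = \<eta> / 2 + (deriv q t + t * deriv (deriv q) t) / (4 * (q t)\<^sup>2)
        - t * (deriv q t)\<^sup>2 / (2 * q t ^ 3) - deriv q t / (4 * (q t)\<^sup>2)"
    have t: "t \<noteq> 0" "q t \<noteq> 0" "q t + Z \<noteq> 0" and an: "q analytic_on {t}"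
      using elim Z by (simp_all add: PIII_regular_point_def add.commute)
    have dq: "(q has_field_derivative deriv q t) (at t)" using an by (rule analytic_derivI)
    have dw: "(shift_z3 \<eta> q has_field_derivative w') (at t)"
      unfolding w'_def using an t(2) by (rule shift_z3_deriv)
    have y3': "(y3 has_field_derivative rhs_z (q t) (deriv q t) t Y Z + deriv q t) (at t)"
      using elim(2)[THEN conjunct1] unfolding hamiltonian_H_D7 Z(2) Y shift_z3_def transformation_z[OF t(1,2)] .
    have z3': "(z3 has_field_derivative rhs_y \<eta> \<kappa> (q t) (deriv q t) t Y Z * Z + Y * rhs_z (q t) (deriv q t) t Y Z + w') (at t)"
    proof -
      have c: "deriv (deriv q) t = (deriv q t)\<^sup>2 / q t - deriv q t / t + (- 4 * \<kappa>i * \<eta> * (q t)\<^sup>2 + 4 * \<kappa>) / t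
          + 4 * \<eta>\<^sup>2 * (q t) ^ 3 + 0 / q t"
        using elim(1) by (simp add: PIII_regular_point_def)
      note T = transformation_y[OF t shift_z3_def c, of Y]
      show ?thesis
        using elim(2)[THEN conjunct2] unfolding hamiltonian_H_D7(2)[OF elim(3)] unfolding Z(2) Y T w'_def .
    qed
    have "((\<lambda>t. y3 t - q t) has_field_derivative rhs_z (q t) (deriv q t) t Y Z) (at t)"
      using DERIV_diff[OF y3' dq] by simp
    \<comment> \<open>The numerator has derivative Y' Z + Y Z', so the quotient rule leaves Y'
      alone.\<close>
    moreover have "((\<lambda>t. (z3 t - shift_z3 \<eta> q t) / (y3 t - q t)) has_field_derivative
        rhs_y \<eta> \<kappa> (q t) (deriv q t) t Y Z) (at t)"
      using DERIV_divide[OF DERIV_diff[OF z3' dw] DERIV_diff[OF y3' dq]] Z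
      by (simp add: Y field_simps)
    ultimately show ?case
      by (simp add: bg_D7_def Y_def Z_def)
  qed
qed

lemma bg_to_hamiltonian:
  assumes sol: "solution_near (bg_D7 \<eta> \<kappa> q) y z x" and nz: "z x + q x \<noteq> 0"
  shows "solution_near (hamiltonian_system (H_D7 \<eta> \<kappa> \<kappa>i)) (\<lambda>t. z t + q t) (\<lambda>t. y t * z t + shift_z3 \<eta> q t) x"
proof -
  have "\<forall>\<^sub>F t in nhds x. z t + q t \<noteq> 0"
    by (rule isCont_eventually_nonzero[OF isCont_add[OF solution_near_continuous(2)[OF sol] q_isCont] nz])
  with reg sol show ?thesis
    unfolding solution_near_def
  proof eventually_elim
    case (elim t)
    define w' where "w' = \<eta> / 2 + (deriv q t + t * deriv (deriv q) t) / (4 * (q t)\<^sup>2)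
        - t * (deriv q t)\<^sup>2 / (2 * q t ^ 3) - deriv q t / (4 * (q t)\<^sup>2)"
    have t: "t \<noteq> 0" "q t \<noteq> 0" "q t + z t \<noteq> 0" and an: "q analytic_on {t}"
      using elim by (simp_all add: PIII_regular_point_def add.commute)
    have dq: "(q has_field_derivative deriv q t) (at t)" using an by (rule analytic_derivI)
    have dw: "(shift_z3 \<eta> q has_field_derivative w') (at t)"
      unfolding w'_def using an t(2) by (rule shift_z3_deriv)
    have c: "deriv (deriv q) t = (deriv q t)\<^sup>2 / q t - deriv q t / t + (- 4 * \<kappa>i * \<eta> * (q t)\<^sup>2 + 4 * \<kappa>) / t
        + 4 * \<eta>\<^sup>2 * (q t) ^ 3 + 0 / q t"
      using elim(1) by (simp add: PIII_regular_point_def)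
    note T = transformation_y[OF t shift_z3_def c, of "y t"]
    have y': "(y has_field_derivative rhs_y \<eta> \<kappa> (q t) (deriv q t) t (y t) (z t)) (at t)"
      and z': "(z has_field_derivative rhs_z (q t) (deriv q t) t (y t) (z t)) (at t)"
      using elim(2) by (simp_all add: bg_D7_def)
    have "((\<lambda>t. z t + q t) has_field_derivative rhs_z (q t) (deriv q t) t (y t) (z t) + deriv q t) (at t)"
      by (rule DERIV_add[OF z' dq])
    moreover have "((\<lambda>t. y t * z t + shift_z3 \<eta> q t) has_field_derivative
      rhs_y \<eta> \<kappa> (q t) (deriv q t) t (y t) (z t) * z t + y t * rhs_z (q t) (deriv q t) t (y t) (z t) + w') (at t)"
      using DERIV_add[OF DERIV_mult[OF y' z'] dw] by (simp add: mult.commute add.commute)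
    ultimately show ?case
      unfolding hamiltonian_H_D7(1) hamiltonian_H_D7(2)[OF elim(3)] T w'_def[symmetric]
      unfolding shift_z3_def transformation_z[OF t(1,2)] by blast
  qed
qed

end

section \<open>The transformation as a birational map\<close>

lemma bipoly_1: "bipoly 1 c y z = c 0 0 + c 0 1 * z + c 1 0 * y + c 1 1 * y * z"
  for c :: "nat \<Rightarrow> nat \<Rightarrow> 'k::comm_semiring_1"
  by (simp add: bipoly_def add_ac)

lemma rational_yzI:
  assumes "\<And>i j. c i j meromorphic_on D" "\<And>i j. e i j meromorphic_on D"
    "i \<le> n" "j \<le> n" "\<And>x. e i j x \<noteq> 0"
    "\<And>x y z. F x y z = bipoly n (\<lambda>i j. c i j x) y z / bipoly n (\<lambda>i j. e i j x) y z"
  shows "rational_yz D F"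
  unfolding rational_yz_def
  by (rule exI[of _ n], rule exI[of _ c], rule exI[of _ e])
    (use assms in \<open>blast intro: always_eventually\<close>)

lemma genericallyI:
  assumes "\<And>i j. e i j meromorphic_on D" "i \<le> n" "j \<le> n" "\<And>x. e i j x \<noteq> 0"
    "\<forall>\<^sub>\<approx>x\<in>D. \<forall>y z. bipoly n (\<lambda>i j. e i j x) y z \<noteq> 0 \<longrightarrow> \<Phi> x y z"
  shows "generically D \<Phi>"
  unfolding generically_def
  by (rule exI[of _ n], rule exI[of _ e])
    (use assms in \<open>blast intro: eventually_mono\<close>)

lemma birationally_equivalent_bg:
  assumes D: "open D" and q: "solves_PIII (- 4 * \<kappa>i * \<eta>) (4 * \<kappa>) (4 * \<eta>\<^sup>2) 0 D q"
  shows "birationally_equivalent D (hamiltonian_system (H_D7 \<eta> \<kappa> \<kappa>i)) (bg_D7 \<eta> \<kappa> q)"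
proof -
  let ?w = "shift_z3 \<eta> q"
  have mq: "q meromorphic_on D" using q by (simp add: solves_PIII_def)
  have mw: "?w meromorphic_on D"
    unfolding shift_z3_def using mq by (intro meromorphic_intros) auto
  note pts = PIII_regular_points[OF q D]
  \<comment> \<open>F and G solve the transformation for the new coordinates; F' and G' are the
    transformation itself.\<close>
  define F G F' G' where
    "F x y z = (z - ?w x) / (y - q x)" and "G x y (z::complex) = y - q x" and
    "F' x (y::complex) z = z + q x" and "G' x y z = y * z + ?w x" for x y z
  \<comment> \<open>Coefficient tables: \<open>eF\<close> is y - q, \<open>e1\<close> is 1,
    \<open>ez\<close> is z, \<open>cF\<close> is z minus the shift, \<open>cF'\<close> is z + q,
    \<open>cG'\<close> is y z plus the shift, \<open>e2\<close> is y (y - q). They serve as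
    numerators, denominators and equations of excluded curves.\<close>
  define eF where "eF i j = (if j = 0 \<and> i = 0 then (\<lambda>x. - q x) else if j = 0 \<and> i = 1 then (\<lambda>x. 1) else (\<lambda>x. 0))" for i j :: nat
  define e1 :: "nat \<Rightarrow> nat \<Rightarrow> complex \<Rightarrow> complex" where "e1 i j = (if i = 0 \<and> j = 0 then (\<lambda>x. 1) else (\<lambda>x. 0))" for i j
  define ez :: "nat \<Rightarrow> nat \<Rightarrow> complex \<Rightarrow> complex" where "ez i j = (if i = 0 \<and> j = 1 then (\<lambda>x. 1) else (\<lambda>x. 0))" for i j
  define cF where "cF i j = (if i = 0 \<and> j = 0 then (\<lambda>x. - ?w x) else if i = 0 \<and> j = 1 then (\<lambda>x. 1) else (\<lambda>x. 0))" for i j :: nat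
  define cF' where "cF' i j = (if i = 0 \<and> j = 0 then q else if i = 0 \<and> j = 1 then (\<lambda>x. 1) else (\<lambda>x. 0))" for i j :: nat
  define cG' where "cG' i j = (if i = 0 \<and> j = 0 then ?w else if i = 1 \<and> j = 1 then (\<lambda>x. 1) else (\<lambda>x. 0))" for i j :: nat
  define e2 where "e2 i j = (if j = 0 \<and> i = 1 then (\<lambda>x. - q x) else if j = 0 \<and> i = 2 then (\<lambda>x. 1) else (\<lambda>x. 0))" for i j :: nat
  have mer: "eF i j meromorphic_on D" "e1 i j meromorphic_on D" "ez i j meromorphic_on D"
    "cF i j meromorphic_on D" "cF' i j meromorphic_on D" "cG' i j meromorphic_on D"
    "e2 i j meromorphic_on D" for i j
    unfolding eF_def e1_def ez_def cF_def cF'_def cG'_def e2_def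
    by (auto split: if_splits intro: mq mw meromorphic_on_uminus)
  have b2: "bipoly 2 (\<lambda>i j. e2 i j x) y z = y * (y - q x)" for x y z
  proof -
    have "{..2::nat} = {0, 1, 2}" by auto
    then show ?thesis by (simp add: bipoly_def e2_def algebra_simps power2_eq_square)
  qed
  have "rational_yz D F"
  proof (rule rational_yzI[where c = cF and e = eF and n = 1 and i = 1 and j = 0])
    show "F x y z = bipoly 1 (\<lambda>i j. cF i j x) y z / bipoly 1 (\<lambda>i j. eF i j x) y z" for x y z
      unfolding bipoly_1 by (simp add: F_def cF_def eF_def)
  qed (rule mer | simp add: eF_def)+
  moreover have "rational_yz D G"
  proof (rule rational_yzI[where c = eF and e = e1 and n = 1 and i = 0 and j = 0])
    show "G x y z = bipoly 1 (\<lambda>i j. eF i j x) y z / bipoly 1 (\<lambda>i j. e1 i j x) y z" for x y z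
      unfolding bipoly_1 by (simp add: G_def e1_def eF_def)
  qed (rule mer | simp add: e1_def)+
  moreover have "rational_yz D F'"
  proof (rule rational_yzI[where c = cF' and e = e1 and n = 1 and i = 0 and j = 0])
    show "F' x y z = bipoly 1 (\<lambda>i j. cF' i j x) y z / bipoly 1 (\<lambda>i j. e1 i j x) y z" for x y z
      unfolding bipoly_1 by (simp add: F'_def e1_def cF'_def)
  qed (rule mer | simp add: e1_def)+
  moreover have "rational_yz D G'"
  proof (rule rational_yzI[where c = cG' and e = e1 and n = 1 and i = 0 and j = 0])
    show "G' x y z = bipoly 1 (\<lambda>i j. cG' i j x) y z / bipoly 1 (\<lambda>i j. e1 i j x) y z" for x y z
      unfolding bipoly_1 by (simp add: G'_def e1_def cG'_def)
  qed (rule mer | simp add: e1_def)+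
  moreover have "generically D (\<lambda>x y z. F' x (F x y z) (G x y z) = y \<and> G' x (F x y z) (G x y z) = z)"
  proof (rule genericallyI[where e = eF and n = 1 and i = 1 and j = 0])
    have "bipoly 1 (\<lambda>i j. eF i j x) y z = y - q x" for x y z
      unfolding bipoly_1 by (simp add: eF_def)
    then show "\<forall>\<^sub>\<approx>x\<in>D. \<forall>y z. bipoly 1 (\<lambda>i j. eF i j x) y z \<noteq> 0 \<longrightarrow>
        F' x (F x y z) (G x y z) = y \<and> G' x (F x y z) (G x y z) = z"
      by (simp only: F_def G_def F'_def G'_def) (auto intro!: always_eventually)
  qed (rule mer | simp add: eF_def)+
  moreover have "generically D (\<lambda>x y z. F x (F' x y z) (G' x y z) = y \<and> G x (F' x y z) (G' x y z) = z)"
  proof (rule genericallyI[where e = ez and n = 1 and i = 0 and j = 1])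
    have "bipoly 1 (\<lambda>i j. ez i j x) y z = z" for x y z
      unfolding bipoly_1 by (simp add: ez_def)
    then show "\<forall>\<^sub>\<approx>x\<in>D. \<forall>y z. bipoly 1 (\<lambda>i j. ez i j x) y z \<noteq> 0 \<longrightarrow>
        F x (F' x y z) (G' x y z) = y \<and> G x (F' x y z) (G' x y z) = z"
      by (simp only: F_def G_def F'_def G'_def) (auto intro!: always_eventually)
  qed (rule mer | simp add: ez_def)+
  moreover have "transforms_into D F G (hamiltonian_system (H_D7 \<eta> \<kappa> \<kappa>i)) (bg_D7 \<eta> \<kappa> q)"
    unfolding transforms_into_def
  \<comment> \<open>The excluded curves are y3 = 0, where the Hamiltonian has its pole, and y3 = q,
    where z = 0 and y cannot be recovered.\<close>
  proof (rule genericallyI[where e = e2 and n = 2 and i = 2 and j = 0])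
    show "\<forall>\<^sub>\<approx>x\<in>D. \<forall>y0 z0. bipoly 2 (\<lambda>i j. e2 i j x) y0 z0 \<noteq> 0 \<longrightarrow>
         (\<forall>y z. y x = y0 \<and> z x = z0 \<and> solution_near (hamiltonian_system (H_D7 \<eta> \<kappa> \<kappa>i)) y z x \<longrightarrow>
            solution_near (bg_D7 \<eta> \<kappa> q) (\<lambda>t. F t (y t) (z t)) (\<lambda>t. G t (y t) (z t)) x)"
      using pts
    proof eventually_elim
      case (elim x)
      show ?case
        unfolding b2 F_def G_def using hamiltonian_to_bg[OF elim] by auto
    qed
  qed (rule mer | simp add: e2_def)+
  moreover have "transforms_into D F' G' (bg_D7 \<eta> \<kappa> q) (hamiltonian_system (H_D7 \<eta> \<kappa> \<kappa>i))"
    unfolding transforms_into_def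
  proof (rule genericallyI[where e = cF' and n = 1 and i = 0 and j = 1])
    show "\<forall>\<^sub>\<approx>x\<in>D. \<forall>y0 z0. bipoly 1 (\<lambda>i j. cF' i j x) y0 z0 \<noteq> 0 \<longrightarrow>
         (\<forall>y z. y x = y0 \<and> z x = z0 \<and> solution_near (bg_D7 \<eta> \<kappa> q) y z x \<longrightarrow>
            solution_near (hamiltonian_system (H_D7 \<eta> \<kappa> \<kappa>i)) (\<lambda>t. F' t (y t) (z t)) (\<lambda>t. G' t (y t) (z t)) x)"
      using pts
    proof eventually_elim
      case (elim x)
      have "bipoly 1 (\<lambda>i j. cF' i j x) y z = z + q x" for y z
        unfolding bipoly_1 by (simp add: cF'_def add.commute)
      then show ?case
        unfolding F'_def G'_def using bg_to_hamiltonian[OF elim] by auto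
    qed
  qed (rule mer | simp add: cF'_def)+
  ultimately show ?thesis
    unfolding birationally_equivalent_def by blast
qed

theorem proposition3p3:
  fixes \<eta>\<^sub>i \<kappa>\<^sub>0 \<kappa>\<^sub>i :: complex
    and D :: "complex set"
    and q :: "complex \<Rightarrow> complex"
  assumes "\<eta>\<^sub>i * \<kappa>\<^sub>0 \<noteq> 0"
    and "domain_in_C D"
    and "solves_PIII (- 4 * \<kappa>\<^sub>i * \<eta>\<^sub>i) (4 * \<kappa>\<^sub>0) (4 * \<eta>\<^sub>i\<^sup>2) 0 D q"
  shows "(\<forall>\<^sub>\<approx>x\<in>D. \<forall>y z y3 z3.
           (\<forall>\<^sub>F t in nhds x. y3 t = z t + q t \<and>
              z3 t = y t * z t + t * \<eta>\<^sub>i / 2 + t * deriv q t / (4 * (q t)\<^sup>2) + 1 / (4 * q t)) \<and>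
           z x \<noteq> 0 \<and> y3 x \<noteq> 0 \<longrightarrow>
           (solution_near (hamiltonian_system (H_D7 \<eta>\<^sub>i \<kappa>\<^sub>0 \<kappa>\<^sub>i)) y3 z3 x \<longleftrightarrow>
            solution_near (bg_D7 \<eta>\<^sub>i \<kappa>\<^sub>0 q) y z x)) \<and>
         bureau_guillot D (solves_PIII (- 4 * \<kappa>\<^sub>i * \<eta>\<^sub>i) (4 * \<kappa>\<^sub>0) (4 * \<eta>\<^sub>i\<^sup>2) 0)
           (hamiltonian_system (H_D7 \<eta>\<^sub>i \<kappa>\<^sub>0 \<kappa>\<^sub>i)) (bg_D7 \<eta>\<^sub>i \<kappa>\<^sub>0) q"
proof
  have D: "open D" using assms(2) by (simp add: domain_in_C_def)
  have nz: "\<eta>\<^sub>i \<noteq> 0" "\<kappa>\<^sub>0 \<noteq> 0" using assms(1) by auto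
  have mq: "q meromorphic_on D" and q0: "\<forall>\<^sub>\<approx>x\<in>D. q x \<noteq> 0"
    using assms(3) by (auto simp: solves_PIII_def elim: eventually_mono)
  show "bureau_guillot D (solves_PIII (- 4 * \<kappa>\<^sub>i * \<eta>\<^sub>i) (4 * \<kappa>\<^sub>0) (4 * \<eta>\<^sub>i\<^sup>2) 0)
           (hamiltonian_system (H_D7 \<eta>\<^sub>i \<kappa>\<^sub>0 \<kappa>\<^sub>i)) (bg_D7 \<eta>\<^sub>i \<kappa>\<^sub>0) q"
    unfolding bureau_guillot_def
    using assms(3) birationally_equivalent_bg[OF D assms(3)] coefficients_bg[OF mq D q0]
      regularising_conditions_bg[OF nz] PIII_reg_cond by blast
  show "\<forall>\<^sub>\<approx>x\<in>D. \<forall>y z y3 z3.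
           (\<forall>\<^sub>F t in nhds x. y3 t = z t + q t \<and>
              z3 t = y t * z t + t * \<eta>\<^sub>i / 2 + t * deriv q t / (4 * (q t)\<^sup>2) + 1 / (4 * q t)) \<and>
           z x \<noteq> 0 \<and> y3 x \<noteq> 0 \<longrightarrow>
           (solution_near (hamiltonian_system (H_D7 \<eta>\<^sub>i \<kappa>\<^sub>0 \<kappa>\<^sub>i)) y3 z3 x \<longleftrightarrow>
            solution_near (bg_D7 \<eta>\<^sub>i \<kappa>\<^sub>0 q) y z x)"
    using PIII_regular_points[OF assms(3) D]
  proof eventually_elim
    case (elim x)
    show ?case
    proof (intro allI impI, elim conjE)
      fix y z y3 z3
      assume "\<forall>\<^sub>F t in nhds x. y3 t = z t + q t \<and>
              z3 t = y t * z t + t * \<eta>\<^sub>i / 2 + t * deriv q t / (4 * (q t)\<^sup>2) + 1 / (4 * q t)"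
        and nz: "z x \<noteq> 0" "y3 x \<noteq> 0"
      then have ev: "\<forall>\<^sub>F t in nhds x. y3 t = z t + q t \<and> z3 t = y t * z t + shift_z3 \<eta>\<^sub>i q t"
        by (simp add: shift_z3_def add.assoc)
      then have x: "y3 x = z x + q x" by (auto dest: eventually_nhds_x_imp_x)
      show "solution_near (hamiltonian_system (H_D7 \<eta>\<^sub>i \<kappa>\<^sub>0 \<kappa>\<^sub>i)) y3 z3 x \<longleftrightarrow>
            solution_near (bg_D7 \<eta>\<^sub>i \<kappa>\<^sub>0 q) y z x"
      proof
        assume sol: "solution_near (hamiltonian_system (H_D7 \<eta>\<^sub>i \<kappa>\<^sub>0 \<kappa>\<^sub>i)) y3 z3 x"
        \<comment> \<open>By continuity z = y3 - q stays nonzero near x, so the quotient recovers y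
          there.\<close>
        have "\<forall>\<^sub>F t in nhds x. y3 t - q t \<noteq> 0"
          by (rule isCont_eventually_nonzero[OF isCont_diff[OF solution_near_continuous(1)[OF sol] q_isCont[OF elim]]])
            (use nz x in simp)
        with ev have "\<forall>\<^sub>F t in nhds x. (z3 t - shift_z3 \<eta>\<^sub>i q t) / (y3 t - q t) = y t \<and> y3 t - q t = z t"
          by eventually_elim auto
        moreover have "solution_near (bg_D7 \<eta>\<^sub>i \<kappa>\<^sub>0 q) (\<lambda>t. (z3 t - shift_z3 \<eta>\<^sub>i q t) / (y3 t - q t)) (\<lambda>t. y3 t - q t) x"
          using hamiltonian_to_bg[OF elim sol] nz x by simp
        ultimately show "solution_near (bg_D7 \<eta>\<^sub>i \<kappa>\<^sub>0 q) y z x" by (rule solution_near_cong)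
      next
        assume "solution_near (bg_D7 \<eta>\<^sub>i \<kappa>\<^sub>0 q) y z x"
        then have "solution_near (hamiltonian_system (H_D7 \<eta>\<^sub>i \<kappa>\<^sub>0 \<kappa>\<^sub>i)) (\<lambda>t. z t + q t) (\<lambda>t. y t * z t + shift_z3 \<eta>\<^sub>i q t) x"
          using bg_to_hamiltonian[OF elim] nz x by simp
        moreover have "\<forall>\<^sub>F t in nhds x. z t + q t = y3 t \<and> y t * z t + shift_z3 \<eta>\<^sub>i q t = z3 t"
          using ev by eventually_elim auto
        ultimately show "solution_near (hamiltonian_system (H_D7 \<eta>\<^sub>i \<kappa>\<^sub>0 \<kappa>\<^sub>i)) y3 z3 x"
          by (rule solution_near_cong[rotated])
      qed
    qed
  qed
qed

end
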